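(* Let $p\in(1,\infty)$, $m\ge1$, $0\le u_0\in L^1(\mathbb{R}^N)$, let $-\mathfrak{L}$ be an operator as in the context for which the Green function assumption holds with $A=I-\mathfrak{L}$, and let $u$ be a weak dual solution of $\partial_t u+(-\mathfrak{L})[u^m]=0$ with initial data $u_0$. If the heat kernel of $-\mathfrak{L}$ satisfies $$0\le\mathbb{H}_{-\mathfrak{L}}^{x_0}(x,t)\le C(t)\qquad\text{with}\qquad\int_0^\infty e^{-t}C(t)^{\frac{p-1}{p}}\,dt<\infty,$$ then $u$ is (essentially) bounded on $\mathbb{R}^N\times[\tau,\infty)$ for a.e. $\tau>0$.
   Context: Throughout $N\ge 3$. Operator. $-\mathfrak{L}$ is a linear, symmetric, nonnegative operator which is densely defined, $\mathfrak m$-accretive and Dirichlet in $L^1(\mathbb{R}^N)$: writing $A=-\mathfrak{L}$ with domain $D(A)\subset L^1(\mathbb{R}^N)$, $D(A)$ is dense in $L^1$; $\|u\|_{L^1}\le\|u+\lambda A[u]\|_{L^1}$ for all $u\in D(A)$, $\lambda>0$; the range of $I+\lambda A$ is $L^1(\mathbb{R}^N)$ for all $\lambda>0$; and if $f\in L^1$, $a\le f\le b$ a.e. ($a,b\in\mathbb{R}$), then $a\le(I+\lambda A)^{-1}f\le b$ a.e. Heat kernel. $\mathbb{H}_{-\mathfrak{L}}^{x_0}(x,t)=\mathbb{H}_{-\mathfrak{L}}^{0}(x-x_0,t)$ is the symmetric nonnegative convolution kernel of the contraction semigroup on $L^1(\mathbb{R}^N)$ generated by $\mathfrak{L}$ (i.e.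 of the solution operator of $\partial_tu+(-\mathfrak{L})[u]=0$; it has initial data $\delta_{x_0}$); it satisfies $\int_{\mathbb{R}^N}\mathbb{H}_{-\mathfrak{L}}^{x_0}(x,t)dx\le1$. Green function assumption for an operator $A$: there is a function $\mathbb{G}_A^{x_0}\in L^1_{\rm loc}(\mathbb{R}^N)$ (for each $x_0$) with $0\le\mathbb{G}_A^{x_0}=\mathbb{G}_A^0(\cdot-x_0)=\mathbb{G}_A^0(x_0-\cdot)$ a.e. and $A[\mathbb{G}_A^{x_0}]=\delta_{x_0}$ in $\mathcal D'(\mathbb{R}^N)$. Then $A^{-1}[f](y):=\int_{\mathbb{R}^N}\mathbb{G}_A^0(x-y)f(x)\,dx$ whenever the integral converges. One has $\mathbb{G}_{I-\mathfrak{L}}^{x_0}(x)=\int_0^\infty e^{-t}\mathbb{H}_{-\mathfrak{L}}^{x_0}(x,t)\,dt$. Weak dual solution (resolvent form, used because the equation is equivalent to $\partial_tu+(I-\mathfrak{L})[u^m]=u^m$) in $\mathbb{R}^N\times(0,T)$ with $u(\cdot,0)=u_0$: a nonnegative measurable $u$ such that (i) $u\in C([0,T];L^1(\mathbb{R}^N))$ and $u^m\in L^1((0,T);L^1_{\rm loc}(\mathbb{R}^N))$; (ii) for a.e. $0<\tau_1\le\tau_2\le T$ and all $\psi\in C^1_{\rm c}([\tau_1,\tau_2];L^\infty_{\rm c}(\mathbb{R}^N))$ ($L_{\rm c}^\infty$: bounded functions with compact support), the integrals being well defined, $$\int_{\tau_1}^{\tau_2}\!\!\int_{\mathbb{R}^N}\big((I-\mathfrak{L})^{-1}[u]\partial_t\psi-u^m\psi+u^m(I-\mathfrak{L})^{-1}[\psi]\big)dx\,dt=\int_{\mathbb{R}^N}(I-\mathfrak{L})^{-1}[u(\cdot,\tau_2)]\psi(\cdot,\tau_2)dx-\int_{\mathbb{R}^N}(I-\mathfrak{L})^{-1}[u(\cdot,\tau_1)]\psi(\cdot,\tau_1)dx;$$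 (iii) $u(\cdot,0)=u_0$ a.e. Here $u$ is a weak dual solution for every $T>0$. (For $m=1$, $u$ is the solution given by the semigroup.) Standing assumption: the comparison principle ($u_0\le v_0$ a.e. implies $u\le v$ a.e.) and $L^p$-decay ($\|u(\cdot,\tau_2)\|_{L^r}\le\|u(\cdot,\tau_1)\|_{L^r}$ for $r\in[1,\infty]$ and a.e. $0\le\tau_1\le\tau_2$) hold for solutions of the equation. *)

theory Defs
  imports "HOL-Analysis.Analysis" "HOL-Probability.Essential_Supremum"
begin

section \<open>Lebesgue spaces\<close>

text \<open>
  The elements of \<open>L^1\<close> are represented by integrable functions; identities between them are
  stated almost everywhere, and operators are required to respect almost everywhere equality.
\<close>

definition L1 :: "('a::euclidean_space \<Rightarrow> real) set" where
  "L1 = {f. integrable lborel f}"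

definition L1_norm :: "('a::euclidean_space \<Rightarrow> real) \<Rightarrow> real" where
  "L1_norm f = (LBINT x. \<bar>f x\<bar>)"

definition L1_loc :: "('a::euclidean_space \<Rightarrow> real) set" where
  "L1_loc = {f. \<forall>K. compact K \<longrightarrow> set_integrable lborel K f}"

text \<open>The \<open>L^r\<close> norm with values in \<open>[0,\<infinity>]\<close>, for \<open>r \<in> [1,\<infinity>]\<close>.\<close>

definition Lr_norm :: "ennreal \<Rightarrow> ('a::euclidean_space \<Rightarrow> real) \<Rightarrow> ennreal" where
  "Lr_norm r f =
    (if r = top then esssup lborel (\<lambda>x. ennreal \<bar>f x\<bar>)
     else let I = (\<integral>\<^sup>+x. ennreal (\<bar>f x\<bar> powr enn2real r) \<partial>lborel) in
       if I = top then top else ennreal (enn2real I powr (1 / enn2real r)))"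

lemma Lr_norm_1: "f \<in> L1 \<Longrightarrow> Lr_norm 1 f = ennreal (L1_norm f)"
  by (simp add: Lr_norm_def L1_def L1_norm_def nn_integral_eq_integral)

definition Linf :: "('a::euclidean_space \<Rightarrow> real) set" where
  "Linf = {f \<in> borel_measurable lborel. Lr_norm top f < top}"

text \<open>\<open>u \<in> C(I; L^1)\<close>\<close>

definition L1_continuous_on :: "real set \<Rightarrow> (real \<Rightarrow> 'a::euclidean_space \<Rightarrow> real) \<Rightarrow> bool" where
  "L1_continuous_on I u \<longleftrightarrow>
    (\<forall>t\<in>I. u t \<in> L1) \<and>
    (\<forall>t\<in>I. ((\<lambda>s. L1_norm (\<lambda>x. u s x - u t x)) \<longlongrightarrow> 0) (at t within I))"


section \<open>The operator\<close>

text \<open>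
  An unbounded linear operator on \<open>L^1\<close> with domain \<open>D\<close>. Values of \<open>A\<close> outside \<open>D\<close> are
  irrelevant.
\<close>

definition linear_operator_L1 ::
  "('a::euclidean_space \<Rightarrow> real) set \<Rightarrow> (('a \<Rightarrow> real) \<Rightarrow> 'a \<Rightarrow> real) \<Rightarrow> bool" where
  "linear_operator_L1 D A \<longleftrightarrow>
    D \<subseteq> L1 \<and> A ` D \<subseteq> L1 \<and> (\<lambda>x. 0) \<in> D \<and>
    (\<forall>f\<in>D. \<forall>g\<in>L1. (AE x in lborel. f x = g x) \<longrightarrow>
       g \<in> D \<and> (AE x in lborel. A f x = A g x)) \<and>
    (\<forall>f\<in>D. \<forall>g\<in>D. \<forall>a b. (\<lambda>x. a * f x + b * g x) \<in> D \<and>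
       (AE x in lborel. A (\<lambda>x. a * f x + b * g x) x = a * A f x + b * A g x))"

text \<open>
  Symmetry and nonnegativity of an operator on \<open>L^1\<close> are tested on \<open>D \<inter> L^\<infinity>\<close>, where the
  pairings are integrable.
\<close>

definition symmetric_operator ::
  "('a::euclidean_space \<Rightarrow> real) set \<Rightarrow> (('a \<Rightarrow> real) \<Rightarrow> 'a \<Rightarrow> real) \<Rightarrow> bool" where
  "symmetric_operator D A \<longleftrightarrow>
    (\<forall>u\<in>D \<inter> Linf. \<forall>v\<in>D \<inter> Linf. (LBINT x. A u x * v x) = (LBINT x. u x * A v x))"

definition nonnegative_operator ::
  "('a::euclidean_space \<Rightarrow> real) set \<Rightarrow> (('a \<Rightarrow> real) \<Rightarrow> 'a \<Rightarrow> real) \<Rightarrow> bool" where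
  "nonnegative_operator D A \<longleftrightarrow> (\<forall>u\<in>D \<inter> Linf. 0 \<le> (LBINT x. A u x * u x))"

definition densely_defined :: "('a::euclidean_space \<Rightarrow> real) set \<Rightarrow> bool" where
  "densely_defined D \<longleftrightarrow> (\<forall>f\<in>L1. \<forall>\<epsilon>>0. \<exists>u\<in>D. L1_norm (\<lambda>x. f x - u x) < \<epsilon>)"

definition m_accretive ::
  "('a::euclidean_space \<Rightarrow> real) set \<Rightarrow> (('a \<Rightarrow> real) \<Rightarrow> 'a \<Rightarrow> real) \<Rightarrow> bool" where
  "m_accretive D A \<longleftrightarrow>
    (\<forall>u\<in>D. \<forall>\<mu>>0. L1_norm u \<le> L1_norm (\<lambda>x. u x + \<mu> * A u x)) \<and>
    (\<forall>\<mu>>0. \<forall>f\<in>L1. \<exists>u\<in>D. AE x in lborel. u x + \<mu> * A u x = f x)"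

text \<open>Here \<open>u\<close> is the resolvent \<open>(I + \<mu>A)\<^sup>-\<^sup>1 f\<close>.\<close>

definition Dirichlet_operator ::
  "('a::euclidean_space \<Rightarrow> real) set \<Rightarrow> (('a \<Rightarrow> real) \<Rightarrow> 'a \<Rightarrow> real) \<Rightarrow> bool" where
  "Dirichlet_operator D A \<longleftrightarrow>
    (\<forall>\<mu>>0. \<forall>f\<in>L1. \<forall>u\<in>D. \<forall>a b.
       (AE x in lborel. u x + \<mu> * A u x = f x) \<longrightarrow>
       (AE x in lborel. a \<le> f x \<and> f x \<le> b) \<longrightarrow>
       (AE x in lborel. a \<le> u x \<and> u x \<le> b))"

definition admissible_operator ::
  "('a::euclidean_space \<Rightarrow> real) set \<Rightarrow> (('a \<Rightarrow> real) \<Rightarrow> 'a \<Rightarrow> real) \<Rightarrow> bool" where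
  "admissible_operator D A \<longleftrightarrow>
    linear_operator_L1 D A \<and> symmetric_operator D A \<and> nonnegative_operator D A \<and>
    densely_defined D \<and> m_accretive D A \<and> Dirichlet_operator D A"


section \<open>Semigroup and heat kernel\<close>

definition contraction_semigroup_L1 ::
  "(real \<Rightarrow> ('a::euclidean_space \<Rightarrow> real) \<Rightarrow> 'a \<Rightarrow> real) \<Rightarrow> bool" where
  "contraction_semigroup_L1 S \<longleftrightarrow>
    (\<forall>t\<ge>0. \<forall>f\<in>L1. S t f \<in> L1 \<and> L1_norm (S t f) \<le> L1_norm f) \<and>
    (\<forall>t\<ge>0. \<forall>f\<in>L1. \<forall>g\<in>L1. \<forall>a b. AE x in lborel.
       S t (\<lambda>x. a * f x + b * g x) x = a * S t f x + b * S t g x) \<and>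
    (\<forall>f\<in>L1. AE x in lborel. S 0 f x = f x) \<and>
    (\<forall>s\<ge>0. \<forall>t\<ge>0. \<forall>f\<in>L1. AE x in lborel. S (s + t) f x = S s (S t f) x) \<and>
    (\<forall>f\<in>L1. ((\<lambda>t. L1_norm (\<lambda>x. S t f x - f x)) \<longlongrightarrow> 0) (at_right 0))"

text \<open>The infinitesimal generator of \<open>S\<close> is \<open>L\<close>, with domain exactly \<open>D\<close>.\<close>

definition is_generator ::
  "('a::euclidean_space \<Rightarrow> real) set \<Rightarrow> (('a \<Rightarrow> real) \<Rightarrow> 'a \<Rightarrow> real) \<Rightarrow>
   (real \<Rightarrow> ('a \<Rightarrow> real) \<Rightarrow> 'a \<Rightarrow> real) \<Rightarrow> bool" where
  "is_generator D L S \<longleftrightarrow>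
    (\<forall>f\<in>L1. \<forall>g\<in>L1.
       (f \<in> D \<and> (AE x in lborel. L f x = g x)) \<longleftrightarrow>
       ((\<lambda>h. L1_norm (\<lambda>x. (S h f x - f x) / h - g x)) \<longlongrightarrow> 0) (at_right 0))"

text \<open>
  \<open>H t x\<^sub>0 x\<close> is the heat kernel of \<open>A\<close> with pole \<open>x\<^sub>0\<close>, for \<open>t > 0\<close>. The generator of the
  semigroup is \<open>-A\<close>; its strong continuity at \<open>0\<close> encodes the initial datum \<open>\<delta>\<close> at \<open>x\<^sub>0\<close>.
\<close>

definition heat_kernel ::
  "('a::euclidean_space \<Rightarrow> real) set \<Rightarrow> (('a \<Rightarrow> real) \<Rightarrow> 'a \<Rightarrow> real) \<Rightarrow>
   (real \<Rightarrow> 'a \<Rightarrow> 'a \<Rightarrow> real) \<Rightarrow> bool" where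
  "heat_kernel D A H \<longleftrightarrow>
    set_borel_measurable lborel ({0<..} \<times> UNIV) (\<lambda>(t, x). H t 0 x) \<and>
    (\<forall>t>0. \<forall>x\<^sub>0 x. H t x\<^sub>0 x = H t 0 (x - x\<^sub>0)) \<and>
    (\<forall>t>0. AE x in lborel. 0 \<le> H t 0 x) \<and>
    (\<forall>t>0. AE x in lborel. H t 0 (- x) = H t 0 x) \<and>
    (\<forall>t>0. integrable lborel (H t 0) \<and> (LBINT x. H t 0 x) \<le> 1) \<and>
    (\<exists>S. contraction_semigroup_L1 S \<and> is_generator D (\<lambda>f x. - A f x) S \<and>
       (\<forall>t>0. \<forall>f\<in>L1. AE x in lborel. S t f x = (LBINT y. H t y x * f y)))"


section \<open>Green function\<close>

primrec C_k :: "nat \<Rightarrow> ('a::euclidean_space \<Rightarrow> real) \<Rightarrow> bool" where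
  "C_k 0 f \<longleftrightarrow> continuous_on UNIV f"
| "C_k (Suc k) f \<longleftrightarrow> (\<forall>x. f differentiable at x) \<and>
     (\<forall>i\<in>Basis. C_k k (\<lambda>x. frechet_derivative f (at x) i))"

definition test_functions :: "('a::euclidean_space \<Rightarrow> real) set" where
  "test_functions = {\<psi>. (\<forall>k. C_k k \<psi>) \<and> (\<exists>K. compact K \<and> (\<forall>x. x \<notin> K \<longrightarrow> \<psi> x = 0))}"

text \<open>
  \<open>A[g] = \<delta>\<close> at \<open>x\<^sub>0\<close> in the sense of distributions: by symmetry \<open>A\<close> is moved to the test
  function. That the pairing makes sense is part of the notion.
\<close>

definition fundamental_solution ::
  "('a::euclidean_space \<Rightarrow> real) set \<Rightarrow> (('a \<Rightarrow> real) \<Rightarrow> 'a \<Rightarrow> real) \<Rightarrow> 'a \<Rightarrow>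
   ('a \<Rightarrow> real) \<Rightarrow> bool" where
  "fundamental_solution D A x\<^sub>0 g \<longleftrightarrow>
    (\<forall>\<psi>\<in>test_functions. \<psi> \<in> D \<and> integrable lborel (\<lambda>x. g x * A \<psi> x) \<and>
       (LBINT x. g x * A \<psi> x) = \<psi> x\<^sub>0)"

definition green_function ::
  "('a::euclidean_space \<Rightarrow> real) set \<Rightarrow> (('a \<Rightarrow> real) \<Rightarrow> 'a \<Rightarrow> real) \<Rightarrow>
   ('a \<Rightarrow> 'a \<Rightarrow> real) \<Rightarrow> bool" where
  "green_function D A G \<longleftrightarrow>
    (\<forall>x\<^sub>0. G x\<^sub>0 \<in> L1_loc \<and>
       (AE x in lborel. 0 \<le> G x\<^sub>0 x) \<and>
       (AE x in lborel. G x\<^sub>0 x = G 0 (x - x\<^sub>0)) \<and>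
       (AE x in lborel. G x\<^sub>0 x = G 0 (x\<^sub>0 - x)) \<and>
       fundamental_solution D A x\<^sub>0 (G x\<^sub>0))"

text \<open>The operator \<open>A\<^sup>-\<^sup>1\<close> associated with the Green function \<open>G\<close> of \<open>A\<close>.\<close>

definition green_inverse ::
  "('a::euclidean_space \<Rightarrow> 'a \<Rightarrow> real) \<Rightarrow> ('a \<Rightarrow> real) \<Rightarrow> 'a \<Rightarrow> real" where
  "green_inverse G f y = (LBINT x. G 0 (x - y) * f x)"


section \<open>Weak dual solutions\<close>

text \<open>
  \<open>\<psi> \<in> C\<^sup>1([a,b]; L^\<infinity>)\<close> with derivative \<open>\<psi>'\<close> and values supported in a common compact set.
\<close>

definition C1_Linf_c ::
  "real \<Rightarrow> real \<Rightarrow> (real \<Rightarrow> 'a::euclidean_space \<Rightarrow> real) \<Rightarrow> (real \<Rightarrow> 'a \<Rightarrow> real) \<Rightarrow> bool" where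
  "C1_Linf_c a b \<psi> \<psi>' \<longleftrightarrow>
    set_borel_measurable lborel ({a..b} \<times> UNIV) (\<lambda>(t, x). \<psi> t x) \<and>
    set_borel_measurable lborel ({a..b} \<times> UNIV) (\<lambda>(t, x). \<psi>' t x) \<and>
    (\<exists>K. compact K \<and> (\<forall>t\<in>{a..b}. AE x in lborel. x \<notin> K \<longrightarrow> \<psi> t x = 0)) \<and>
    (\<forall>t\<in>{a..b}. \<psi> t \<in> Linf \<and> \<psi>' t \<in> Linf \<and>
       ((\<lambda>s. Lr_norm top (\<lambda>x. (\<psi> s x - \<psi> t x) / (s - t) - \<psi>' t x)) \<longlongrightarrow> 0) (at t within {a..b}) \<and>
       ((\<lambda>s. Lr_norm top (\<lambda>x. \<psi>' s x - \<psi>' t x)) \<longlongrightarrow> 0) (at t within {a..b}))"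

text \<open>
  Weak dual solutions (resolvent form) on \<open>(0,T)\<close> of the equation with nonlinearity \<open>u^m\<close>;
  \<open>G\<close> is the Green function of \<open>I - \<LL>\<close>, so that \<open>green_inverse G\<close> is \<open>(I - \<LL>)\<^sup>-\<^sup>1\<close>.
\<close>

definition weak_dual_identity ::
  "('a::euclidean_space \<Rightarrow> 'a \<Rightarrow> real) \<Rightarrow> real \<Rightarrow> (real \<Rightarrow> 'a \<Rightarrow> real) \<Rightarrow> real \<Rightarrow> real \<Rightarrow>
   (real \<Rightarrow> 'a \<Rightarrow> real) \<Rightarrow> (real \<Rightarrow> 'a \<Rightarrow> real) \<Rightarrow> bool" where
  "weak_dual_identity G m u \<tau>\<^sub>1 \<tau>\<^sub>2 \<psi> \<psi>' \<longleftrightarrow>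
    set_integrable lborel ({\<tau>\<^sub>1..\<tau>\<^sub>2} \<times> UNIV) (\<lambda>(t, x). green_inverse G (u t) x * \<psi>' t x) \<and>
    set_integrable lborel ({\<tau>\<^sub>1..\<tau>\<^sub>2} \<times> UNIV) (\<lambda>(t, x). u t x powr m * \<psi> t x) \<and>
    set_integrable lborel ({\<tau>\<^sub>1..\<tau>\<^sub>2} \<times> UNIV) (\<lambda>(t, x). u t x powr m * green_inverse G (\<psi> t) x) \<and>
    integrable lborel (\<lambda>x. green_inverse G (u \<tau>\<^sub>1) x * \<psi> \<tau>\<^sub>1 x) \<and>
    integrable lborel (\<lambda>x. green_inverse G (u \<tau>\<^sub>2) x * \<psi> \<tau>\<^sub>2 x) \<and>
    set_lebesgue_integral lborel ({\<tau>\<^sub>1..\<tau>\<^sub>2} \<times> UNIV)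
      (\<lambda>(t, x). green_inverse G (u t) x * \<psi>' t x - u t x powr m * \<psi> t x
                + u t x powr m * green_inverse G (\<psi> t) x) =
    (LBINT x. green_inverse G (u \<tau>\<^sub>2) x * \<psi> \<tau>\<^sub>2 x) -
    (LBINT x. green_inverse G (u \<tau>\<^sub>1) x * \<psi> \<tau>\<^sub>1 x)"

definition weak_dual_solution ::
  "('a::euclidean_space \<Rightarrow> 'a \<Rightarrow> real) \<Rightarrow> real \<Rightarrow> real \<Rightarrow> ('a \<Rightarrow> real) \<Rightarrow>
   (real \<Rightarrow> 'a \<Rightarrow> real) \<Rightarrow> bool" where
  "weak_dual_solution G m T u\<^sub>0 u \<longleftrightarrow>
    set_borel_measurable lborel ({0..T} \<times> UNIV) (\<lambda>(t, x). u t x) \<and>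
    (\<forall>t\<in>{0..T}. AE x in lborel. 0 \<le> u t x) \<and>
    L1_continuous_on {0..T} u \<and>
    (\<forall>K. compact K \<longrightarrow> set_integrable lborel ({0<..<T} \<times> K) (\<lambda>(t, x). u t x powr m)) \<and>
    (AE (\<tau>\<^sub>1, \<tau>\<^sub>2) in lborel. 0 < \<tau>\<^sub>1 \<and> \<tau>\<^sub>1 \<le> \<tau>\<^sub>2 \<and> \<tau>\<^sub>2 \<le> T \<longrightarrow>
       (\<forall>\<psi> \<psi>'. C1_Linf_c \<tau>\<^sub>1 \<tau>\<^sub>2 \<psi> \<psi>' \<longrightarrow> weak_dual_identity G m u \<tau>\<^sub>1 \<tau>\<^sub>2 \<psi> \<psi>')) \<and>
    (AE x in lborel. u 0 x = u\<^sub>0 x)"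

definition global_weak_dual_solution ::
  "('a::euclidean_space \<Rightarrow> 'a \<Rightarrow> real) \<Rightarrow> real \<Rightarrow> ('a \<Rightarrow> real) \<Rightarrow>
   (real \<Rightarrow> 'a \<Rightarrow> real) \<Rightarrow> bool" where
  "global_weak_dual_solution G m u\<^sub>0 u \<longleftrightarrow> (\<forall>T>0. weak_dual_solution G m T u\<^sub>0 u)"

definition comparison_principle ::
  "('a::euclidean_space \<Rightarrow> 'a \<Rightarrow> real) \<Rightarrow> real \<Rightarrow> bool" where
  "comparison_principle G m \<longleftrightarrow>
    (\<forall>u\<^sub>0 v\<^sub>0 u v. global_weak_dual_solution G m u\<^sub>0 u \<longrightarrow> global_weak_dual_solution G m v\<^sub>0 v \<longrightarrow>
       (AE x in lborel. u\<^sub>0 x \<le> v\<^sub>0 x) \<longrightarrow>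
       (AE (t, x) in lborel. 0 < t \<longrightarrow> u t x \<le> v t x))"

definition Lp_decay ::
  "('a::euclidean_space \<Rightarrow> 'a \<Rightarrow> real) \<Rightarrow> real \<Rightarrow> bool" where
  "Lp_decay G m \<longleftrightarrow>
    (\<forall>u\<^sub>0 u. global_weak_dual_solution G m u\<^sub>0 u \<longrightarrow>
       (\<forall>r\<ge>1. AE (\<tau>\<^sub>1, \<tau>\<^sub>2) in lborel. 0 \<le> \<tau>\<^sub>1 \<and> \<tau>\<^sub>1 \<le> \<tau>\<^sub>2 \<longrightarrow>
          Lr_norm r (u \<tau>\<^sub>2) \<le> Lr_norm r (u \<tau>\<^sub>1)))"

end

theory Submission
  imports Defs
begin

text \<open>
  Write \<open>P\<^sub>t\<close> for the heat semigroup, \<open>G * F = \<integral>\<^sub>0\<^sup>\<infinity> e\<^sup>-\<^sup>s P\<^sub>s F ds\<close> for the Green potential of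
  \<open>I - \<LL>\<close>. For \<open>m = 1\<close> the solution is \<open>P\<^sub>t u\<^sub>0 \<le> C(t) \<parallel>u\<^sub>0\<parallel>\<^sub>1\<close>, and decay of the \<open>L\<^sup>\<infinity>\<close> norm
  gives the claim. Let \<open>m > 1\<close>; by the same decay it suffices to bound \<open>u(a)\<close> for almost every
  \<open>a > 0\<close>. No integrability of \<open>u\<^sup>m\<close> beyond local integrability is available a priori, so the
  usual estimate through \<open>\<parallel>G\<parallel>\<^sub>p\<close> cannot be started; instead an iteration is run with exponents
  below one, for which \<open>u \<in> L\<^sup>1\<close> is enough.

  Fix \<open>a < b\<close> and put \<open>w = \<integral>\<^sub>a\<^sup>b u\<^sup>m dt\<close>. Homogeneity of the equation and the comparison principle
  make \<open>t \<mapsto> t\<^bsup>1/(m-1)\<^esup> u(t)\<close> nondecreasing (\<open>time_monotonicity\<close>), so that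
  \<open>u(a)\<^sup>m \<le> k w\<close> and \<open>w\<^bsup>1/m\<^esup> \<le> K u(b) \<in> L\<^sup>1\<close>. The weak dual formulation, tested with indicators of
  bounded sets, reads \<open>W := w + G * u(b) = G * (w + u(a))\<close> almost everywhere
  (\<open>accumulated_power_identity\<close>). The second form of \<open>W\<close> has two consequences. As a potential, \<open>W\<close>
  is excessive, \<open>P\<^sub>t W \<le> e\<^sup>t W\<close>. And since \<open>u(a) \<le> 1 + k w\<close>, also \<open>W \<le> (1 + k) G * W + 1\<close>. The first
  form gives, with \<open>q = 1/m\<close>, the bound \<open>P\<^sub>s(W\<^sup>q) \<le> A (C(s) + 1)\<close>. For simplicity \<open>W\<close> is replaced by
  \<open>V = W + 1 \<ge> 1\<close>, for which the same estimates hold up to constants.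

  Hoelder's inequality interpolates the bounds for \<open>P\<^sub>s V\<close> and \<open>P\<^sub>s(V\<^sup>q)\<close>: with
  \<open>a\<^sub>k = 1 - (1 - q)\<^sup>k\<close>,
  \<open>P\<^sub>s(V\<^bsup>a(k+1)\<^esup>) \<le> (e\<^sup>s V)\<^bsup>a(k)\<^esup> (A (C(s) + 1))\<^bsup>1-a(k)\<^esup>\<close>. Iterating along times \<open>s\<^sub>k\<close> with finite
  sum, the constants stay bounded because \<open>1 - a\<^sub>k = (1 - q)\<^sup>k\<close> decays geometrically, while the
  integrability of \<open>e\<^sup>-\<^sup>t C(t)\<^bsup>(p-1)/p\<^esup>\<close> provides \<open>s\<^sub>k\<close> for which \<open>C(s\<^sub>k)\<close> grows at most
  geometrically. As \<open>a\<^sub>k \<rightarrow> 1\<close> this yields \<open>P\<^sub>T V \<le> B\<close> for every \<open>T > 0\<close>, with \<open>B\<close> depending on \<open>T\<close>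
  (\<open>kernel_op_excessive_bounded\<close>). Splitting the potential at time \<open>T\<close> then gives
  \<open>V \<le> \<Lambda> (T V + B) + c\<close>, and \<open>\<Lambda> T \<le> 1/2\<close> bounds \<open>V\<close>, hence \<open>w\<close>, hence \<open>u(a)\<close>
  (\<open>excessive_bounded_of_le_potential\<close>).
\<close>

section \<open>Lebesgue measure\<close>

lemma nn_integral_lborel_reflect:
  fixes f :: "'a::euclidean_space \<Rightarrow> ennreal"
  assumes [measurable]: "f \<in> borel_measurable borel"
  shows "(\<integral>\<^sup>+y. f (x - y) \<partial>lborel) = (\<integral>\<^sup>+y. f y \<partial>lborel)"
proof -
  have "(\<integral>\<^sup>+y. f y \<partial>lborel) = (\<integral>\<^sup>+y. f y \<partial>(density (distr lborel borel (\<lambda>y. x + (-1) *\<^sub>R y)) (\<lambda>_. \<bar>-1::real\<bar>^DIM('a))))"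
    by (rule arg_cong2[where f=nn_integral, OF lborel_affine refl]) simp
  also have "\<dots> = (\<integral>\<^sup>+y. f (x - y) \<partial>lborel)"
    by (subst nn_integral_density) (auto simp: nn_integral_distr)
  finally show ?thesis by simp
qed

lemma AE_lborel_affine:
  fixes x :: "'a::euclidean_space"
  assumes "AE y in lborel. Q y" and c: "c \<noteq> 0"
  shows "AE y in lborel. Q (x + c *\<^sub>R y)"
proof -
  from assms obtain N where N: "N \<in> null_sets lborel" "{y. \<not> Q y} \<subseteq> N"
    by (auto elim!: AE_E2 AE_E simp: null_sets_def)
  then have [measurable]: "N \<in> sets borel" by auto
  have "0 = emeasure (density (distr lborel borel (\<lambda>y. x + c *\<^sub>R y)) (\<lambda>_. \<bar>c\<bar>^DIM('a))) N"
    using N(1) by (simp flip: lborel_affine[OF c] add: null_sets_def)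
  also have "\<dots> = (\<integral>\<^sup>+y. ennreal (\<bar>c\<bar>^DIM('a)) * indicator N (x + c *\<^sub>R y) \<partial>lborel)"
    by (simp add: emeasure_density nn_integral_distr)
  finally have "AE y in lborel. ennreal (\<bar>c\<bar>^DIM('a)) * indicator N (x + c *\<^sub>R y) = 0"
    by (subst (asm) eq_commute, subst (asm) nn_integral_0_iff_AE) auto
  then show ?thesis
    by eventually_elim (use N(2) c in \<open>auto simp: indicator_def split: if_splits\<close>)
qed

lemma AE_lborel_reflect:
  fixes x :: "'a::euclidean_space"
  assumes "AE y in lborel. Q y"
  shows "AE y in lborel. Q (x - y)"
  using AE_lborel_affine[OF assms, of "-1" x] by simp

lemma AE_lborel_happens:
  assumes "AE x in (lborel :: 'a::euclidean_space measure). P x"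
  shows "\<exists>x. P x"
  by (rule eventually_happens'[OF _ assms]) (simp add: ae_filter_eq_bot_iff)

lemma AE_lborel_happens_between:
  fixes a b :: real
  assumes "AE t in lborel. P t" and ab: "a < b"
  shows "\<exists>t. a < t \<and> t < b \<and> P t"
proof (rule ccontr)
  assume no: "\<not> ?thesis"
  have "AE t in lborel. t \<notin> {a<..<b}"
    using assms(1) by eventually_elim (use no in auto)
  then have "emeasure lborel {a<..<b} = 0"
    by (subst (asm) AE_iff_measurable[of "{a<..<b}"]) auto
  then show False using ab by simp
qed

lemma AE_lborel_snd:
  assumes "AE x in (lborel :: 'a::euclidean_space measure). Q x"
  shows "AE z in (lborel :: (real \<times> 'a) measure). Q (snd z)"
proof -
  from assms obtain N where N: "N \<in> null_sets lborel" "{y. \<not> Q y} \<subseteq> N"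
    by (auto elim!: AE_E2 AE_E simp: null_sets_def)
  have "UNIV \<times> N \<in> null_sets ((lborel :: real measure) \<Otimes>\<^sub>M lborel)"
    by (rule sigma_finite_measure.times_in_null_sets2[OF sigma_finite_lborel]) (use N in auto)
  then have "UNIV \<times> N \<in> null_sets (lborel :: (real \<times> 'a) measure)"
    unfolding lborel_prod .
  then show ?thesis by (rule AE_I') (use N(2) in auto)
qed

lemma AE_eq_of_nn_integral_bounded_sets:
  fixes f g :: "'a::euclidean_space \<Rightarrow> ennreal"
  assumes [measurable]: "f \<in> borel_measurable borel" "g \<in> borel_measurable borel"
    and eq: "\<And>B. B \<in> sets borel \<Longrightarrow> bounded B \<Longrightarrow> (\<integral>\<^sup>+x\<in>B. f x \<partial>lborel) = (\<integral>\<^sup>+x\<in>B. g x \<partial>lborel)"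
  shows "AE x in lborel. f x = g x"
proof -
  have "AE x in lborel. f x * indicator (cball 0 (real n)) x = g x * indicator (cball 0 (real n)) x" for n :: nat
  proof (rule sigma_finite_measure.density_unique2[OF sigma_finite_lborel])
    fix A :: "'a set" assume "A \<in> sets lborel"
    then have [measurable]: "A \<in> sets borel" by simp
    have "(\<integral>\<^sup>+x\<in>cball 0 (real n) \<inter> A. f x \<partial>lborel) = (\<integral>\<^sup>+x\<in>cball 0 (real n) \<inter> A. g x \<partial>lborel)"
      by (rule eq) (auto intro: bounded_subset[OF bounded_cball])
    then show "(\<integral>\<^sup>+x\<in>A. (f x * indicator (cball 0 (real n)) x) \<partial>lborel) = (\<integral>\<^sup>+x\<in>A. (g x * indicator (cball 0 (real n)) x) \<partial>lborel)"
      by (simp add: indicator_inter_arith mult.assoc)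
  next
    have [measurable]: "(indicator (cball 0 (real n)) :: 'a \<Rightarrow> ennreal) \<in> borel_measurable borel"
      by (rule borel_measurable_indicator) simp
    show "(\<lambda>x. f x * indicator (cball 0 (real n)) x) \<in> borel_measurable lborel"
      "(\<lambda>x. g x * indicator (cball 0 (real n)) x) \<in> borel_measurable lborel"
      by measurable
  qed
  then have "AE x in lborel. \<forall>n::nat. f x * indicator (cball 0 (real n)) x = g x * indicator (cball 0 (real n)) x"
    by (simp add: AE_all_countable)
  then show ?thesis
  proof eventually_elim
    case (elim x)
    obtain n :: nat where "norm x \<le> real n" using real_arch_simple by blast
    then show ?case using elim[rule_format, of n] by simp
  qed
qed

lemma nn_integral_finite_on_balls_AE:
  fixes f :: "'a::euclidean_space \<Rightarrow> ennreal"
  assumes [measurable]: "f \<in> borel_measurable borel"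
    and fin: "\<And>B. B \<in> sets borel \<Longrightarrow> bounded B \<Longrightarrow> (\<integral>\<^sup>+x\<in>B. f x \<partial>lborel) < \<infinity>"
  shows "AE x in lborel. f x \<noteq> \<infinity>"
proof -
  have "AE x in lborel. f x * indicator (cball 0 (real n)) x \<noteq> \<infinity>" for n :: nat
  proof (rule nn_integral_noteq_infinite)
    show "(\<integral>\<^sup>+x\<in>cball 0 (real n). f x \<partial>lborel) \<noteq> \<infinity>"
      using fin[of "cball 0 (real n)"] by auto
    have [measurable]: "(indicator (cball 0 (real n)) :: 'a \<Rightarrow> ennreal) \<in> borel_measurable borel"
      by (rule borel_measurable_indicator) simp
    show "(\<lambda>x. f x * indicator (cball 0 (real n)) x) \<in> borel_measurable lborel" by measurable
  qed
  then have "AE x in lborel. \<forall>n::nat. f x * indicator (cball 0 (real n)) x \<noteq> \<infinity>"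
    by (simp add: AE_all_countable)
  then show ?thesis
  proof eventually_elim
    case (elim x)
    obtain n :: nat where "norm x \<le> real n" using real_arch_simple by blast
    then show ?case using elim[rule_format, of n] by simp
  qed
qed


section \<open>Convolution with nonnegative kernels\<close>

text \<open>
  Convolution \<open>k * f\<close>. Values in \<open>[0,\<infinity>]\<close> avoid all questions of integrability.
\<close>

definition kernel_op :: "('a::euclidean_space \<Rightarrow> ennreal) \<Rightarrow> ('a \<Rightarrow> ennreal) \<Rightarrow> 'a \<Rightarrow> ennreal" where
  "kernel_op k f x = (\<integral>\<^sup>+y. k (x - y) * f y \<partial>lborel)"

lemma kernel_op_measurable [measurable]:
  assumes [measurable]: "k \<in> borel_measurable borel" "f \<in> borel_measurable borel"
  shows "kernel_op k f \<in> borel_measurable borel"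
  unfolding kernel_op_def[abs_def] by measurable

lemma kernel_op_mono:
  assumes "AE y in lborel. f y \<le> g y"
  shows "kernel_op k f x \<le> kernel_op k g x"
  unfolding kernel_op_def
  by (rule nn_integral_mono_AE) (use assms in eventually_elim, auto intro: mult_left_mono)

lemma kernel_op_cong:
  assumes "AE y in lborel. f y = g y"
  shows "kernel_op k f x = kernel_op k g x"
  by (intro antisym kernel_op_mono; use assms in eventually_elim; simp)

lemma kernel_op_cong_kernel:
  assumes "AE y in lborel. k y = l y"
  shows "kernel_op k f x = kernel_op l f x"
  unfolding kernel_op_def
  by (rule nn_integral_cong_AE) (use AE_lborel_reflect[OF assms, of x] in eventually_elim, auto)

lemma kernel_op_add:
  assumes [measurable]: "k \<in> borel_measurable borel" "f \<in> borel_measurable borel" "g \<in> borel_measurable borel"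
  shows "kernel_op k (\<lambda>y. f y + g y) x = kernel_op k f x + kernel_op k g x"
  unfolding kernel_op_def by (simp add: distrib_left nn_integral_add)

lemma kernel_op_cmult:
  assumes [measurable]: "k \<in> borel_measurable borel" "f \<in> borel_measurable borel"
  shows "kernel_op k (\<lambda>y. c * f y) x = c * kernel_op k f x"
  unfolding kernel_op_def by (simp add: nn_integral_cmult mult.left_commute[of _ c])

lemma kernel_op_const_le:
  assumes [measurable]: "k \<in> borel_measurable borel" and "(\<integral>\<^sup>+y. k y \<partial>lborel) \<le> 1"
  shows "kernel_op k (\<lambda>_. c) x \<le> c"
proof -
  have "kernel_op k (\<lambda>_. c) x = (\<integral>\<^sup>+y. k y \<partial>lborel) * c"
    unfolding kernel_op_def by (simp add: nn_integral_multc nn_integral_lborel_reflect)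
  also have "\<dots> \<le> 1 * c" by (intro mult_right_mono assms) auto
  finally show ?thesis by simp
qed

lemma kernel_op_le_bound:
  assumes [measurable]: "f \<in> borel_measurable borel" and "AE y in lborel. k y \<le> C"
  shows "kernel_op k f x \<le> C * (\<integral>\<^sup>+y. f y \<partial>lborel)"
proof -
  have "kernel_op k f x \<le> (\<integral>\<^sup>+y. C * f y \<partial>lborel)"
    unfolding kernel_op_def
    by (rule nn_integral_mono_AE)
       (use AE_lborel_reflect[OF assms(2), of x] in eventually_elim, auto intro: mult_right_mono)
  then show ?thesis by (simp add: nn_integral_cmult)
qed

lemma kernel_op_symmetric:
  assumes [measurable]: "k \<in> borel_measurable borel" "f \<in> borel_measurable borel" "g \<in> borel_measurable borel"
    and even: "AE y in lborel. k (- y) = k y"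
  shows "(\<integral>\<^sup>+x. f x * kernel_op k g x \<partial>lborel) = (\<integral>\<^sup>+x. g x * kernel_op k f x \<partial>lborel)"
proof -
  have ev: "AE y in lborel. k (x - y) = k (y - x)" for x
    using AE_lborel_reflect[OF even, of x] by eventually_elim (auto simp: algebra_simps)
  have swap: "(\<integral>\<^sup>+y. f x * (k (x - y) * g y) \<partial>lborel) = (\<integral>\<^sup>+y. f x * (k (y - x) * g y) \<partial>lborel)" for x
    by (rule nn_integral_cong_AE) (use ev[of x] in eventually_elim, auto)
  have "(\<integral>\<^sup>+x. f x * kernel_op k g x \<partial>lborel) = (\<integral>\<^sup>+x. \<integral>\<^sup>+y. f x * (k (x - y) * g y) \<partial>lborel \<partial>lborel)"
    unfolding kernel_op_def by (simp add: nn_integral_cmult)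
  also have "\<dots> = (\<integral>\<^sup>+x. \<integral>\<^sup>+y. f x * (k (y - x) * g y) \<partial>lborel \<partial>lborel)"
    by (simp only: swap)
  also have "\<dots> = (\<integral>\<^sup>+y. \<integral>\<^sup>+x. f x * (k (y - x) * g y) \<partial>lborel \<partial>lborel)"
    by (rule lborel_pair.Fubini') measurable
  also have "\<dots> = (\<integral>\<^sup>+y. \<integral>\<^sup>+x. g y * (k (y - x) * f x) \<partial>lborel \<partial>lborel)"
    by (simp add: mult_ac)
  also have "\<dots> = (\<integral>\<^sup>+x. g x * kernel_op k f x \<partial>lborel)"
    unfolding kernel_op_def by (simp add: nn_integral_cmult)
  finally show ?thesis .
qed

lemma nn_integral_kernel_op_le:
  assumes [measurable]: "k \<in> borel_measurable borel" "f \<in> borel_measurable borel"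
    and even: "AE y in lborel. k (- y) = k y"
    and mass: "(\<integral>\<^sup>+y. k y \<partial>lborel) \<le> 1"
  shows "(\<integral>\<^sup>+x. kernel_op k f x \<partial>lborel) \<le> (\<integral>\<^sup>+x. f x \<partial>lborel)"
proof -
  have "(\<integral>\<^sup>+x. kernel_op k f x \<partial>lborel) = (\<integral>\<^sup>+x. 1 * kernel_op k f x \<partial>lborel)" by simp
  also have "\<dots> = (\<integral>\<^sup>+x. f x * kernel_op k (\<lambda>_. 1) x \<partial>lborel)"
    using even by (subst kernel_op_symmetric) auto
  also have "\<dots> \<le> (\<integral>\<^sup>+x. f x * 1 \<partial>lborel)"
    by (intro nn_integral_mono mult_left_mono kernel_op_const_le) (use mass in auto)
  finally show ?thesis by simp
qed

lemma kernel_op_SUP: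
  fixes f :: "nat \<Rightarrow> 'a::euclidean_space \<Rightarrow> ennreal"
  assumes [measurable]: "k \<in> borel_measurable borel" "\<And>i. f i \<in> borel_measurable borel"
    and "\<And>y. incseq (\<lambda>i. f i y)"
  shows "kernel_op k (\<lambda>y. SUP i. f i y) x = (SUP i. kernel_op k (f i) x)"
proof -
  have "kernel_op k (\<lambda>y. SUP i. f i y) x = (\<integral>\<^sup>+y. (SUP i. k (x - y) * f i y) \<partial>lborel)"
    unfolding kernel_op_def by (simp add: SUP_mult_left_ennreal)
  also have "\<dots> = (SUP i. kernel_op k (f i) x)"
    unfolding kernel_op_def
    by (rule nn_integral_monotone_convergence_SUP)
       (use assms(3) in \<open>auto simp: incseq_def le_fun_def intro!: mult_left_mono\<close>)
  finally show ?thesis .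
qed

text \<open>
  Hoelder's inequality for \<open>V\<close> and \<open>V\<^sup>q\<close>, in terms of upper bounds \<open>\<xi>\<close> and \<open>\<eta>\<close> of the two
  convolutions; obtained by integrating the weighted inequality of arithmetic and geometric means.
\<close>

lemma kernel_op_interpolate:
  fixes V :: "'a::euclidean_space \<Rightarrow> real"
  assumes [measurable]: "k \<in> borel_measurable borel" "V \<in> borel_measurable borel"
    and V: "\<And>y. V y > 0" and a: "0 \<le> a" "a \<le> 1" and pos: "\<xi> > 0" "\<eta> > 0"
    and \<xi>: "kernel_op k (\<lambda>y. ennreal (V y)) x \<le> ennreal \<xi>"
    and \<eta>: "kernel_op k (\<lambda>y. ennreal (V y powr q)) x \<le> ennreal \<eta>"
  shows "kernel_op k (\<lambda>y. ennreal (V y powr (a + (1 - a) * q))) x \<le> ennreal (\<xi> powr a * \<eta> powr (1 - a))"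
proof -
  define Z where "Z = \<xi> powr a * \<eta> powr (1 - a)"
  have Z: "Z > 0" unfolding Z_def using pos by simp
  define c where "c = Z * a / \<xi>"
  define d where "d = Z * (1 - a) / \<eta>"
  have cd: "c \<ge> 0" "d \<ge> 0" unfolding c_def d_def using Z a pos by auto
  have le: "V y powr (a + (1 - a) * q) \<le> c * V y + d * V y powr q" for y
  proof -
    have "V y powr (a + (1 - a) * q) = V y powr a * (V y powr q) powr (1 - a)"
      using V[of y] by (simp add: powr_add powr_powr mult.commute)
    also have "\<dots> = Z * ((V y / \<xi>) powr a * (V y powr q / \<eta>) powr (1 - a))"
      unfolding Z_def using V[of y] pos by (simp add: powr_divide)
    also have "\<dots> \<le> Z * (a * (V y / \<xi>) + (1 - a) * (V y powr q / \<eta>))"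
      using Z a pos V[of y] by (intro mult_left_mono Youngs_inequality_0) auto
    also have "\<dots> = c * V y + d * V y powr q"
      unfolding c_def d_def by (simp add: field_simps)
    finally show ?thesis .
  qed
  have "kernel_op k (\<lambda>y. ennreal (V y powr (a + (1 - a) * q))) x
    \<le> kernel_op k (\<lambda>y. ennreal c * ennreal (V y) + ennreal d * ennreal (V y powr q)) x"
    using le cd V by (intro kernel_op_mono AE_I2)
      (simp add: ennreal_mult[symmetric] ennreal_plus[symmetric] less_imp_le del: ennreal_plus)
  also have "\<dots> = ennreal c * kernel_op k (\<lambda>y. ennreal (V y)) x + ennreal d * kernel_op k (\<lambda>y. ennreal (V y powr q)) x"
    by (simp add: kernel_op_add kernel_op_cmult)
  also have "\<dots> \<le> ennreal c * ennreal \<xi> + ennreal d * ennreal \<eta>"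
    by (intro add_mono mult_left_mono \<xi> \<eta>) auto
  also have "\<dots> = ennreal (c * \<xi> + d * \<eta>)"
    using cd pos by (simp add: ennreal_mult)
  also have "c * \<xi> + d * \<eta> = Z"
    unfolding c_def d_def using pos by (simp add: field_simps)
  finally show ?thesis unfolding Z_def .
qed


section \<open>Sub-Markovian convolution semigroups and potentials\<close>

text \<open>
  A semigroup of symmetric convolution operators of mass at most one.
  Apart from measurability only positive times are constrained; \<open>h t\<close> is irrelevant for \<open>t \<le> 0\<close>.
\<close>

locale sub_markov_semigroup =
  fixes h :: "real \<Rightarrow> 'a::euclidean_space \<Rightarrow> ennreal"
  assumes h_measurable [measurable]: "case_prod h \<in> borel_measurable (borel \<Otimes>\<^sub>M borel)"
    and mass: "t > 0 \<Longrightarrow> (\<integral>\<^sup>+x. h t x \<partial>lborel) \<le> 1"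
    and even: "t > 0 \<Longrightarrow> AE x in lborel. h t (- x) = h t x"
    and semigroup: "s > 0 \<Longrightarrow> t > 0 \<Longrightarrow> f \<in> borel_measurable borel \<Longrightarrow>
      AE x in lborel. kernel_op (h s) (kernel_op (h t) f) x = kernel_op (h (s + t)) f x"
begin

text \<open>
  The resolvent at \<open>1\<close>, \<open>(I - \<LL>)\<^sup>-\<^sup>1 f = \<integral>\<^sub>0\<^sup>\<infinity> e\<^sup>-\<^sup>s P\<^sub>s f ds\<close>.
\<close>

definition potential :: "('a \<Rightarrow> ennreal) \<Rightarrow> 'a \<Rightarrow> ennreal" where
  "potential f x = (\<integral>\<^sup>+s\<in>{0<..}. ennreal (exp (- s)) * kernel_op (h s) f x \<partial>lborel)"

lemma kernel_measurable [measurable]: "h t \<in> borel_measurable borel"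
  by measurable

lemma kernel_op_measurable_pair [measurable]:
  assumes [measurable]: "f \<in> borel_measurable borel"
  shows "(\<lambda>(t, x). kernel_op (h t) f x) \<in> borel_measurable (borel \<Otimes>\<^sub>M borel)"
  unfolding kernel_op_def[abs_def] by measurable

lemma potential_measurable [measurable]:
  assumes [measurable]: "f \<in> borel_measurable borel"
  shows "potential f \<in> borel_measurable borel"
  unfolding potential_def[abs_def] by measurable

lemma potential_mono:
  assumes "AE y in lborel. f y \<le> g y"
  shows "potential f x \<le> potential g x"
  unfolding potential_def
  by (intro nn_integral_mono mult_right_mono mult_left_mono kernel_op_mono assms) auto

lemma potential_add:
  assumes [measurable]: "f \<in> borel_measurable borel" "g \<in> borel_measurable borel"
  shows "potential (\<lambda>y. f y + g y) x = potential f x + potential g x"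
  unfolding potential_def
  by (simp add: kernel_op_add distrib_left distrib_right nn_integral_add)

lemma potential_cmult:
  assumes [measurable]: "f \<in> borel_measurable borel"
  shows "potential (\<lambda>y. c * f y) x = c * potential f x"
  unfolding potential_def
  by (subst nn_integral_cmult[symmetric]) (auto simp: kernel_op_cmult mult_ac intro!: nn_integral_cong)

lemma nn_integral_exp_minus: "(\<integral>\<^sup>+s\<in>{0<..}. ennreal (exp (- s)) \<partial>lborel) = 1"
proof -
  have "(\<integral>\<^sup>+s\<in>{0<..}. ennreal (exp (- s)) \<partial>lborel) = (\<integral>\<^sup>+s. ennreal (exp (- s)) * indicator {0..} s \<partial>lborel)"
    by (rule nn_integral_cong_AE) (use AE_lborel_singleton[of "0::real"] in eventually_elim, auto simp: indicator_def)
  also have "\<dots> = ennreal (0 - (- exp (- 0)))"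
  proof (rule nn_integral_FTC_atLeast)
    show "((\<lambda>s::real. - exp (- s)) \<longlongrightarrow> 0) at_top"
      by (rule tendsto_eq_intros filterlim_compose[OF exp_at_bot] filterlim_uminus_at_bot_at_top | simp)+
  qed (auto intro!: derivative_eq_intros)
  finally show ?thesis by simp
qed

lemma nn_integral_exp_le:
  assumes "\<And>s. s > 0 \<Longrightarrow> F s \<le> c"
  shows "(\<integral>\<^sup>+s\<in>{0<..}. ennreal (exp (- s)) * F s \<partial>lborel) \<le> c"
proof -
  have "(\<integral>\<^sup>+s\<in>{0<..}. ennreal (exp (- s)) * F s \<partial>lborel) \<le> (\<integral>\<^sup>+s. c * (ennreal (exp (- s)) * indicator {0<..} s) \<partial>lborel)"
    by (rule nn_integral_mono) (auto simp: indicator_def mult.commute[of c] intro!: mult_left_mono assms)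
  also have "\<dots> = c" by (subst nn_integral_cmult) (auto simp: nn_integral_exp_minus)
  finally show ?thesis .
qed

lemma potential_const_le: "potential (\<lambda>_. c) x \<le> c"
  unfolding potential_def by (intro nn_integral_exp_le kernel_op_const_le mass) auto

lemma nn_integral_potential:
  assumes [measurable]: "f \<in> borel_measurable borel" "g \<in> borel_measurable borel"
  shows "(\<integral>\<^sup>+x. g x * potential f x \<partial>lborel)
    = (\<integral>\<^sup>+s\<in>{0<..}. ennreal (exp (- s)) * (\<integral>\<^sup>+x. g x * kernel_op (h s) f x \<partial>lborel) \<partial>lborel)"
proof -
  have "(\<integral>\<^sup>+x. g x * potential f x \<partial>lborel)
     = (\<integral>\<^sup>+x. \<integral>\<^sup>+s. g x * (ennreal (exp (- s)) * kernel_op (h s) f x * indicator {0<..} s) \<partial>lborel \<partial>lborel)"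
    unfolding potential_def by (intro nn_integral_cong nn_integral_cmult[symmetric]) measurable
  also have "\<dots> = (\<integral>\<^sup>+s. \<integral>\<^sup>+x. g x * (ennreal (exp (- s)) * kernel_op (h s) f x * indicator {0<..} s) \<partial>lborel \<partial>lborel)"
    by (rule lborel_pair.Fubini'[symmetric]) measurable
  also have "\<dots> = (\<integral>\<^sup>+s. \<integral>\<^sup>+x. (ennreal (exp (- s)) * indicator {0<..} s) * (g x * kernel_op (h s) f x) \<partial>lborel \<partial>lborel)"
    by (intro nn_integral_cong) (simp add: mult_ac)
  also have "\<dots> = (\<integral>\<^sup>+s. (ennreal (exp (- s)) * indicator {0<..} s) * (\<integral>\<^sup>+x. g x * kernel_op (h s) f x \<partial>lborel) \<partial>lborel)"
    by (intro nn_integral_cong nn_integral_cmult) measurable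
  finally show ?thesis by (simp only: mult_ac)
qed

lemma potential_symmetric:
  assumes [measurable]: "f \<in> borel_measurable borel" "g \<in> borel_measurable borel"
  shows "(\<integral>\<^sup>+x. g x * potential f x \<partial>lborel) = (\<integral>\<^sup>+x. f x * potential g x \<partial>lborel)"
  unfolding nn_integral_potential[OF assms] nn_integral_potential[OF assms(2,1)]
proof (rule nn_integral_cong)
  fix s :: real
  show "ennreal (exp (- s)) * (\<integral>\<^sup>+x. g x * kernel_op (h s) f x \<partial>lborel) * indicator {0<..} s
    = ennreal (exp (- s)) * (\<integral>\<^sup>+x. f x * kernel_op (h s) g x \<partial>lborel) * indicator {0<..} s"
    by (cases "s > 0") (simp_all add: kernel_op_symmetric[of "h s" g f] even)
qed

lemma nn_integral_potential_le:
  assumes [measurable]: "f \<in> borel_measurable borel"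
  shows "(\<integral>\<^sup>+x. potential f x \<partial>lborel) \<le> (\<integral>\<^sup>+x. f x \<partial>lborel)"
proof -
  have "(\<integral>\<^sup>+x. 1 * potential f x \<partial>lborel)
    = (\<integral>\<^sup>+s\<in>{0<..}. ennreal (exp (- s)) * (\<integral>\<^sup>+x. 1 * kernel_op (h s) f x \<partial>lborel) \<partial>lborel)"
    by (rule nn_integral_potential) auto
  also have "\<dots> \<le> (\<integral>\<^sup>+x. f x \<partial>lborel)"
    by (rule nn_integral_exp_le) (auto intro!: nn_integral_kernel_op_le even mass)
  finally show ?thesis by simp
qed

text \<open>
  Exchanges an exceptional null set in space for each time with one in time for each point.
\<close>

lemma AE_pair_time:
  fixes F G :: "real \<Rightarrow> 'a \<Rightarrow> ennreal"
  assumes [measurable]: "case_prod F \<in> borel_measurable (borel \<Otimes>\<^sub>M borel)"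
    "case_prod G \<in> borel_measurable (borel \<Otimes>\<^sub>M borel)"
    and le: "\<And>s. s > 0 \<Longrightarrow> AE x in lborel. F s x \<le> G s x"
  shows "AE x in lborel. AE s in lborel. s > 0 \<longrightarrow> F s x \<le> G s x"
proof -
  have "AE s in lborel. AE x in lborel. s > 0 \<longrightarrow> F s x \<le> G s x"
  proof (rule AE_I2)
    show "AE x in lborel. s > 0 \<longrightarrow> F s x \<le> G s x" for s
      using le by (cases "s > 0") auto
  qed
  moreover have "{z \<in> space (lborel \<Otimes>\<^sub>M lborel). fst z > 0 \<longrightarrow> F (fst z) (snd z) \<le> G (fst z) (snd z)}
      \<in> sets (lborel \<Otimes>\<^sub>M (lborel :: 'a measure))"
    by measurable
  ultimately show ?thesis
    by (rule iffD1[OF lborel_pair.AE_commute, rotated])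
qed

text \<open>
  Potentials are excessive: \<open>P\<^sub>t\<close> shifts the time integral to \<open>{t<..}\<close>.
\<close>

lemma kernel_op_potential_le:
  assumes [measurable]: "f \<in> borel_measurable borel" and t: "t > 0"
  shows "AE x in lborel. kernel_op (h t) (potential f) x \<le> ennreal (exp t) * potential f x"
proof -
  have "AE x in lborel. AE s in lborel. s > 0 \<longrightarrow> kernel_op (h t) (kernel_op (h s) f) x \<le> kernel_op (h (t + s)) f x"
  proof (rule AE_pair_time)
    show "AE x in lborel. kernel_op (h t) (kernel_op (h s) f) x \<le> kernel_op (h (t + s)) f x" if "s > 0" for s
      using semigroup[OF t that assms(1)] by eventually_elim simp
    show "(\<lambda>(s, x). kernel_op (h t) (kernel_op (h s) f) x) \<in> borel_measurable (borel \<Otimes>\<^sub>M borel)"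
      unfolding kernel_op_def[of "h t"] by measurable
  qed measurable
  then show ?thesis
  proof eventually_elim
    case (elim x)
    have "kernel_op (h t) (potential f) x
      = (\<integral>\<^sup>+y. \<integral>\<^sup>+s. h t (x - y) * (ennreal (exp (- s)) * kernel_op (h s) f y * indicator {0<..} s) \<partial>lborel \<partial>lborel)"
      unfolding kernel_op_def[of _ "potential f"] potential_def
      by (intro nn_integral_cong nn_integral_cmult[symmetric]) measurable
    also have "\<dots> = (\<integral>\<^sup>+s. \<integral>\<^sup>+y. h t (x - y) * (ennreal (exp (- s)) * kernel_op (h s) f y * indicator {0<..} s) \<partial>lborel \<partial>lborel)"
      by (rule lborel_pair.Fubini'[symmetric]) measurable
    also have "\<dots> = (\<integral>\<^sup>+s. \<integral>\<^sup>+y. (ennreal (exp (- s)) * indicator {0<..} s) * (h t (x - y) * kernel_op (h s) f y) \<partial>lborel \<partial>lborel)"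
      by (intro nn_integral_cong) (simp add: mult_ac)
    also have "\<dots> = (\<integral>\<^sup>+s. (ennreal (exp (- s)) * indicator {0<..} s) * kernel_op (h t) (kernel_op (h s) f) x \<partial>lborel)"
      unfolding kernel_op_def[of "h t"] by (intro nn_integral_cong nn_integral_cmult) measurable
    also have "\<dots> \<le> (\<integral>\<^sup>+s. ennreal (exp (- s)) * indicator {0<..} s * kernel_op (h (t + s)) f x \<partial>lborel)"
      by (rule nn_integral_mono_AE) (use elim in eventually_elim, auto simp: indicator_def intro!: mult_left_mono)
    also have "\<dots> \<le> (\<integral>\<^sup>+s. ennreal (exp t) * (ennreal (exp (- (t + 1 * s))) * kernel_op (h (t + 1 * s)) f x * indicator {0<..} (t + 1 * s)) \<partial>lborel)"
    proof (rule nn_integral_mono)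
      fix s :: real
      have "ennreal (exp (- s)) = ennreal (exp t) * ennreal (exp (- (t + 1 * s)))"
        by (simp add: ennreal_mult[symmetric] exp_add[symmetric])
      then show "ennreal (exp (- s)) * indicator {0<..} s * kernel_op (h (t + s)) f x
        \<le> ennreal (exp t) * (ennreal (exp (- (t + 1 * s))) * kernel_op (h (t + 1 * s)) f x * indicator {0<..} (t + 1 * s))"
        using t by (cases "s > 0") (simp_all add: mult_ac)
    qed
    also have "\<dots> = ennreal (exp t) * (\<integral>\<^sup>+s. (ennreal (exp (- (t + 1 * s))) * kernel_op (h (t + 1 * s)) f x * indicator {0<..} (t + 1 * s)) \<partial>lborel)"
      by (rule nn_integral_cmult) measurable
    also have "(\<integral>\<^sup>+s. (ennreal (exp (- (t + 1 * s))) * kernel_op (h (t + 1 * s)) f x * indicator {0<..} (t + 1 * s)) \<partial>lborel) = potential f x"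
      unfolding potential_def
      using nn_integral_real_affine[of "\<lambda>s. ennreal (exp (- s)) * kernel_op (h s) f x * indicator {0<..} s" 1 t] by simp
    finally show ?case .
  qed
qed

end

section \<open>Boundedness of excessive functions\<close>

context sub_markov_semigroup
begin

lemma kernel_op_bound_mono:
  assumes [measurable]: "f \<in> borel_measurable borel"
    and t: "0 < t" "t < s" and le: "AE x in lborel. kernel_op (h t) f x \<le> B"
  shows "AE x in lborel. kernel_op (h s) f x \<le> B"
proof -
  have "AE x in lborel. kernel_op (h (s - t)) (kernel_op (h t) f) x = kernel_op (h (s - t + t)) f x"
    using t by (intro semigroup) auto
  then show ?thesis
  proof eventually_elim
    case (elim x)
    have "kernel_op (h s) f x = kernel_op (h (s - t)) (kernel_op (h t) f) x"
      using elim by simp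
    also have "\<dots> \<le> kernel_op (h (s - t)) (\<lambda>_. B) x"
      by (rule kernel_op_mono[OF le])
    also have "\<dots> \<le> B"
      using t by (intro kernel_op_const_le mass) auto
    finally show ?case .
  qed
qed

text \<open>
  The iteration. The exponents \<open>a k = 1 - (1 - q) ^ k\<close> increase from \<open>0\<close> to \<open>1\<close>, and one step
  from \<open>a k\<close> to \<open>a (Suc k)\<close> uses up the time \<open>s k\<close> and costs the factor \<open>D ^ Suc k\<close> to the power
  \<open>(1 - q) ^ k\<close>.
\<close>

lemma kernel_op_excessive_bounded:
  fixes V :: "'a \<Rightarrow> real" and q D T :: real and s :: "nat \<Rightarrow> real"
  assumes [measurable]: "V \<in> borel_measurable borel" and V: "\<And>x. V x \<ge> 1"
    and q: "0 < q" "q < 1" and D: "D \<ge> 1"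
    and exc: "\<And>t. t > 0 \<Longrightarrow> AE x in lborel. kernel_op (h t) (\<lambda>y. ennreal (V y)) x \<le> ennreal (exp t * V x)"
    and s: "\<And>k. s k > 0" "\<And>k. sum s {..<k} \<le> T"
    and pow: "\<And>k. AE x in lborel. kernel_op (h (s k)) (\<lambda>y. ennreal (V y powr q)) x \<le> ennreal (D ^ Suc k)"
  shows "\<exists>B\<ge>0. AE x in lborel. kernel_op (h T) (\<lambda>y. ennreal (V y)) x \<le> ennreal B"
proof -
  define a where "a k = 1 - (1 - q) ^ k" for k
  define S where "S k = sum s {..<k}" for k
  define e where "e k = (\<Sum>j<k. real (Suc j) * (1 - q) ^ j)" for k
  \<comment> \<open>the sum of the series of exponents of \<open>D\<close>\<close>
  define e' where "e' = 1 / (1 - (1 - q))\<^sup>2"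
  have a01: "0 \<le> a k" "a k \<le> 1" for k
    unfolding a_def using q by (auto simp: power_le_one)
  have Vpos: "V y > 0" for y using V[of y] by linarith
  have a_Suc: "a (Suc k) = a k + (1 - a k) * q" for k
    unfolding a_def by (simp add: algebra_simps)
  have S_pos: "S (Suc k) > 0" for k
    unfolding S_def using s(1) by (intro sum_pos) auto
  have S_less: "S k < T" for k
    using s(1)[of k] s(2)[of "Suc k"] unfolding S_def by simp
  have "(\<lambda>j. of_nat (Suc j) * (1 - q) ^ j) sums e'"
    unfolding e'_def using q by (intro geometric_deriv_sums) auto
  then have e_le: "e k \<le> e'" for k
    unfolding e_def using q
    by (metis (no_types, lifting) lessThan_iff mult_nonneg_nonneg of_nat_0_le_iff sum_le_suminf sums_unique sums_summable
        finite_lessThan zero_le_power diff_ge_0_iff_ge less_imp_le)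
  \<comment> \<open>the base case is \<open>Suc 0\<close>, as \<open>h\<close> has no meaning at time \<open>S 0 = 0\<close>\<close>
  have step: "AE x in lborel. kernel_op (h (S (Suc k))) (\<lambda>y. ennreal (V y powr a (Suc k))) x
    \<le> ennreal (exp (S (Suc k)) * D powr e (Suc k))" for k
  proof (induction k)
    case 0
    have "D \<le> exp (s 0) * D" using D s(1)[of 0] by simp
    then show ?case
      using pow[of 0] D unfolding S_def e_def a_def
      by (auto elim!: eventually_mono intro: order_trans ennreal_leI)
  next
    case (Suc k)
    let ?c = "exp (s (Suc k)) * D powr (real (Suc (Suc k)) * (1 - q) ^ Suc k)"
    have "AE x in lborel. kernel_op (h (s (Suc k))) (\<lambda>y. ennreal (V y powr a (Suc (Suc k)))) x
        \<le> ennreal ?c * ennreal (V x powr a (Suc k))"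
      using exc[OF s(1)[of "Suc k"]] pow[of "Suc k"]
    proof eventually_elim
      case (elim x)
      have "kernel_op (h (s (Suc k))) (\<lambda>y. ennreal (V y powr a (Suc (Suc k)))) x
         \<le> ennreal ((exp (s (Suc k)) * V x) powr a (Suc k) * (D ^ Suc (Suc k)) powr (1 - a (Suc k)))"
        unfolding a_Suc[of "Suc k"]
        by (rule kernel_op_interpolate) (use Vpos D a01 elim in auto)
      also have "\<dots> \<le> ennreal (?c * V x powr a (Suc k))"
      proof (rule ennreal_leI)
        have "exp (s (Suc k)) powr a (Suc k) \<le> exp (s (Suc k)) powr 1"
          by (rule powr_mono) (use a01 s(1)[of "Suc k"] in auto)
        moreover have "(D ^ Suc (Suc k)) powr (1 - a (Suc k)) = D powr (real (Suc (Suc k)) * (1 - q) ^ Suc k)"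
          using D by (simp add: powr_realpow[symmetric] powr_powr a_def del: power_Suc)
        ultimately show "(exp (s (Suc k)) * V x) powr a (Suc k) * (D ^ Suc (Suc k)) powr (1 - a (Suc k)) \<le> ?c * V x powr a (Suc k)"
          using V[of x] by (auto simp: powr_mult mult_ac intro!: mult_left_mono mult_right_mono simp del: power_Suc)
      qed
      also have "\<dots> = ennreal ?c * ennreal (V x powr a (Suc k))"
        by (simp add: ennreal_mult)
      finally show ?case .
    qed
    note le = this
    have "AE x in lborel. kernel_op (h (S (Suc k))) (kernel_op (h (s (Suc k))) (\<lambda>y. ennreal (V y powr a (Suc (Suc k))))) x
        = kernel_op (h (S (Suc k) + s (Suc k))) (\<lambda>y. ennreal (V y powr a (Suc (Suc k)))) x"
      by (intro semigroup S_pos s) auto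
    with Suc show ?case
    proof eventually_elim
      case (elim x)
      have "kernel_op (h (S (Suc (Suc k)))) (\<lambda>y. ennreal (V y powr a (Suc (Suc k)))) x
        = kernel_op (h (S (Suc k))) (kernel_op (h (s (Suc k))) (\<lambda>y. ennreal (V y powr a (Suc (Suc k))))) x"
        using elim(2) by (simp add: S_def)
      also have "\<dots> \<le> kernel_op (h (S (Suc k))) (\<lambda>y. ennreal ?c * ennreal (V y powr a (Suc k))) x"
        by (rule kernel_op_mono[OF le])
      also have "\<dots> = ennreal ?c * kernel_op (h (S (Suc k))) (\<lambda>y. ennreal (V y powr a (Suc k))) x"
        by (rule kernel_op_cmult) auto
      also have "\<dots> \<le> ennreal ?c * ennreal (exp (S (Suc k)) * D powr e (Suc k))"
        by (intro mult_left_mono elim) auto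
      also have "\<dots> = ennreal (?c * (exp (S (Suc k)) * D powr e (Suc k)))"
        by (simp add: ennreal_mult)
      also have "?c * (exp (S (Suc k)) * D powr e (Suc k)) = exp (S (Suc (Suc k))) * D powr e (Suc (Suc k))"
        unfolding S_def e_def sum.lessThan_Suc[of _ "Suc k"] exp_add powr_add by (simp only: mult_ac)
      finally show ?case .
    qed
  qed
  define B where "B = exp T * D powr e'"
  have T: "AE x in lborel. kernel_op (h T) (\<lambda>y. ennreal (V y powr a (Suc k))) x \<le> ennreal B" for k
  proof (rule kernel_op_bound_mono[OF _ S_pos S_less])
    have "exp (S (Suc k)) * D powr e (Suc k) \<le> B"
      unfolding B_def using S_less[of "Suc k"] e_le[of "Suc k"] D by (intro mult_mono powr_mono) auto
    then show "AE x in lborel. kernel_op (h (S (Suc k))) (\<lambda>y. ennreal (V y powr a (Suc k))) x \<le> ennreal B"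
      using step[of k] by (auto elim!: eventually_mono intro: order_trans ennreal_leI)
  qed measurable
  have inc: "incseq (\<lambda>k. ennreal (V y powr a (Suc k)))" for y
  proof (rule incseq_SucI)
    show "ennreal (V y powr a (Suc k)) \<le> ennreal (V y powr a (Suc (Suc k)))" for k
      using V[of y] a01[of "Suc k"] q by (intro ennreal_leI powr_mono) (auto simp: a_Suc[of "Suc k"])
  qed
  have "(\<lambda>k. (1 - q) ^ Suc k) \<longlonglongrightarrow> 0"
    using q by (intro LIMSEQ_Suc LIMSEQ_power_zero) auto
  then have "(\<lambda>k. a (Suc k)) \<longlonglongrightarrow> 1 - 0"
    unfolding a_def by (intro tendsto_intros)
  then have lim: "(\<lambda>k. ennreal (V y powr a (Suc k))) \<longlonglongrightarrow> ennreal (V y powr (1 - 0))" for y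
    using V[of y] by (intro tendsto_intros) auto
  then have sup: "(SUP k. ennreal (V y powr a (Suc k))) = ennreal (V y)" for y
    using LIMSEQ_unique[OF LIMSEQ_SUP[OF inc[of y]] lim[of y]] Vpos[of y] by simp
  have "AE x in lborel. \<forall>k. kernel_op (h T) (\<lambda>y. ennreal (V y powr a (Suc k))) x \<le> ennreal B"
    using T by (simp add: AE_all_countable)
  then have "AE x in lborel. kernel_op (h T) (\<lambda>y. ennreal (V y)) x \<le> ennreal B"
  proof eventually_elim
    case (elim x)
    have "kernel_op (h T) (\<lambda>y. ennreal (V y)) x = (SUP k. kernel_op (h T) (\<lambda>y. ennreal (V y powr a (Suc k))) x)"
      unfolding sup[symmetric] by (rule kernel_op_SUP) (use inc in auto)
    also have "\<dots> \<le> ennreal B"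
      using elim by (intro SUP_least) auto
    finally show ?case .
  qed
  moreover have "B \<ge> 0" unfolding B_def by simp
  ultimately show ?thesis by blast
qed

text \<open>
  Before time \<open>T\<close> excessivity bounds the integrand of the potential by \<open>V x\<close>, afterwards it is at
  most \<open>exp (- s) * B\<close>; as \<open>\<Lambda> * T \<le> 1 / 2\<close>, the first part is absorbed by the left-hand side.
\<close>

lemma excessive_bounded_of_le_potential:
  fixes V :: "'a \<Rightarrow> real" and T \<Lambda> c B :: real
  assumes [measurable]: "V \<in> borel_measurable borel" and V: "\<And>x. V x \<ge> 0"
    and exc: "\<And>t. t > 0 \<Longrightarrow> AE x in lborel. kernel_op (h t) (\<lambda>y. ennreal (V y)) x \<le> ennreal (exp t * V x)"
    and T: "T > 0" "\<Lambda> * T \<le> 1 / 2" and \<Lambda>: "\<Lambda> \<ge> 0" "c \<ge> 0" "B \<ge> 0"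
    and B: "AE x in lborel. kernel_op (h T) (\<lambda>y. ennreal (V y)) x \<le> ennreal B"
    and pot: "AE x in lborel. ennreal (V x) \<le> ennreal \<Lambda> * potential (\<lambda>y. ennreal (V y)) x + ennreal c"
  shows "AE x in lborel. V x \<le> 2 * (\<Lambda> * B + c)"
proof -
  have "AE x in lborel. AE s in lborel. s > 0 \<longrightarrow>
    kernel_op (h s) (\<lambda>y. ennreal (V y)) x \<le> (if s \<le> T then ennreal (exp s * V x) else ennreal B)"
  proof (rule AE_pair_time)
    show "AE x in lborel. kernel_op (h s) (\<lambda>y. ennreal (V y)) x \<le> (if s \<le> T then ennreal (exp s * V x) else ennreal B)"
      if "s > 0" for s
      using exc[OF that] kernel_op_bound_mono[OF _ T(1) _ B, of s] by (cases "s \<le> T") auto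
  qed measurable
  then show ?thesis
    using pot
  proof eventually_elim
    case (elim x)
    have "potential (\<lambda>y. ennreal (V y)) x
      \<le> (\<integral>\<^sup>+s. ennreal (V x) * indicator {0..T} s + ennreal B * (ennreal (exp (- s)) * indicator {0<..} s) \<partial>lborel)"
      unfolding potential_def
    proof (rule nn_integral_mono_AE, use elim(1) in eventually_elim)
      case (elim s)
      show ?case
      proof (cases "s > 0")
        case True
        with elim have le: "kernel_op (h s) (\<lambda>y. ennreal (V y)) x \<le> (if s \<le> T then ennreal (exp s * V x) else ennreal B)"
          by simp
        have "ennreal (exp (- s)) * kernel_op (h s) (\<lambda>y. ennreal (V y)) x
          \<le> ennreal (exp (- s)) * (if s \<le> T then ennreal (exp s * V x) else ennreal B)"
          by (intro mult_left_mono le) auto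
        also have "\<dots> = (if s \<le> T then ennreal (V x) else ennreal B * ennreal (exp (- s)))"
          using V[of x] by (simp add: ennreal_mult[symmetric] mult.assoc[symmetric] exp_add[symmetric] mult.commute)
        finally show ?thesis
          using True by (auto simp: indicator_def intro: order_trans split: if_splits)
      qed simp
    qed
    also have "\<dots> = ennreal (V x) * ennreal T + ennreal B"
      using T by (subst nn_integral_add) (auto simp: nn_integral_cmult nn_integral_exp_minus nn_integral_cmult_indicator)
    also have "\<dots> = ennreal (V x * T + B)"
      using V[of x] T \<Lambda> by (simp add: ennreal_mult)
    finally have "ennreal (V x) \<le> ennreal \<Lambda> * ennreal (V x * T + B) + ennreal c"
      using elim(2) by (meson add_right_mono mult_left_mono order_trans zero_le)
    also have "\<dots> = ennreal (\<Lambda> * (V x * T + B) + c)"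
      using \<Lambda> V[of x] T by (simp add: ennreal_mult)
    finally have "V x \<le> \<Lambda> * (V x * T + B) + c"
      using \<Lambda> V[of x] T by (subst (asm) ennreal_le_iff) auto
    moreover have "(\<Lambda> * T) * V x \<le> 1 / 2 * V x"
      using T V[of x] by (intro mult_right_mono) auto
    ultimately show ?case by (simp add: algebra_simps)
  qed
qed

end

text \<open>
  In each interval \<open>(0, T / 2 ^ Suc k)\<close> the integrand is somewhere at most a constant times
  \<open>2 ^ Suc k\<close>, by comparison with its integral.
\<close>

lemma integrable_short_times:
  fixes C :: "real \<Rightarrow> real"
  assumes int: "set_integrable lborel {0<..} (\<lambda>t. exp (- t) * C t powr r)"
    and r: "r > 0" and T: "T > 0" and C: "\<And>t. t > 0 \<Longrightarrow> C t \<ge> 0"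
  shows "\<exists>s E. E \<ge> 1 \<and> (\<forall>k. s k > 0 \<and> C (s k) \<le> E ^ Suc k \<and> sum s {..<k} \<le> T)"
proof -
  define J where "J = (LINT t:{0<..}|lborel. exp (- t) * C t powr r)"
  have J: "J \<ge> 0" unfolding J_def set_lebesgue_integral_def by (intro Bochner_Integration.integral_nonneg) auto
  define Z where "Z = max 1 (exp T * (J + 1) / T)"
  \<comment> \<open>\<open>Z \<ge> 1\<close> allows \<open>Z * 2 ^ Suc k \<le> (2 * Z) ^ Suc k\<close>\<close>
  define E where "E = (2 * Z) powr (1 / r)"
  have Z: "Z \<ge> 1" "exp T * (J + 1) / T \<le> Z" unfolding Z_def by auto
  have E: "E \<ge> 1" unfolding E_def using Z r by (intro ge_one_powr_ge_zero) auto
  have "\<exists>t. 0 < t \<and> t < T / 2 ^ Suc k \<and> C t \<le> E ^ Suc k" for k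
  proof -
    define b where "b = T / 2 ^ Suc k"
    have b: "0 < b" "b \<le> T"
      unfolding b_def using T by (auto simp: divide_le_eq)
         (metis less_eq_real_def mult.commute mult_le_cancel_left1 not_less one_le_numeral one_le_power power_Suc)+
    have "\<exists>t. 0 < t \<and> t < b \<and> exp (- t) * C t powr r \<le> (J + 1) / b"
    proof (rule ccontr)
      assume "\<not> ?thesis"
      then have gt: "exp (- t) * C t powr r \<ge> (J + 1) / b" if "0 < t" "t < b" for t
        using that by (meson linear)
      have "J + 1 = (LINT t|lborel. indicator {0<..<b} t *\<^sub>R ((J + 1) / b))"
        using b by simp
      also have "\<dots> \<le> (LINT t|lborel. indicator {0<..} t *\<^sub>R (exp (- t) * C t powr r))"
      proof (rule Bochner_Integration.integral_mono)
        show "integrable lborel (\<lambda>t. indicator {0<..<b} t *\<^sub>R ((J + 1) / b))"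
          using b by (intro integrable_scaleR_left integrable_real_indicator) auto
        show "integrable lborel (\<lambda>t. indicator {0<..} t *\<^sub>R (exp (- t) * C t powr r))"
          using int unfolding set_integrable_def .
      qed (use gt in \<open>auto simp: indicator_def\<close>)
      also have "\<dots> = J" unfolding J_def set_lebesgue_integral_def ..
      finally show False by simp
    qed
    then obtain t where t: "0 < t" "t < b" "exp (- t) * C t powr r \<le> (J + 1) / b" by blast
    have "C t powr r = exp t * (exp (- t) * C t powr r)"
      by (simp add: mult.assoc[symmetric] exp_add[symmetric])
    also have "\<dots> \<le> exp T * ((J + 1) / b)"
      using t b J by (intro mult_mono) auto
    also have "\<dots> = (exp T * (J + 1) / T) * 2 ^ Suc k"
      unfolding b_def by simp
    also have "\<dots> \<le> Z * 2 ^ Suc k"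
      using Z by (intro mult_right_mono) auto
    also have "\<dots> \<le> Z ^ Suc k * 2 ^ Suc k"
      using Z by (intro mult_right_mono) (auto simp: self_le_power)
    also have "\<dots> = (2 * Z) ^ Suc k" by (simp add: power_mult_distrib)
    finally have "(C t powr r) powr (1 / r) \<le> ((2 * Z) ^ Suc k) powr (1 / r)"
      using r by (intro powr_mono2) auto
    also have "\<dots> = E ^ Suc k"
    proof -
      have "E ^ Suc k = E powr real (Suc k)"
        using E by (intro powr_realpow[symmetric]) auto
      moreover have "(2 * Z) ^ Suc k = (2 * Z) powr real (Suc k)"
        using Z by (intro powr_realpow[symmetric]) auto
      ultimately show ?thesis
        unfolding E_def by (simp only: powr_powr) (simp add: mult.commute)
    qed
    finally have "C t \<le> E ^ Suc k"
      using C[OF t(1)] r by (simp add: powr_powr)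
    with t show ?thesis unfolding b_def by blast
  qed
  then obtain s where s: "\<And>k. 0 < s k \<and> s k < T / 2 ^ Suc k \<and> C (s k) \<le> E ^ Suc k" by metis
  have "sum s {..<k} \<le> T * (1 - 1 / 2 ^ k)" for k
  proof (induction k)
    case (Suc k)
    have "sum s {..<Suc k} \<le> T * (1 - 1 / 2 ^ k) + T / 2 ^ Suc k"
      using Suc s[of k] by simp
    also have "\<dots> = T * (1 - 1 / 2 ^ Suc k)"
      by (simp add: field_simps)
    finally show ?case .
  qed simp
  moreover have "T * (1 - 1 / 2 ^ k) \<le> T" for k
    using T by (simp add: mult_le_cancel_left1)
  ultimately have "sum s {..<k} \<le> T" for k
    by (meson order_trans)
  with s E show ?thesis by blast
qed

section \<open>Heat kernel and Green function\<close>

lemma L1_measurable: "f \<in> L1 \<Longrightarrow> f \<in> borel_measurable borel"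
  using borel_measurable_integrable[of lborel f] by (simp add: L1_def)

lemma L1_nn_integral_finite:
  assumes "f \<in> L1"
  shows "(\<integral>\<^sup>+x. ennreal (f x) \<partial>lborel) < \<infinity>"
proof -
  have "(\<integral>\<^sup>+x. ennreal (f x) \<partial>lborel) \<le> (\<integral>\<^sup>+x. ennreal (norm (f x)) \<partial>lborel)"
    by (intro nn_integral_mono ennreal_leI) auto
  also have "\<dots> < \<infinity>"
    using assms by (simp add: L1_def integrable_iff_bounded)
  finally show ?thesis .
qed

lemma L1_loc_measurable:
  assumes "f \<in> L1_loc"
  shows "f \<in> borel_measurable borel"
proof -
  have meas: "(\<lambda>x. indicator (cball 0 (real n)) x *\<^sub>R f x) \<in> borel_measurable borel" for n
  proof -
    have "set_integrable lborel (cball 0 (real n)) f"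
      using assms by (simp add: L1_loc_def)
    from borel_measurable_integrable[OF this[unfolded set_integrable_def]] show ?thesis by simp
  qed
  have lim: "(\<lambda>n. indicator (cball 0 (real n)) x *\<^sub>R f x) \<longlonglongrightarrow> f x" for x
  proof (rule tendsto_eventually)
    obtain N :: nat where N: "norm x \<le> real N" using real_arch_simple by blast
    have "indicator (cball 0 (real n)) x *\<^sub>R f x = f x" if "N \<le> n" for n
    proof -
      have "norm x \<le> real n" using N that by linarith
      then show ?thesis by simp
    qed
    then show "\<forall>\<^sub>F n in sequentially. indicator (cball 0 (real n)) x *\<^sub>R f x = f x"
      unfolding eventually_sequentially by blast
  qed
  show ?thesis
    by (rule borel_measurable_LIMSEQ_real[OF lim meas])
qed

lemma convolution_eq_kernel_op:
  fixes k f :: "'a::euclidean_space \<Rightarrow> real"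
  assumes [measurable]: "k \<in> borel_measurable borel" "f \<in> borel_measurable borel"
    and nonneg: "AE y in lborel. 0 \<le> k y" "AE y in lborel. 0 \<le> f y"
    and fin: "kernel_op (\<lambda>y. ennreal (k y)) (\<lambda>y. ennreal (f y)) x < \<infinity>"
  shows "0 \<le> (LBINT y. k (x - y) * f y)"
    and "ennreal (LBINT y. k (x - y) * f y) = kernel_op (\<lambda>y. ennreal (k y)) (\<lambda>y. ennreal (f y)) x"
proof -
  have ae: "AE y in lborel. 0 \<le> k (x - y) * f y"
    using AE_lborel_reflect[OF nonneg(1), of x] nonneg(2) by eventually_elim auto
  have eq: "(\<integral>\<^sup>+y. ennreal (k (x - y) * f y) \<partial>lborel) = kernel_op (\<lambda>y. ennreal (k y)) (\<lambda>y. ennreal (f y)) x"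
    unfolding kernel_op_def
    by (rule nn_integral_cong_AE)
       (use AE_lborel_reflect[OF nonneg(1), of x] in eventually_elim, auto simp: ennreal_mult')
  show "0 \<le> (LBINT y. k (x - y) * f y)"
    by (rule integral_nonneg_AE[OF ae])
  have "integrable lborel (\<lambda>y. k (x - y) * f y)"
    by (rule integrableI_nonneg) (use ae eq fin in auto)
  then show "ennreal (LBINT y. k (x - y) * f y) = kernel_op (\<lambda>y. ennreal (k y)) (\<lambda>y. ennreal (f y)) x"
    using nn_integral_eq_integral[OF _ ae] eq by simp
qed

text \<open>
  Truncation in height and support. It transfers the semigroup law from \<open>L1\<close> to all measurable
  functions with values in \<open>[0,\<infinity>]\<close>.
\<close>

lemma SUP_L1_approx:
  fixes f :: "'a::euclidean_space \<Rightarrow> ennreal"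
  assumes [measurable]: "f \<in> borel_measurable borel"
  obtains fn :: "nat \<Rightarrow> 'a \<Rightarrow> real" where "\<And>n. fn n \<in> L1" "\<And>n y. 0 \<le> fn n y"
    "\<And>y. incseq (\<lambda>n. ennreal (fn n y))" "\<And>y. (SUP n. ennreal (fn n y)) = f y"
proof -
  define fn where "fn n y = (if norm y \<le> real n then enn2real (min (f y) (of_nat n)) else 0)" for n y
  have [measurable]: "fn n \<in> borel_measurable borel" for n
    unfolding fn_def by measurable
  have fn_nonneg: "fn n y \<ge> 0" for n y unfolding fn_def by simp
  have min_fin: "min (f y) (of_nat n) < top" for n y
    by (simp add: min_less_iff_disj ennreal_of_nat_eq_real_of_nat)
  have fn_eq: "ennreal (fn n y) = (if norm y \<le> real n then min (f y) (of_nat n) else 0)" for n y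
    unfolding fn_def by (cases "norm y \<le> real n") (simp_all add: ennreal_enn2real[OF min_fin])
  have L1: "fn n \<in> L1" for n
  proof -
    have "(\<integral>\<^sup>+y. ennreal (fn n y) \<partial>lborel) \<le> (\<integral>\<^sup>+y. of_nat n * indicator (cball 0 (real n)) y \<partial>(lborel :: 'a measure))"
      unfolding fn_eq by (intro nn_integral_mono) (auto simp: indicator_def)
    also have "\<dots> < \<infinity>"
      using emeasure_bounded_finite[of "cball 0 (real n) :: 'a set"]
      by (simp add: nn_integral_cmult_indicator ennreal_mult_less_top ennreal_of_nat_eq_real_of_nat)
    finally show ?thesis
      unfolding L1_def using fn_nonneg by (auto intro!: integrableI_nonneg)
  qed
  have inc: "incseq (\<lambda>n. ennreal (fn n y))" for y
  proof (rule incseq_SucI)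
    have "(of_nat n :: ennreal) \<le> of_nat (Suc n)" for n by (simp add: ennreal_of_nat_eq_real_of_nat)
    then have "min (f y) (of_nat n) \<le> min (f y) (of_nat (Suc n))" for n
      by (intro min.mono order_refl)
    then show "ennreal (fn n y) \<le> ennreal (fn (Suc n) y)" for n
      unfolding fn_eq by (auto simp del: of_nat_Suc min_less_iff_conj min.bounded_iff)
  qed
  have sup: "(SUP n. ennreal (fn n y)) = f y" for y
  proof (rule antisym)
    show "(SUP n. ennreal (fn n y)) \<le> f y"
      by (intro SUP_least) (auto simp: fn_eq)
    obtain N :: nat where N: "norm y \<le> real N" using real_arch_simple by blast
    show "f y \<le> (SUP n. ennreal (fn n y))"
    proof (rule le_SUP_iff[THEN iffD2], intro allI impI)
      fix z assume z: "z < f y"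
      obtain M :: nat where M: "z < of_nat M"
        using ennreal_Ex_less_of_nat[of z] less_le_trans[OF z top_greatest] by auto
      have "(of_nat M :: ennreal) \<le> of_nat (max N M)" by (simp add: ennreal_of_nat_eq_real_of_nat)
      with M have "z < of_nat (max N M)" by (rule less_le_trans)
      with z N have "z < ennreal (fn (max N M) y)"
        unfolding fn_eq by (simp del: of_nat_max)
      then show "\<exists>i\<in>UNIV. z < ennreal (fn i y)" by blast
    qed
  qed
  show thesis by (rule that[OF L1 fn_nonneg inc sup])
qed

text \<open>
  The heat kernel with pole \<open>0\<close>, as a function with values in \<open>[0,\<infinity>]\<close>, cut off to \<open>t > 0\<close> so
  that it is jointly measurable.
\<close>

definition nn_heat :: "(real \<Rightarrow> 'a::euclidean_space \<Rightarrow> 'a \<Rightarrow> real) \<Rightarrow> real \<Rightarrow> 'a \<Rightarrow> ennreal" where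
  "nn_heat H t x = ennreal (indicator ({0<..} \<times> UNIV) (t, x) *\<^sub>R H t 0 x)"

lemma nn_heat_eq: "t > 0 \<Longrightarrow> nn_heat H t x = ennreal (H t 0 x)"
  by (simp add: nn_heat_def)

lemma heat_kernelD:
  assumes "heat_kernel D A H"
  shows "set_borel_measurable lborel ({0<..} \<times> UNIV) (\<lambda>(t, x). H t 0 x)"
    and "t > 0 \<Longrightarrow> H t x\<^sub>0 x = H t 0 (x - x\<^sub>0)"
    and "t > 0 \<Longrightarrow> AE x in lborel. 0 \<le> H t 0 x"
    and "t > 0 \<Longrightarrow> AE x in lborel. H t 0 (- x) = H t 0 x"
    and "t > 0 \<Longrightarrow> integrable lborel (H t 0)"
    and "t > 0 \<Longrightarrow> (LBINT x. H t 0 x) \<le> 1"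
    and "\<exists>S. contraction_semigroup_L1 S \<and>
       (\<forall>t>0. \<forall>f\<in>L1. AE x in lborel. S t f x = (LBINT y. H t y x * f y))"
  using assms unfolding heat_kernel_def by blast+

lemma sub_markov_semigroup_nn_heat:
  assumes "heat_kernel D A H"
  shows "sub_markov_semigroup (nn_heat H)"
proof -
  have Hm: "(\<lambda>(t, x). indicator ({0<..} \<times> UNIV) (t, x) *\<^sub>R H t 0 x) \<in> borel_measurable (borel \<Otimes>\<^sub>M borel)"
    using heat_kernelD(1)[OF assms] by (simp add: set_borel_measurable_def borel_prod case_prod_unfold)
  note trans = heat_kernelD(2)[OF assms] and nonneg = heat_kernelD(3)[OF assms]
    and int = heat_kernelD(5)[OF assms] heat_kernelD(6)[OF assms]
  have Htm [measurable]: "H t 0 \<in> borel_measurable borel" if "t > 0" for t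
    using borel_measurable_integrable[OF int(1)[OF that]] by simp
  have mass: "(\<integral>\<^sup>+x. nn_heat H t x \<partial>lborel) \<le> 1" if "t > 0" for t
    using nn_integral_eq_integral[OF int(1) nonneg] int(2) that by (simp add: nn_heat_eq)
  have even: "AE x in lborel. nn_heat H t (- x) = nn_heat H t x" if "t > 0" for t
  proof -
    have "AE x in lborel. H t 0 (- x) = H t 0 x"
      by (rule heat_kernelD(4)[OF assms that])
    then show ?thesis by eventually_elim (simp add: nn_heat_eq that)
  qed
  have hm [measurable]: "nn_heat H t \<in> borel_measurable borel" if "t > 0" for t
    using Htm[OF that] unfolding nn_heat_eq[OF that, abs_def] by measurable
  obtain S where S: "contraction_semigroup_L1 S"
    and SH: "\<And>t f. t > 0 \<Longrightarrow> f \<in> L1 \<Longrightarrow> AE x in lborel. S t f x = (LBINT y. H t y x * f y)"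
    using heat_kernelD(7)[OF assms] by blast
  have SL1: "S t f \<in> L1" if "t > 0" "f \<in> L1" for t f
    using S that by (auto simp: contraction_semigroup_L1_def)
  have S_kernel: "AE x in lborel. 0 \<le> S t f x \<and> ennreal (S t f x) = kernel_op (nn_heat H t) (\<lambda>y. ennreal (f y)) x"
    if t: "t > 0" and f: "f \<in> L1" and f0: "AE y in lborel. 0 \<le> f y" for t f
  proof -
    note [measurable] = L1_measurable[OF f]
    have "(\<integral>\<^sup>+x. kernel_op (nn_heat H t) (\<lambda>y. ennreal (f y)) x \<partial>lborel) \<le> (\<integral>\<^sup>+x. ennreal (f x) \<partial>lborel)"
      by (rule nn_integral_kernel_op_le) (use t even mass in auto)
    also have "\<dots> < \<infinity>" by (rule L1_nn_integral_finite[OF f])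
    finally have "AE x in lborel. kernel_op (nn_heat H t) (\<lambda>y. ennreal (f y)) x \<noteq> \<infinity>"
      using t by (intro nn_integral_noteq_infinite) auto
    with SH[OF t f] show ?thesis
    proof eventually_elim
      case (elim x)
      have fin: "kernel_op (\<lambda>y. ennreal (H t 0 y)) (\<lambda>y. ennreal (f y)) x < \<infinity>"
        using elim by (simp add: nn_heat_eq[OF t, abs_def] less_top)
      show ?case
        using convolution_eq_kernel_op[OF _ _ nonneg[OF t] f0 fin] elim(1) t
        by (simp add: trans[OF t, where x=x] nn_heat_eq[OF t, abs_def] Htm[OF t])
    qed
  qed
  have semi_L1: "AE x in lborel. kernel_op (nn_heat H s) (kernel_op (nn_heat H t) (\<lambda>y. ennreal (f y))) x
      = kernel_op (nn_heat H (s + t)) (\<lambda>y. ennreal (f y)) x"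
    if s: "s > 0" and t: "t > 0" and f: "f \<in> L1" and f0: "AE y in lborel. 0 \<le> f y" for s t f
  proof -
    have Stf: "AE x in lborel. 0 \<le> S t f x \<and> ennreal (S t f x) = kernel_op (nn_heat H t) (\<lambda>y. ennreal (f y)) x"
      by (rule S_kernel[OF t f f0])
    then have "AE x in lborel. 0 \<le> S t f x" by eventually_elim simp
    from S_kernel[OF s SL1[OF t f] this]
    have "AE x in lborel. ennreal (S s (S t f) x) = kernel_op (nn_heat H s) (\<lambda>y. ennreal (S t f y)) x"
      by eventually_elim simp
    note A = this
    have B: "AE x in lborel. ennreal (S (s + t) f x) = kernel_op (nn_heat H (s + t)) (\<lambda>y. ennreal (f y)) x"
      using S_kernel[OF _ f f0, of "s + t"] s t by (auto elim!: eventually_mono)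
    have C: "AE x in lborel. S (s + t) f x = S s (S t f) x"
      using S s t f by (auto simp: contraction_semigroup_L1_def)
    have eq: "kernel_op (nn_heat H s) (\<lambda>y. ennreal (S t f y)) x
      = kernel_op (nn_heat H s) (kernel_op (nn_heat H t) (\<lambda>y. ennreal (f y))) x" for x
      by (rule kernel_op_cong) (use Stf in eventually_elim, simp)
    show ?thesis using A B C unfolding eq by eventually_elim simp
  qed
  show ?thesis
  proof
    show "case_prod (nn_heat H) \<in> borel_measurable (borel \<Otimes>\<^sub>M borel)"
      using measurable_compose[OF Hm measurable_ennreal] by (simp add: nn_heat_def[abs_def] case_prod_unfold)
    fix s t :: real and f :: "'a \<Rightarrow> ennreal"
    assume s: "s > 0" and t: "t > 0" and [measurable]: "f \<in> borel_measurable borel"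
    obtain fn :: "nat \<Rightarrow> 'a \<Rightarrow> real" where fn_L1: "\<And>n. fn n \<in> L1" and fn_nonneg: "\<And>n y. 0 \<le> fn n y"
      and inc: "\<And>y. incseq (\<lambda>n. ennreal (fn n y))" and sup: "\<And>y. (SUP n. ennreal (fn n y)) = f y"
      by (rule SUP_L1_approx[OF \<open>f \<in> borel_measurable borel\<close>]) blast
    have [measurable]: "fn n \<in> borel_measurable borel" for n
      by (rule L1_measurable[OF fn_L1])
    have "AE x in lborel. \<forall>n. kernel_op (nn_heat H s) (kernel_op (nn_heat H t) (\<lambda>y. ennreal (fn n y))) x
      = kernel_op (nn_heat H (s + t)) (\<lambda>y. ennreal (fn n y)) x"
      unfolding AE_all_countable by (intro allI semi_L1 s t fn_L1 AE_I2 fn_nonneg)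
    then show "AE x in lborel. kernel_op (nn_heat H s) (kernel_op (nn_heat H t) f) x = kernel_op (nn_heat H (s + t)) f x"
    proof eventually_elim
      case (elim x)
      have 1: "kernel_op (nn_heat H r) f y = (SUP n. kernel_op (nn_heat H r) (\<lambda>y. ennreal (fn n y)) y)" if "r > 0" for r y
        using kernel_op_SUP[OF hm[OF that], of "\<lambda>n y. ennreal (fn n y)" y] inc by (simp add: sup)
      have inc2: "incseq (\<lambda>n. kernel_op (nn_heat H t) (\<lambda>y. ennreal (fn n y)) y)" for y
        by (intro incseq_SucI kernel_op_mono AE_I2 incseq_SucD[OF inc])
      have "kernel_op (nn_heat H s) (kernel_op (nn_heat H t) f) x
         = kernel_op (nn_heat H s) (\<lambda>y. SUP n. kernel_op (nn_heat H t) (\<lambda>y. ennreal (fn n y)) y) x"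
        using 1[OF t] by (intro kernel_op_cong AE_I2)
      also have "\<dots> = (SUP n. kernel_op (nn_heat H s) (\<lambda>y. kernel_op (nn_heat H t) (\<lambda>y. ennreal (fn n y)) y) x)"
        by (rule kernel_op_SUP[OF hm[OF s] _ inc2]) (intro kernel_op_measurable hm t, measurable)
      also have "\<dots> = (SUP n. kernel_op (nn_heat H (s + t)) (\<lambda>y. ennreal (fn n y)) x)"
        using elim by simp
      also have "\<dots> = kernel_op (nn_heat H (s + t)) f x"
        using 1[of "s + t"] s t by simp
      finally show ?case .
    qed
  next
    show "(\<integral>\<^sup>+x. nn_heat H t x \<partial>lborel) \<le> 1" if "t > 0" for t by (rule mass[OF that])
    show "AE x in lborel. nn_heat H t (- x) = nn_heat H t x" if "t > 0" for t by (rule even[OF that])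
  qed
qed

context sub_markov_semigroup
begin

text \<open>
  The convolution kernel of the potential.
\<close>

definition green_kernel :: "'a \<Rightarrow> ennreal" where
  "green_kernel x = (\<integral>\<^sup>+s\<in>{0<..}. ennreal (exp (- s)) * h s x \<partial>lborel)"

lemma green_kernel_measurable [measurable]: "green_kernel \<in> borel_measurable borel"
  unfolding green_kernel_def[abs_def] by measurable

lemma kernel_op_green_kernel:
  assumes [measurable]: "f \<in> borel_measurable borel"
  shows "kernel_op green_kernel f x = potential f x"
proof -
  have "kernel_op green_kernel f x
    = (\<integral>\<^sup>+y. \<integral>\<^sup>+s. ennreal (exp (- s)) * h s (x - y) * indicator {0<..} s * f y \<partial>lborel \<partial>lborel)"
    unfolding kernel_op_def green_kernel_def by (intro nn_integral_cong nn_integral_multc[symmetric]) measurable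
  also have "\<dots> = (\<integral>\<^sup>+s. \<integral>\<^sup>+y. ennreal (exp (- s)) * h s (x - y) * indicator {0<..} s * f y \<partial>lborel \<partial>lborel)"
    by (rule lborel_pair.Fubini'[symmetric]) measurable
  also have "\<dots> = (\<integral>\<^sup>+s. \<integral>\<^sup>+y. (ennreal (exp (- s)) * indicator {0<..} s) * (h s (x - y) * f y) \<partial>lborel \<partial>lborel)"
    by (intro nn_integral_cong) (simp add: mult_ac)
  also have "\<dots> = (\<integral>\<^sup>+s. (ennreal (exp (- s)) * indicator {0<..} s) * kernel_op (h s) f x \<partial>lborel)"
    unfolding kernel_op_def by (intro nn_integral_cong nn_integral_cmult) measurable
  also have "\<dots> = potential f x"
    unfolding potential_def by (intro nn_integral_cong) (simp add: mult_ac)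
  finally show ?thesis .
qed

lemma green_kernel_finite: "AE x in lborel. green_kernel x \<noteq> \<infinity>"
proof (rule nn_integral_noteq_infinite)
  have "(\<integral>\<^sup>+x. green_kernel x \<partial>lborel) = kernel_op green_kernel (\<lambda>_. 1) 0"
    unfolding kernel_op_def using nn_integral_lborel_reflect[of green_kernel 0] by simp
  also have "\<dots> = potential (\<lambda>_. 1) 0" by (rule kernel_op_green_kernel) simp
  also have "\<dots> \<le> 1" by (rule potential_const_le)
  finally show "(\<integral>\<^sup>+x. green_kernel x \<partial>lborel) \<noteq> \<infinity>" by (auto simp: top_unique)
qed measurable

end

lemma green_function_eq_green_kernel:
  assumes H: "heat_kernel D A H"
    and G_H: "AE x in lborel. G x = (LBINT t:{0<..}. exp (- t) * H t 0 x)"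
  shows "AE x in lborel. ennreal (G x) = sub_markov_semigroup.green_kernel (nn_heat H) x"
proof -
  interpret sub_markov_semigroup "nn_heat H" by (rule sub_markov_semigroup_nn_heat[OF H])
  define K where "K t x = indicator ({0<..} \<times> UNIV) (t, x) *\<^sub>R H t 0 x" for t x
  have [measurable]: "case_prod K \<in> borel_measurable (borel \<Otimes>\<^sub>M borel)"
    unfolding K_def
    using heat_kernelD(1)[OF H] by (simp add: set_borel_measurable_def borel_prod case_prod_unfold)
  have "AE x in lborel. 0 \<le> K t x" for t
    using heat_kernelD(3)[OF H, of t] by (cases "t > 0") (simp_all add: K_def)
  then have "AE t in lborel. AE x in lborel. 0 \<le> K t x"
    by (rule AE_I2)
  moreover have "{z \<in> space (lborel \<Otimes>\<^sub>M lborel). 0 \<le> K (fst z) (snd z)} \<in> sets (lborel \<Otimes>\<^sub>M (lborel :: 'a measure))"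
    by measurable
  ultimately have "AE x in lborel. AE t in lborel. 0 \<le> K t x"
    by (rule iffD1[OF lborel_pair.AE_commute, rotated])
  with G_H green_kernel_finite show ?thesis
  proof eventually_elim
    case (elim x)
    have eq: "indicat_real {0<..} t *\<^sub>R (exp (- t) * H t 0 x) = exp (- t) * K t x" for t
      by (simp add: K_def indicator_def)
    have ae: "AE t in lborel. 0 \<le> exp (- t) * K t x"
      using elim(3) by eventually_elim simp
    have gk: "(\<integral>\<^sup>+t. ennreal (exp (- t) * K t x) \<partial>lborel) = green_kernel x"
      unfolding green_kernel_def nn_heat_def K_def[symmetric]
      by (intro nn_integral_cong) (auto simp: ennreal_mult' indicator_def K_def)
    have "integrable lborel (\<lambda>t. exp (- t) * K t x)"
      by (rule integrableI_nonneg) (use ae gk elim(2) in \<open>auto simp: less_top\<close>)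
    from nn_integral_eq_integral[OF this ae] gk elim(1) show ?case
      unfolding set_lebesgue_integral_def eq by simp
  qed
qed

text \<open>
  The reflection in the definition of \<open>green_inverse\<close> is harmless since \<open>G 0\<close> is even almost
  everywhere. The null set includes the points where the convolution integral diverges.
\<close>

lemma green_inverse_eq_potential:
  assumes H: "heat_kernel D A H"
    and G: "green_function D' A' G"
    and G_H: "\<And>x\<^sub>0. AE x in lborel. G x\<^sub>0 x = (LBINT t:{0<..}. exp (- t) * H t x\<^sub>0 x)"
    and f: "f \<in> L1" and f0: "AE y in lborel. 0 \<le> f y"
  shows "AE x in lborel. 0 \<le> green_inverse G f x \<and>
    ennreal (green_inverse G f x) = sub_markov_semigroup.potential (nn_heat H) (\<lambda>y. ennreal (f y)) x"
proof -
  interpret sub_markov_semigroup "nn_heat H" by (rule sub_markov_semigroup_nn_heat[OF H])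
  note [measurable] = L1_measurable[OF f]
  have [measurable]: "G 0 \<in> borel_measurable borel"
    using G by (intro L1_loc_measurable) (auto simp: green_function_def)
  have G0: "AE x in lborel. 0 \<le> G 0 x" and even: "AE x in lborel. G 0 x = G 0 (0 - x)"
    using G unfolding green_function_def by blast+
  have gk: "AE x in lborel. ennreal (G 0 x) = green_kernel x"
    by (rule green_function_eq_green_kernel[OF H G_H])
  have pot: "kernel_op (\<lambda>y. ennreal (G 0 y)) (\<lambda>y. ennreal (f y)) x = potential (\<lambda>y. ennreal (f y)) x" for x
    using kernel_op_cong_kernel[OF gk] kernel_op_green_kernel[of "\<lambda>y. ennreal (f y)"] by simp
  have "(\<integral>\<^sup>+x. potential (\<lambda>y. ennreal (f y)) x \<partial>lborel) \<le> (\<integral>\<^sup>+x. ennreal (f x) \<partial>lborel)"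
    by (rule nn_integral_potential_le) auto
  also have "\<dots> < \<infinity>" by (rule L1_nn_integral_finite[OF f])
  finally have "AE x in lborel. potential (\<lambda>y. ennreal (f y)) x \<noteq> \<infinity>"
    by (intro nn_integral_noteq_infinite) auto
  then show ?thesis
  proof eventually_elim
    case (elim x)
    have "green_inverse G f x = (LBINT y. G 0 (x - y) * f y)"
      unfolding green_inverse_def
      by (intro integral_cong_AE) (measurable, use AE_lborel_reflect[OF even, of x] in eventually_elim, auto)
    then show ?case
      using convolution_eq_kernel_op[OF _ _ G0 f0, of x] elim by (simp add: pot less_top)
  qed
qed

section \<open>Scaling in time\<close>

text \<open>
  Multiplication of the time variable by \<open>l\<close>.
\<close>

definition time_scale :: "real \<Rightarrow> real \<times> 'a \<Rightarrow> real \<times> 'a" where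
  "time_scale l z = (l * fst z, snd z)"

lemma time_scale_measurable [measurable]:
  "time_scale l \<in> (borel :: (real \<times> 'a::euclidean_space) measure) \<rightarrow>\<^sub>M borel"
  unfolding time_scale_def[abs_def] by (simp add: borel_prod[symmetric])

lemma lborel_time_scale:
  assumes l: "l > 0"
  shows "(lborel :: (real \<times> 'a::euclidean_space) measure)
    = density (distr lborel borel (time_scale l)) (\<lambda>_. ennreal l)"
proof (rule measure_eqI)
  fix A :: "(real \<times> 'a) set"
  assume "A \<in> sets lborel"
  then have A: "A \<in> sets borel" by simp
  then have A'[measurable]: "A \<in> sets (borel \<Otimes>\<^sub>M borel)" unfolding borel_prod .
  have "emeasure lborel A = emeasure (lborel \<Otimes>\<^sub>M lborel) A" by (simp add: lborel_prod)
  also have "\<dots> = (\<integral>\<^sup>+z. indicator A z \<partial>(lborel \<Otimes>\<^sub>M lborel))" by simp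
  also have "\<dots> = (\<integral>\<^sup>+x. \<integral>\<^sup>+t. indicator A (t, x) \<partial>lborel \<partial>lborel)"
    by (rule lborel_pair.nn_integral_snd[symmetric]) measurable
  also have "\<dots> = (\<integral>\<^sup>+x. \<integral>\<^sup>+t. ennreal l * indicator A (l * t, x) \<partial>lborel \<partial>lborel)"
  proof (rule nn_integral_cong)
    fix x :: 'a
    have "(\<integral>\<^sup>+t. indicator A (t, x) \<partial>lborel) = ennreal \<bar>l\<bar> * (\<integral>\<^sup>+t. indicator A (0 + l * t, x) \<partial>lborel)"
      by (rule nn_integral_real_affine) (measurable, use l in simp)
    also have "\<dots> = (\<integral>\<^sup>+t. ennreal l * indicator A (l * t, x) \<partial>lborel)"
    proof -
      have [measurable]: "(\<lambda>t. indicator A (l * t, x) :: ennreal) \<in> borel_measurable borel" by measurable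
      show ?thesis using l by (simp add: nn_integral_cmult)
    qed
    finally show "(\<integral>\<^sup>+t. indicator A (t, x) \<partial>lborel) = (\<integral>\<^sup>+t. ennreal l * indicator A (l * t, x) \<partial>lborel)" .
  qed
  also have "\<dots> = (\<integral>\<^sup>+z. ennreal l * indicator A (l * fst z, snd z) \<partial>(lborel \<Otimes>\<^sub>M lborel))"
  proof -
    have "(\<lambda>z. (l * fst z, snd z)) \<in> lborel \<Otimes>\<^sub>M (lborel :: 'a measure) \<rightarrow>\<^sub>M borel \<Otimes>\<^sub>M borel"
      by measurable
    from measurable_compose[OF this borel_measurable_indicator[OF A']]
    have "(\<lambda>z. ennreal l * indicator A (l * fst z, snd z)) \<in> borel_measurable (lborel \<Otimes>\<^sub>M (lborel :: 'a measure))"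
      by measurable
    from lborel_pair.nn_integral_snd[OF this] show ?thesis by simp
  qed
  also have "\<dots> = (\<integral>\<^sup>+z. ennreal l * indicator A (time_scale l z) \<partial>lborel)"
    by (simp add: lborel_prod time_scale_def)
  also have "\<dots> = emeasure (density (distr lborel borel (time_scale l)) (\<lambda>_. ennreal l)) A"
    using A by (simp add: emeasure_density nn_integral_distr)
  finally show "emeasure lborel A = emeasure (density (distr lborel borel (time_scale l)) (\<lambda>_. ennreal l)) A" .
qed simp

lemma integral_time_scale:
  fixes f :: "real \<times> 'a::euclidean_space \<Rightarrow> real"
  assumes f: "integrable lborel f" and l: "l > 0"
  shows "integrable lborel (\<lambda>z. f (time_scale l z))"
    and "(LBINT z. f z) = l * (LBINT z. f (time_scale l z))"
proof -
  have fm [measurable]: "f \<in> borel_measurable borel"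
    using borel_measurable_integrable[OF f] by simp
  have "integrable (density (distr lborel borel (time_scale l)) (\<lambda>_. ennreal l)) f"
    using f lborel_time_scale[OF l, where 'a='a] by simp
  then have "integrable lborel (\<lambda>z. l * f (time_scale l z))"
    using l by (simp add: integrable_density integrable_distr_eq)
  then show "integrable lborel (\<lambda>z. f (time_scale l z))"
    using l by simp
  have "(LBINT z. f z) = integral\<^sup>L (density (distr lborel borel (time_scale l)) (\<lambda>_. ennreal l)) f"
    using lborel_time_scale[OF l, where 'a='a] by simp
  also have "\<dots> = (LBINT z. l * f (time_scale l z))"
    using l by (simp add: integral_density integral_distr)
  finally show "(LBINT z. f z) = l * (LBINT z. f (time_scale l z))"
    by simp
qed

lemma set_integral_time_scale:
  fixes f :: "real \<times> 'a::euclidean_space \<Rightarrow> real"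
  assumes f: "set_integrable lborel (I \<times> K) f" and l: "l > 0"
    and J: "\<And>t. t \<in> J \<longleftrightarrow> l * t \<in> I"
  shows "set_integrable lborel (J \<times> K) (\<lambda>z. f (time_scale l z))"
    and "set_lebesgue_integral lborel (I \<times> K) f = l * set_lebesgue_integral lborel (J \<times> K) (\<lambda>z. f (time_scale l z))"
proof -
  have eq: "indicat_real (I \<times> K) (time_scale l z) = indicat_real (J \<times> K) z" for z
    by (cases z) (simp add: time_scale_def indicator_def J)
  show "set_integrable lborel (J \<times> K) (\<lambda>z. f (time_scale l z))"
    using integral_time_scale(1)[OF f[unfolded set_integrable_def] l] unfolding set_integrable_def eq .
  show "set_lebesgue_integral lborel (I \<times> K) f = l * set_lebesgue_integral lborel (J \<times> K) (\<lambda>z. f (time_scale l z))"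
    using integral_time_scale(2)[OF f[unfolded set_integrable_def] l] unfolding set_lebesgue_integral_def eq .
qed

lemma set_borel_measurable_time_scale:
  fixes f :: "real \<times> 'a::euclidean_space \<Rightarrow> real"
  assumes f: "set_borel_measurable lborel (I \<times> K) f"
    and J: "\<And>t. t \<in> J \<longleftrightarrow> l * t \<in> I"
  shows "set_borel_measurable lborel (J \<times> K) (\<lambda>z. f (time_scale l z))"
proof -
  have eq: "indicat_real (I \<times> K) (time_scale l z) = indicat_real (J \<times> K) z" for z
    by (cases z) (simp add: time_scale_def indicator_def J)
  have "(\<lambda>z. indicat_real (I \<times> K) z *\<^sub>R f z) \<in> borel_measurable borel"
    using f by (simp add: set_borel_measurable_def)
  from measurable_compose[OF time_scale_measurable[of l] this]
  show ?thesis unfolding set_borel_measurable_def eq by simp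
qed

lemma Lr_norm_top_cmult_le:
  assumes [measurable]: "f \<in> borel_measurable borel"
  shows "Lr_norm top (\<lambda>x. c * f x) \<le> ennreal \<bar>c\<bar> * Lr_norm top f"
proof -
  have "AE x in lborel. ennreal \<bar>f x\<bar> \<le> esssup lborel (\<lambda>x. ennreal \<bar>f x\<bar>)"
    by (rule esssup_AE)
  then have "AE x in lborel. ennreal \<bar>c * f x\<bar> \<le> ennreal \<bar>c\<bar> * esssup lborel (\<lambda>x. ennreal \<bar>f x\<bar>)"
    by eventually_elim (auto simp: abs_mult ennreal_mult intro: mult_left_mono)
  then show ?thesis
    unfolding Lr_norm_def by (auto intro!: esssup_I)
qed

lemma Linf_measurable: "f \<in> Linf \<Longrightarrow> f \<in> borel_measurable borel"
  by (simp add: Linf_def)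

lemma Linf_cmult:
  assumes "f \<in> Linf"
  shows "(\<lambda>x. c * f x) \<in> Linf"
proof -
  have [measurable]: "f \<in> borel_measurable borel" by (rule Linf_measurable[OF assms])
  have "Lr_norm top (\<lambda>x. c * f x) \<le> ennreal \<bar>c\<bar> * Lr_norm top f"
    by (rule Lr_norm_top_cmult_le) measurable
  also have "\<dots> < top" using assms by (simp add: Linf_def ennreal_mult_less_top)
  finally show ?thesis by (simp add: Linf_def)
qed

lemma tendsto_Lr_norm_top_cmult:
  assumes "(N \<longlongrightarrow> 0) F" and "\<forall>\<^sub>F s in F. M s \<le> ennreal c * N s"
  shows "(M \<longlongrightarrow> (0 :: ennreal)) F"
proof (rule tendsto_sandwich[of "\<lambda>_. 0" _ _ "\<lambda>s. ennreal c * N s"])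
  have "((\<lambda>s. ennreal c * N s) \<longlongrightarrow> ennreal c * 0) F"
    using assms(1) by (intro ennreal_tendsto_cmult) auto
  then show "((\<lambda>s. ennreal c * N s) \<longlongrightarrow> 0) F" by simp
qed (use assms(2) in auto)

lemma filterlim_divide_within:
  fixes l t :: real
  assumes l: "l > 0" and J: "\<And>t. t \<in> J \<longleftrightarrow> l * t \<in> I"
  shows "filterlim (\<lambda>s. s / l) (at (t / l) within J) (at t within I)"
proof (rule filterlim_at[THEN iffD2], intro conjI)
  have "s / l \<in> J \<and> s / l \<noteq> t / l" if "s \<in> I" "s \<noteq> t" for s
    using that l J[of "s / l"] by simp
  then show "\<forall>\<^sub>F s in at t within I. s / l \<in> J \<and> s / l \<noteq> t / l"
    by (auto simp: eventually_at_filter)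
  show "((\<lambda>s. s / l) \<longlongrightarrow> t / l) (at t within I)"
    using l by (intro tendsto_intros) auto
qed

lemma filterlim_times_within:
  fixes l t :: real
  assumes l: "l > 0" and J: "\<And>t. t \<in> J \<longleftrightarrow> l * t \<in> I"
  shows "filterlim (\<lambda>s. l * s) (at (l * t) within I) (at t within J)"
  using filterlim_divide_within[of "1 / l" I J "t"] l J by (simp add: mult.commute field_simps)

lemma C1_Linf_c_time_scale:
  assumes l: "l > 0" and \<psi>: "C1_Linf_c a b \<psi> \<psi>'"
  shows "C1_Linf_c (l * a) (l * b) (\<lambda>s. \<psi> (s / l)) (\<lambda>s x. 1 / l * \<psi>' (s / l) x)"
proof -
  have J: "t \<in> {l * a..l * b} \<longleftrightarrow> 1 / l * t \<in> {a..b}" for t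
    using l by (auto simp: field_simps)
  have J': "t \<in> {a..b} \<longleftrightarrow> l * t \<in> {l * a..l * b}" for t
    using l by auto
  have inf: "\<psi> t \<in> Linf" "\<psi>' t \<in> Linf" if "t \<in> {a..b}" for t
    using \<psi> that by (auto simp: C1_Linf_c_def)
  have lim: "((\<lambda>s. Lr_norm top (\<lambda>x. (\<psi> s x - \<psi> t x) / (s - t) - \<psi>' t x)) \<longlongrightarrow> 0) (at t within {a..b})"
    "((\<lambda>s. Lr_norm top (\<lambda>x. \<psi>' s x - \<psi>' t x)) \<longlongrightarrow> 0) (at t within {a..b})" if "t \<in> {a..b}" for t
    using \<psi> that unfolding C1_Linf_c_def by blast+
  have m1: "set_borel_measurable lborel ({a..b} \<times> UNIV) (\<lambda>(t, x). \<psi> t x)"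
    and m2: "set_borel_measurable lborel ({a..b} \<times> UNIV) (\<lambda>(t, x). \<psi>' t x)"
    using \<psi> unfolding C1_Linf_c_def by blast+
  obtain K where K: "compact K" "\<forall>t\<in>{a..b}. AE x in lborel. x \<notin> K \<longrightarrow> \<psi> t x = 0"
    using \<psi> unfolding C1_Linf_c_def by blast
  show ?thesis
    unfolding C1_Linf_c_def
  proof (intro conjI ballI)
    show "set_borel_measurable lborel ({l * a..l * b} \<times> UNIV) (\<lambda>(s, x). \<psi> (s / l) x)"
      using set_borel_measurable_time_scale[OF m1 J] by (simp add: time_scale_def case_prod_unfold)
    have "set_borel_measurable lborel ({l * a..l * b} \<times> UNIV) (\<lambda>(s, x). \<psi>' (s / l) x)"
      using set_borel_measurable_time_scale[OF m2 J] by (simp add: time_scale_def case_prod_unfold)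
    then have "(\<lambda>z. 1 / l * (indicat_real ({l * a..l * b} \<times> UNIV) z *\<^sub>R (case z of (s, x) \<Rightarrow> \<psi>' (s / l) x))) \<in> borel_measurable lborel"
      unfolding set_borel_measurable_def by (rule borel_measurable_times[OF borel_measurable_const])
    then show "set_borel_measurable lborel ({l * a..l * b} \<times> UNIV) (\<lambda>(s, x). 1 / l * \<psi>' (s / l) x)"
      unfolding set_borel_measurable_def by (simp add: case_prod_unfold mult_ac)
    show "\<exists>K. compact K \<and> (\<forall>t\<in>{l * a..l * b}. AE x in lborel. x \<notin> K \<longrightarrow> \<psi> (t / l) x = 0)"
      using K J by (intro exI[of _ K]) auto
    fix t assume t: "t \<in> {l * a..l * b}"
    then have tl: "t / l \<in> {a..b}" using J[of t] by simp
    show "\<psi> (t / l) \<in> Linf" by (rule inf(1)[OF tl])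
    show "(\<lambda>x. 1 / l * \<psi>' (t / l) x) \<in> Linf" by (rule Linf_cmult[OF inf(2)[OF tl]])
    have ev: "\<forall>\<^sub>F s in at t within {l * a..l * b}. s / l \<in> {a..b} \<and> s \<noteq> t"
      using J by (auto simp: eventually_at_filter)
    note fl = filterlim_divide_within[OF l J', of t]
    show "((\<lambda>s. Lr_norm top (\<lambda>x. (\<psi> (s / l) x - \<psi> (t / l) x) / (s - t) - 1 / l * \<psi>' (t / l) x)) \<longlongrightarrow> 0) (at t within {l * a..l * b})"
    proof (rule tendsto_Lr_norm_top_cmult[OF filterlim_compose[OF lim(1)[OF tl] fl], of _ "\<bar>1 / l\<bar>"])
      show "\<forall>\<^sub>F s in at t within {l * a..l * b}.
          Lr_norm top (\<lambda>x. (\<psi> (s / l) x - \<psi> (t / l) x) / (s - t) - 1 / l * \<psi>' (t / l) x)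
          \<le> ennreal \<bar>1 / l\<bar> * Lr_norm top (\<lambda>x. (\<psi> (s / l) x - \<psi> (t / l) x) / (s / l - t / l) - \<psi>' (t / l) x)"
        using ev
      proof eventually_elim
        case (elim s)
        note [measurable] = Linf_measurable[OF inf(1)[OF conjunct1[OF elim]]] Linf_measurable[OF inf(1)[OF tl]] Linf_measurable[OF inf(2)[OF tl]]
        have st: "s / l - t / l = (s - t) / l" by (simp add: diff_divide_distrib)
        have eq: "(\<lambda>x. (\<psi> (s / l) x - \<psi> (t / l) x) / (s - t) - 1 / l * \<psi>' (t / l) x)
          = (\<lambda>x. 1 / l * ((\<psi> (s / l) x - \<psi> (t / l) x) / (s / l - t / l) - \<psi>' (t / l) x))"
          unfolding st using l elim by (simp add: right_diff_distrib)
        show ?case unfolding eq by (rule Lr_norm_top_cmult_le) measurable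
      qed
    qed
    show "((\<lambda>s. Lr_norm top (\<lambda>x. 1 / l * \<psi>' (s / l) x - 1 / l * \<psi>' (t / l) x)) \<longlongrightarrow> 0) (at t within {l * a..l * b})"
    proof (rule tendsto_Lr_norm_top_cmult[OF filterlim_compose[OF lim(2)[OF tl] fl], of _ "\<bar>1 / l\<bar>"])
      show "\<forall>\<^sub>F s in at t within {l * a..l * b}.
          Lr_norm top (\<lambda>x. 1 / l * \<psi>' (s / l) x - 1 / l * \<psi>' (t / l) x)
          \<le> ennreal \<bar>1 / l\<bar> * Lr_norm top (\<lambda>x. \<psi>' (s / l) x - \<psi>' (t / l) x)"
        using ev
      proof eventually_elim
        case (elim s)
        note [measurable] = Linf_measurable[OF inf(2)[OF conjunct1[OF elim]]] Linf_measurable[OF inf(2)[OF tl]]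
        show ?case unfolding right_diff_distrib[symmetric] by (rule Lr_norm_top_cmult_le) measurable
      qed
    qed
  qed
qed

lemma green_inverse_cmult: "green_inverse G (\<lambda>x. c * f x) y = c * green_inverse G f y"
  unfolding green_inverse_def by (simp add: mult.left_commute)

lemma powr_time_scale:
  fixes y :: real
  assumes c: "c > 0" "c powr (m - 1) = l"
  shows "(c * y) powr m = c * l * y powr m"
proof -
  have "c powr m = c powr 1 * c powr (m - 1)"
    unfolding powr_add[symmetric] by simp
  then show ?thesis
    using c by (simp add: powr_mult)
qed

text \<open>
  All three integrands for the rescaled solution are \<open>c * l\<close> times the rescaled integrands of
  \<open>u\<close>, because \<open>c powr m = c * l\<close>; the substitution removes the factor \<open>l\<close>.
\<close>

lemma weak_dual_identity_time_scale:
  assumes l: "l > 0" and c: "c > 0" "c powr (m - 1) = l"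
    and u: "weak_dual_identity G m u (l * a) (l * b) (\<lambda>s. \<psi> (s / l)) (\<lambda>s x. 1 / l * \<psi>' (s / l) x)"
  shows "weak_dual_identity G m (\<lambda>t x. c * u (l * t) x) a b \<psi> \<psi>'"
proof -
  have J: "t \<in> {a..b} \<longleftrightarrow> l * t \<in> {l * a..l * b}" for t
    using l by auto
  define v where "v t x = c * u (l * t) x" for t x
  define f1 where "f1 = (\<lambda>(s, x). green_inverse G (u s) x * (1 / l * \<psi>' (s / l) x))"
  define f2 where "f2 = (\<lambda>(s, x). u s x powr m * \<psi> (s / l) x)"
  define f3 where "f3 = (\<lambda>(s, x). u s x powr m * green_inverse G (\<psi> (s / l)) x)"
  have GI: "green_inverse G (v t) x = c * green_inverse G (u (l * t)) x" for t x
    unfolding v_def by (rule green_inverse_cmult)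
  have g1: "(\<lambda>(t, x). green_inverse G (v t) x * \<psi>' t x) = (\<lambda>z. c * l * f1 (time_scale l z))"
    unfolding f1_def time_scale_def GI using l by (auto simp: case_prod_unfold)
  have g2: "(\<lambda>(t, x). v t x powr m * \<psi> t x) = (\<lambda>z. c * l * f2 (time_scale l z))"
    unfolding f2_def time_scale_def v_def powr_time_scale[OF c] using l by (auto simp: case_prod_unfold)
  have g3: "(\<lambda>(t, x). v t x powr m * green_inverse G (\<psi> t) x) = (\<lambda>z. c * l * f3 (time_scale l z))"
    unfolding f3_def time_scale_def v_def powr_time_scale[OF c] using l by (auto simp: case_prod_unfold)
  have g123: "(\<lambda>(t, x). green_inverse G (v t) x * \<psi>' t x - v t x powr m * \<psi> t x + v t x powr m * green_inverse G (\<psi> t) x)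
    = (\<lambda>z. c * l * (f1 (time_scale l z) - f2 (time_scale l z) + f3 (time_scale l z)))"
    using g1 g2 g3 by (auto simp: fun_eq_iff algebra_simps)
  have i: "set_integrable lborel ({l * a..l * b} \<times> UNIV) f1" "set_integrable lborel ({l * a..l * b} \<times> UNIV) f2"
    "set_integrable lborel ({l * a..l * b} \<times> UNIV) f3"
    using u unfolding weak_dual_identity_def f1_def f2_def f3_def by blast+
  then have i123: "set_integrable lborel ({l * a..l * b} \<times> UNIV) (\<lambda>z. f1 z - f2 z + f3 z)"
    by (intro set_integral_add set_integral_diff)
  have e: "integrable lborel (\<lambda>x. green_inverse G (u (l * a)) x * \<psi> a x)"
    "integrable lborel (\<lambda>x. green_inverse G (u (l * b)) x * \<psi> b x)"
    using u l unfolding weak_dual_identity_def by simp_all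
  have f123: "(\<lambda>(s, x). green_inverse G (u s) x * (1 / l * \<psi>' (s / l) x) - u s x powr m * \<psi> (s / l) x
      + u s x powr m * green_inverse G (\<psi> (s / l)) x) = (\<lambda>z. f1 z - f2 z + f3 z)"
    unfolding f1_def f2_def f3_def by auto
  have eq: "set_lebesgue_integral lborel ({l * a..l * b} \<times> UNIV) (\<lambda>z. f1 z - f2 z + f3 z)
    = (LBINT x. green_inverse G (u (l * b)) x * \<psi> b x) - (LBINT x. green_inverse G (u (l * a)) x * \<psi> a x)"
    using u l unfolding weak_dual_identity_def f123 by simp
  have "weak_dual_identity G m v a b \<psi> \<psi>'"
    unfolding weak_dual_identity_def g1 g2 g3 g123
  proof (intro conjI)
    show "set_integrable lborel ({a..b} \<times> UNIV) (\<lambda>z. c * l * f1 (time_scale l z))"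
      by (rule set_integrable_mult_right) (rule set_integral_time_scale(1)[OF i(1) l J])
    show "set_integrable lborel ({a..b} \<times> UNIV) (\<lambda>z. c * l * f2 (time_scale l z))"
      by (rule set_integrable_mult_right) (rule set_integral_time_scale(1)[OF i(2) l J])
    show "set_integrable lborel ({a..b} \<times> UNIV) (\<lambda>z. c * l * f3 (time_scale l z))"
      by (rule set_integrable_mult_right) (rule set_integral_time_scale(1)[OF i(3) l J])
    show "integrable lborel (\<lambda>x. green_inverse G (v a) x * \<psi> a x)"
      "integrable lborel (\<lambda>x. green_inverse G (v b) x * \<psi> b x)"
      unfolding GI mult.assoc using e by (auto intro: integrable_mult_right)
    have "set_lebesgue_integral lborel ({a..b} \<times> UNIV)
        (\<lambda>z. c * l * (f1 (time_scale l z) - f2 (time_scale l z) + f3 (time_scale l z)))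
      = c * (l * set_lebesgue_integral lborel ({a..b} \<times> UNIV)
        (\<lambda>z. f1 (time_scale l z) - f2 (time_scale l z) + f3 (time_scale l z)))"
      by simp
    also have "\<dots> = c * set_lebesgue_integral lborel ({l * a..l * b} \<times> UNIV) (\<lambda>z. f1 z - f2 z + f3 z)"
      unfolding set_integral_time_scale(2)[OF i123 l J] ..
    also have "\<dots> = (LBINT x. green_inverse G (v b) x * \<psi> b x) - (LBINT x. green_inverse G (v a) x * \<psi> a x)"
      unfolding eq GI mult.assoc by (simp add: right_diff_distrib)
    finally show "set_lebesgue_integral lborel ({a..b} \<times> UNIV)
        (\<lambda>z. c * l * (f1 (time_scale l z) - f2 (time_scale l z) + f3 (time_scale l z)))
      = (LBINT x. green_inverse G (v b) x * \<psi> b x) - (LBINT x. green_inverse G (v a) x * \<psi> a x)" .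
  qed
  then show ?thesis unfolding v_def .
qed

lemma L1_norm_cmult_diff: "L1_norm (\<lambda>x. c * f x - c * g x) = \<bar>c\<bar> * L1_norm (\<lambda>x. f x - g x)"
  unfolding L1_norm_def right_diff_distrib[symmetric] abs_mult by simp

lemma weak_dual_solution_time_scale:
  assumes l: "l > 0" and c: "c > 0" "c powr (m - 1) = l"
    and u: "weak_dual_solution G m (l * T) u\<^sub>0 u"
  shows "weak_dual_solution G m T (\<lambda>x. c * u\<^sub>0 x) (\<lambda>t x. c * u (l * t) x)"
proof -
  have J: "t \<in> {0..T} \<longleftrightarrow> l * t \<in> {0..l * T}" for t
    using l by (auto simp: zero_le_mult_iff)
  have J': "t \<in> {0<..<T} \<longleftrightarrow> l * t \<in> {0<..<l * T}" for t
    using l by (auto simp: zero_less_mult_iff)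
  have m: "set_borel_measurable lborel ({0..l * T} \<times> UNIV) (\<lambda>(t, x). u t x)"
    and nonneg: "\<forall>t\<in>{0..l * T}. AE x in lborel. 0 \<le> u t x"
    and cont: "L1_continuous_on {0..l * T} u"
    and loc: "\<And>K. compact K \<Longrightarrow> set_integrable lborel ({0<..<l * T} \<times> K) (\<lambda>(t, x). u t x powr m)"
    and ident: "AE (\<tau>\<^sub>1, \<tau>\<^sub>2) in lborel. 0 < \<tau>\<^sub>1 \<and> \<tau>\<^sub>1 \<le> \<tau>\<^sub>2 \<and> \<tau>\<^sub>2 \<le> l * T \<longrightarrow>
       (\<forall>\<psi> \<psi>'. C1_Linf_c \<tau>\<^sub>1 \<tau>\<^sub>2 \<psi> \<psi>' \<longrightarrow> weak_dual_identity G m u \<tau>\<^sub>1 \<tau>\<^sub>2 \<psi> \<psi>')"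
    and init: "AE x in lborel. u 0 x = u\<^sub>0 x"
    using u unfolding weak_dual_solution_def by blast+
  show ?thesis
    unfolding weak_dual_solution_def
  proof (intro conjI)
    have "(\<lambda>z. c * (indicat_real ({0..T} \<times> UNIV) z *\<^sub>R (case time_scale l z of (t, x) \<Rightarrow> u t x))) \<in> borel_measurable lborel"
      using set_borel_measurable_time_scale[OF m J]
      unfolding set_borel_measurable_def by (rule borel_measurable_times[OF borel_measurable_const])
    then show "set_borel_measurable lborel ({0..T} \<times> UNIV) (\<lambda>(t, x). c * u (l * t) x)"
      unfolding set_borel_measurable_def time_scale_def by (simp add: case_prod_unfold mult_ac)
    show "\<forall>t\<in>{0..T}. AE x in lborel. 0 \<le> c * u (l * t) x"
    proof
      fix t assume "t \<in> {0..T}"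
      then have "AE x in lborel. 0 \<le> u (l * t) x" using nonneg J[of t] by blast
      then show "AE x in lborel. 0 \<le> c * u (l * t) x"
        by eventually_elim (use c in simp)
    qed
    show "L1_continuous_on {0..T} (\<lambda>t x. c * u (l * t) x)"
      unfolding L1_continuous_on_def
    proof (intro conjI ballI)
      fix t assume t: "t \<in> {0..T}"
      then have lt: "l * t \<in> {0..l * T}" using J[of t] by blast
      show "(\<lambda>x. c * u (l * t) x) \<in> L1"
        using cont lt unfolding L1_continuous_on_def L1_def by auto
      have "((\<lambda>s. L1_norm (\<lambda>x. u s x - u (l * t) x)) \<longlongrightarrow> 0) (at (l * t) within {0..l * T})"
        using cont lt unfolding L1_continuous_on_def by blast
      from filterlim_compose[OF this filterlim_times_within[OF l J]]
      have "((\<lambda>s. \<bar>c\<bar> * L1_norm (\<lambda>x. u (l * s) x - u (l * t) x)) \<longlongrightarrow> \<bar>c\<bar> * 0) (at t within {0..T})"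
        by (intro tendsto_mult tendsto_const)
      then show "((\<lambda>s. L1_norm (\<lambda>x. c * u (l * s) x - c * u (l * t) x)) \<longlongrightarrow> 0) (at t within {0..T})"
        unfolding L1_norm_cmult_diff by simp
    qed
    show "\<forall>K. compact K \<longrightarrow> set_integrable lborel ({0<..<T} \<times> K) (\<lambda>(t, x). (c * u (l * t) x) powr m)"
    proof (intro allI impI)
      fix K :: "'a set" assume "compact K"
      from set_integral_time_scale(1)[OF loc[OF this] l J']
      have "set_integrable lborel ({0<..<T} \<times> K) (\<lambda>z. c * l * (case time_scale l z of (t, x) \<Rightarrow> u t x powr m))"
        by (intro set_integrable_mult_right)
      then show "set_integrable lborel ({0<..<T} \<times> K) (\<lambda>(t, x). (c * u (l * t) x) powr m)"
        unfolding powr_time_scale[OF c] time_scale_def by (simp add: case_prod_unfold)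
    qed
    have "AE z in lborel. case 0 + l *\<^sub>R z of (\<tau>\<^sub>1, \<tau>\<^sub>2) \<Rightarrow> 0 < \<tau>\<^sub>1 \<and> \<tau>\<^sub>1 \<le> \<tau>\<^sub>2 \<and> \<tau>\<^sub>2 \<le> l * T \<longrightarrow>
       (\<forall>\<psi> \<psi>'. C1_Linf_c \<tau>\<^sub>1 \<tau>\<^sub>2 \<psi> \<psi>' \<longrightarrow> weak_dual_identity G m u \<tau>\<^sub>1 \<tau>\<^sub>2 \<psi> \<psi>')"
      by (rule AE_lborel_affine[OF ident]) (use l in simp)
    then show "AE (\<tau>\<^sub>1, \<tau>\<^sub>2) in lborel. 0 < \<tau>\<^sub>1 \<and> \<tau>\<^sub>1 \<le> \<tau>\<^sub>2 \<and> \<tau>\<^sub>2 \<le> T \<longrightarrow>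
       (\<forall>\<psi> \<psi>'. C1_Linf_c \<tau>\<^sub>1 \<tau>\<^sub>2 \<psi> \<psi>' \<longrightarrow> weak_dual_identity G m (\<lambda>t x. c * u (l * t) x) \<tau>\<^sub>1 \<tau>\<^sub>2 \<psi> \<psi>')"
    proof eventually_elim
      case (elim z)
      obtain a b where z: "z = (a, b)" by (cases z)
      show ?case
        unfolding z case_prod_conv
      proof (intro impI allI)
        fix \<psi> \<psi>' assume ab: "0 < a \<and> a \<le> b \<and> b \<le> T" and C1: "C1_Linf_c a b \<psi> (\<psi>' :: real \<Rightarrow> 'a \<Rightarrow> real)"
        have "0 < l * a \<and> l * a \<le> l * b \<and> l * b \<le> l * T" using ab l by simp
        with elim C1_Linf_c_time_scale[OF l C1]
        have "weak_dual_identity G m u (l * a) (l * b) (\<lambda>s. \<psi> (s / l)) (\<lambda>s x. 1 / l * \<psi>' (s / l) x)"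
          unfolding z by (simp only: scaleR_Pair case_prod_conv real_scaleR_def add_0_left)
        then show "weak_dual_identity G m (\<lambda>t x. c * u (l * t) x) a b \<psi> \<psi>'"
          by (rule weak_dual_identity_time_scale[OF l c])
      qed
    qed
    show "AE x in lborel. c * u (l * 0) x = c * u\<^sub>0 x"
      using init by eventually_elim simp
  qed
qed

text \<open>
  Homogeneity of the equation: \<open>c u(l t)\<close> is again a solution if \<open>c\<^bsup>m-1\<^esup> = l\<close>.
\<close>

lemma global_weak_dual_solution_time_scale:
  assumes l: "l > 0" and c: "c > 0" "c powr (m - 1) = l"
    and u: "global_weak_dual_solution G m u\<^sub>0 u"
  shows "global_weak_dual_solution G m (\<lambda>x. c * u\<^sub>0 x) (\<lambda>t x. c * u (l * t) x)"
  using u l unfolding global_weak_dual_solution_def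
  by (intro allI impI weak_dual_solution_time_scale[OF l c]) simp

section \<open>Monotonicity in time\<close>

lemma L1_continuous_onD:
  assumes u: "L1_continuous_on I u" and t: "t \<in> I" and e: "e > 0"
  shows "\<exists>d>0. \<forall>s\<in>I. \<bar>s - t\<bar> < d \<longrightarrow> L1_norm (\<lambda>x. u s x - u t x) < e"
proof -
  have "((\<lambda>s. L1_norm (\<lambda>x. u s x - u t x)) \<longlongrightarrow> 0) (at t within I)"
    using u t unfolding L1_continuous_on_def by blast
  from tendstoD[OF this e] obtain d where d: "d > 0"
    "\<And>s. s \<in> I \<Longrightarrow> s \<noteq> t \<Longrightarrow> dist s t < d \<Longrightarrow> dist (L1_norm (\<lambda>x. u s x - u t x)) 0 < e"
    unfolding eventually_at by blast
  have "L1_norm (\<lambda>x. u s x - u t x) < e" if "s \<in> I" "\<bar>s - t\<bar> < d" for s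
  proof (cases "s = t")
    case True
    then show ?thesis using e by (simp add: L1_norm_def)
  next
    case False
    then show ?thesis using d(2)[of s] that by (simp add: dist_real_def)
  qed
  with d(1) show ?thesis by blast
qed

lemma weak_dual_solutionD:
  assumes "global_weak_dual_solution G m u\<^sub>0 u"
  shows "0 \<le> t \<Longrightarrow> u t \<in> L1"
    and "0 \<le> t \<Longrightarrow> AE x in lborel. 0 \<le> u t x"
    and "T > 0 \<Longrightarrow> L1_continuous_on {0..T} u"
    and "T > 0 \<Longrightarrow> set_borel_measurable lborel ({0..T} \<times> UNIV) (\<lambda>(t, x). u t x)"
    and "AE x in lborel. u 0 x = u\<^sub>0 x"
proof -
  have w: "weak_dual_solution G m T u\<^sub>0 u" if "T > 0" for T
    using assms that unfolding global_weak_dual_solution_def by blast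
  show cont: "L1_continuous_on {0..T} u" if "T > 0" for T
    using w[OF that] unfolding weak_dual_solution_def by blast
  show "set_borel_measurable lborel ({0..T} \<times> UNIV) (\<lambda>(t, x). u t x)" if "T > 0" for T
    using w[OF that] unfolding weak_dual_solution_def by blast
  show "AE x in lborel. u 0 x = u\<^sub>0 x"
    using w[of 1] unfolding weak_dual_solution_def by simp
  show "u t \<in> L1" if "0 \<le> t"
    using cont[of "t + 1"] that unfolding L1_continuous_on_def by simp
  show "AE x in lborel. 0 \<le> u t x" if "0 \<le> t"
    using w[of "t + 1"] that unfolding weak_dual_solution_def by simp
qed

text \<open>
  Comparison of \<open>u\<close> with its rescaling for \<open>l = s / t \<ge> 1\<close>, whose initial datum is larger. The
  comparison principle only speaks about almost every time; continuity in \<open>L1\<close> gives every time.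
\<close>

lemma time_monotonicity:
  fixes u :: "real \<Rightarrow> 'a::euclidean_space \<Rightarrow> real"
  assumes comparison: "comparison_principle G m" and m: "m > 1"
    and u: "global_weak_dual_solution G m u\<^sub>0 u"
    and t: "0 < t" "t \<le> s"
  shows "AE x in lborel. u t x \<le> (s / t) powr (1 / (m - 1)) * u s x"
proof -
  define l where "l = s / t"
  define c where "c = l powr (1 / (m - 1))"
  have l: "l \<ge> 1" unfolding l_def using t by simp
  have lt: "l * t = s" unfolding l_def using t by simp
  have c: "c \<ge> 1" unfolding c_def using l m by (intro ge_one_powr_ge_zero) auto
  have cm: "c powr (m - 1) = l" unfolding c_def using l m by (simp add: powr_powr)
  note L1 = weak_dual_solutionD(1)[OF u]
  have "AE x in lborel. 0 \<le> u\<^sub>0 x"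
    using weak_dual_solutionD(2)[OF u order_refl] weak_dual_solutionD(5)[OF u] by eventually_elim simp
  then have "AE x in lborel. u\<^sub>0 x \<le> c * u\<^sub>0 x"
    by eventually_elim (use c in \<open>simp add: mult_le_cancel_right1\<close>)
  moreover have "global_weak_dual_solution G m (\<lambda>x. c * u\<^sub>0 x) (\<lambda>t x. c * u (l * t) x)"
    by (rule global_weak_dual_solution_time_scale[OF _ _ cm u]) (use l c in auto)
  ultimately have "AE (t, x) in lborel. 0 < t \<longrightarrow> u t x \<le> c * u (l * t) x"
    using comparison u unfolding comparison_principle_def by blast
  then have "AE z in lborel \<Otimes>\<^sub>M lborel. case z of (t, x) \<Rightarrow> 0 < t \<longrightarrow> u t x \<le> c * u (l * t) x"
    unfolding lborel_prod .
  from lborel_pair.AE_pair[OF this]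
  have good: "AE r in lborel. AE x in lborel. 0 < r \<longrightarrow> u r x \<le> c * u (l * r) x"
    by simp
  define g where "g x = max 0 (u t x - c * u s x)" for x
  have int: "integrable lborel (u r)" if "0 \<le> r" for r
    using L1[OF that] by (simp add: L1_def)
  have g_int: "integrable lborel g"
    unfolding g_def using t by (intro integrable_max integrable_zero Bochner_Integration.integrable_diff integrable_mult_right int) auto
  \<comment> \<open>a time \<open>r\<close> just before \<open>t\<close> at which the comparison holds; moving from \<open>r\<close> to \<open>t\<close> costs at most \<open>e\<close> in \<open>u\<close> and \<open>c * e\<close> in its rescaling\<close>
  have le: "(LBINT x. g x) \<le> e * (1 + c)" if e: "e > 0" for e
  proof -
    have cont: "L1_continuous_on {0..s} u"
      by (rule weak_dual_solutionD(3)[OF u]) (use t in simp)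
    obtain d1 where d1: "d1 > 0" "\<And>r. r \<in> {0..s} \<Longrightarrow> \<bar>r - t\<bar> < d1 \<Longrightarrow> L1_norm (\<lambda>x. u r x - u t x) < e"
      using L1_continuous_onD[OF cont _ e, of t] t by auto
    obtain d2 where d2: "d2 > 0" "\<And>r. r \<in> {0..s} \<Longrightarrow> \<bar>r - s\<bar> < d2 \<Longrightarrow> L1_norm (\<lambda>x. u r x - u s x) < e"
      using L1_continuous_onD[OF cont _ e, of s] t by auto
    define d where "d = min t (min d1 (d2 / l))"
    have "d > 0" unfolding d_def using t d1 d2 l by auto
    then obtain r where r: "t - d < r" "r < t" and ae: "AE x in lborel. 0 < r \<longrightarrow> u r x \<le> c * u (l * r) x"
      using AE_lborel_happens_between[OF good, of "t - d" t] by auto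
    have r0: "0 < r" using r unfolding d_def by auto
    have "\<bar>r - t\<bar> < d1" using r unfolding d_def by auto
    then have n1: "L1_norm (\<lambda>x. u r x - u t x) < e"
      using r r0 t by (intro d1) auto
    have "t - r < d2 / l" using r(1) unfolding d_def by linarith
    then have "l * (t - r) < d2" using l by (simp add: field_simps)
    moreover have "l * r < l * t" using r l by simp
    ultimately have "\<bar>l * r - s\<bar> < d2" "l * r \<in> {0..s}"
      using l r0 unfolding lt[symmetric] by (auto simp: right_diff_distrib)
    then have n2: "L1_norm (\<lambda>x. u (l * r) x - u s x) < e"
      by (intro d2)
    have i: "integrable lborel (\<lambda>x. \<bar>u r x - u t x\<bar>)" "integrable lborel (\<lambda>x. \<bar>u (l * r) x - u s x\<bar>)"
      using int[of r] int[of t] int[of "l * r"] int[of s] r0 t l by auto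
    have "(LBINT x. g x) \<le> (LBINT x. \<bar>u r x - u t x\<bar> + c * \<bar>u (l * r) x - u s x\<bar>)"
    proof (rule integral_mono_AE[OF g_int])
      show "integrable lborel (\<lambda>x. \<bar>u r x - u t x\<bar> + c * \<bar>u (l * r) x - u s x\<bar>)"
        using i by auto
      show "AE x in lborel. g x \<le> \<bar>u r x - u t x\<bar> + c * \<bar>u (l * r) x - u s x\<bar>"
        using ae
      proof eventually_elim
        case (elim x)
        have "u t x - c * u s x = (u t x - u r x) + (u r x - c * u (l * r) x) + c * (u (l * r) x - u s x)"
          by (simp add: algebra_simps)
        moreover have "c * (u (l * r) x - u s x) \<le> c * \<bar>u (l * r) x - u s x\<bar>"
          using c by (intro mult_left_mono) auto
        moreover have "0 \<le> c * \<bar>u (l * r) x - u s x\<bar>" using c by simp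
        ultimately show ?case unfolding g_def using elim r0 by auto
      qed
    qed
    also have "\<dots> = L1_norm (\<lambda>x. u r x - u t x) + c * L1_norm (\<lambda>x. u (l * r) x - u s x)"
      using i unfolding L1_norm_def by simp
    also have "\<dots> \<le> e + c * e"
      using n1 n2 c by (intro add_mono mult_left_mono) auto
    finally show ?thesis by (simp add: algebra_simps)
  qed
  have "(LBINT x. g x) \<le> 0"
  proof (rule field_le_epsilon)
    fix e :: real assume "e > 0"
    then show "(LBINT x. g x) \<le> 0 + e"
      using le[of "e / (1 + c)"] c by simp
  qed
  moreover have "0 \<le> (LBINT x. g x)"
    by (rule Bochner_Integration.integral_nonneg) (simp add: g_def)
  ultimately have "(LBINT x. g x) = 0" by simp
  then have "AE x in lborel. g x = 0"
    by (subst (asm) integral_nonneg_eq_0_iff_AE[OF g_int]) (simp_all add: g_def)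
  then show ?thesis
    by eventually_elim (simp add: g_def c_def l_def max_def split: if_splits)
qed

section \<open>The time integral of the nonlinearity\<close>

lemma C1_Linf_c_indicator:
  fixes B :: "'a::euclidean_space set"
  assumes [measurable]: "B \<in> sets borel" and B: "bounded B"
  shows "C1_Linf_c a b (\<lambda>t. indicat_real B) (\<lambda>t x. 0 :: real)"
proof -
  have inf: "indicat_real B \<in> Linf" "(\<lambda>x::'a. 0 :: real) \<in> Linf"
  proof -
    have "esssup lborel (\<lambda>x. ennreal \<bar>indicat_real B x\<bar>) \<le> 1"
      by (rule esssup_I) (auto simp: indicator_def)
    then show "indicat_real B \<in> Linf"
      by (auto simp: Linf_def Lr_norm_def intro: le_less_trans)
    have "esssup lborel (\<lambda>x::'a. ennreal \<bar>0 :: real\<bar>) \<le> 0"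
      by (rule esssup_I) auto
    then show "(\<lambda>x::'a. 0 :: real) \<in> Linf"
      by (auto simp: Linf_def Lr_norm_def)
  qed
  have zero: "Lr_norm top (\<lambda>x::'a. 0) = 0"
  proof -
    have "esssup lborel (\<lambda>x::'a. ennreal \<bar>0 :: real\<bar>) \<le> 0"
      by (rule esssup_I) auto
    then show ?thesis by (simp add: Lr_norm_def)
  qed
  have m: "(\<lambda>z. indicat_real ({a..b} \<times> UNIV) z *\<^sub>R indicat_real B (snd z)) \<in> borel_measurable (lborel :: (real \<times> 'a) measure)"
    unfolding lborel_prod[symmetric] by measurable
  show ?thesis
    unfolding C1_Linf_c_def
  proof (intro conjI ballI)
    show "set_borel_measurable lborel ({a..b} \<times> UNIV) (\<lambda>(t, x). indicat_real B x)"
      using m unfolding set_borel_measurable_def by (simp add: case_prod_unfold)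
    show "set_borel_measurable lborel ({a..b} \<times> UNIV) (\<lambda>(t, x). 0 :: real)"
      unfolding set_borel_measurable_def by (simp add: case_prod_unfold)
    show "\<exists>K. compact K \<and> (\<forall>t\<in>{a..b}. AE x in lborel. x \<notin> K \<longrightarrow> indicat_real B x = 0)"
      using B closure_subset[of B] by (intro exI[of _ "closure B"]) (auto simp: compact_closure indicator_def)
  qed (use inf zero in simp_all)
qed


text \<open>
  The function \<open>w = \<integral>\<^sub>a\<^sup>b u\<^sup>m dt\<close>, with values in \<open>[0,\<infinity>]\<close>.
\<close>

definition accumulated_power :: "real \<Rightarrow> real \<Rightarrow> real \<Rightarrow> (real \<Rightarrow> 'a \<Rightarrow> real) \<Rightarrow> 'a \<Rightarrow> ennreal" where
  "accumulated_power m a b u x = (\<integral>\<^sup>+t\<in>{a..b}. ennreal (u t x powr m) \<partial>lborel)"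

lemma accumulated_power_eq:
  "accumulated_power m a b u x
    = (\<integral>\<^sup>+t. ennreal ((indicat_real ({a..b} \<times> UNIV) (t, x) *\<^sub>R u t x) powr m) \<partial>lborel)"
  unfolding accumulated_power_def by (intro nn_integral_cong) (simp add: indicator_def)

lemma pair_measurable_of_set_borel_measurable:
  fixes u :: "real \<Rightarrow> 'a::euclidean_space \<Rightarrow> real"
  assumes "set_borel_measurable lborel ({a..b} \<times> UNIV) (\<lambda>(t, x). u t x)"
  shows "(\<lambda>(t, x). indicat_real ({a..b} \<times> UNIV) (t, x) *\<^sub>R u t x) \<in> borel_measurable (borel \<Otimes>\<^sub>M borel)"
  using assms unfolding set_borel_measurable_def borel_prod by (simp add: case_prod_unfold)

lemma accumulated_power_measurable:
  fixes u :: "real \<Rightarrow> 'a::euclidean_space \<Rightarrow> real"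
  assumes "set_borel_measurable lborel ({a..b} \<times> UNIV) (\<lambda>(t, x). u t x)"
  shows "accumulated_power m a b u \<in> borel_measurable borel"
proof -
  define v where "v t x = indicat_real ({a..b} \<times> UNIV) (t, x) *\<^sub>R u t x" for t x
  have [measurable]: "case_prod v \<in> borel_measurable (borel \<Otimes>\<^sub>M borel)"
    using pair_measurable_of_set_borel_measurable[OF assms] unfolding v_def .
  show ?thesis
    unfolding accumulated_power_eq[abs_def] v_def[symmetric] by measurable
qed

text \<open>
  The integrated equation \<open>w + (I - \<LL>)\<^sup>-\<^sup>1 u(b) = (I - \<LL>)\<^sup>-\<^sup>1 (w + u(a))\<close>. Testing with the
  indicator of a bounded set \<open>B\<close> and moving the potential to the other factor gives equality of
  the integrals over \<open>B\<close>, all of which are finite.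
\<close>

lemma accumulated_power_identity:
  fixes u :: "real \<Rightarrow> 'a::euclidean_space \<Rightarrow> real"
  assumes H: "heat_kernel D A H"
    and G: "green_function D' A' G"
    and G_H: "\<And>x\<^sub>0. AE x in lborel. G x\<^sub>0 x = (LBINT t:{0<..}. exp (- t) * H t x\<^sub>0 x)"
    and um: "set_borel_measurable lborel ({a..b} \<times> UNIV) (\<lambda>(t, x). u t x)"
    and u_L1: "u a \<in> L1" "u b \<in> L1"
    and u_nonneg: "AE x in lborel. 0 \<le> u a x" "AE x in lborel. 0 \<le> u b x"
    and ident: "\<And>\<psi> \<psi>'. C1_Linf_c a b \<psi> \<psi>' \<Longrightarrow> weak_dual_identity G m u a b \<psi> \<psi>'"
  shows "AE x in lborel. accumulated_power m a b u x + sub_markov_semigroup.potential (nn_heat H) (\<lambda>y. ennreal (u b y)) x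
      = sub_markov_semigroup.potential (nn_heat H) (\<lambda>y. accumulated_power m a b u y + ennreal (u a y)) x"
    and "AE x in lborel. accumulated_power m a b u x + sub_markov_semigroup.potential (nn_heat H) (\<lambda>y. ennreal (u b y)) x \<noteq> \<infinity>"
proof -
  interpret sub_markov_semigroup "nn_heat H" by (rule sub_markov_semigroup_nn_heat[OF H])
  define w where "w = accumulated_power m a b u"
  define v where "v t x = (indicat_real ({a..b} \<times> UNIV) (t, x) *\<^sub>R u t x) powr m" for t x
  note [measurable] = pair_measurable_of_set_borel_measurable[OF um]
  have v [measurable]: "case_prod v \<in> borel_measurable (borel \<Otimes>\<^sub>M borel)"
    unfolding v_def by measurable
  have v0: "v t x \<ge> 0" for t x unfolding v_def by simp
  have v_eq: "indicat_real ({a..b} \<times> UNIV) (t, x) *\<^sub>R (u t x powr m * c) = v t x * c" for t x c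
    unfolding v_def by (simp add: indicator_def)
  have w_eq: "w x = (\<integral>\<^sup>+t. ennreal (v t x) \<partial>lborel)" for x
    unfolding w_def v_def by (rule accumulated_power_eq)
  have w [measurable]: "w \<in> borel_measurable borel"
    unfolding w_def by (rule accumulated_power_measurable[OF um])
  note [measurable] = L1_measurable[OF u_L1(1)] L1_measurable[OF u_L1(2)]
  have Fubini: "(\<integral>\<^sup>+z. ennreal (v (fst z) (snd z)) * g (snd z) \<partial>lborel) = (\<integral>\<^sup>+x. w x * g x \<partial>lborel)"
    if [measurable]: "g \<in> borel_measurable borel" for g :: "'a \<Rightarrow> ennreal"
  proof -
    have "(\<integral>\<^sup>+z. ennreal (v (fst z) (snd z)) * g (snd z) \<partial>(lborel \<Otimes>\<^sub>M lborel))
      = (\<integral>\<^sup>+x. \<integral>\<^sup>+t. ennreal (v t x) * g x \<partial>lborel \<partial>lborel)"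
      by (subst lborel_pair.nn_integral_snd[symmetric]) simp_all
    also have "\<dots> = (\<integral>\<^sup>+x. w x * g x \<partial>lborel)"
      unfolding w_eq by (intro nn_integral_cong nn_integral_multc) measurable
    finally show ?thesis unfolding lborel_prod .
  qed
  have key: "(\<integral>\<^sup>+x\<in>B. (w x + potential (\<lambda>y. ennreal (u b y)) x) \<partial>lborel)
      = (\<integral>\<^sup>+x\<in>B. potential (\<lambda>y. w y + ennreal (u a y)) x \<partial>lborel)
    \<and> (\<integral>\<^sup>+x\<in>B. (w x + potential (\<lambda>y. ennreal (u b y)) x) \<partial>lborel) < \<infinity>"
    if B [measurable]: "B \<in> sets borel" and bB: "bounded B" for B
  proof -
    define \<psi> where "\<psi> = indicat_real B"
    have \<psi>m [measurable]: "\<psi> \<in> borel_measurable borel" unfolding \<psi>_def by measurable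
    have \<psi>0: "\<psi> x \<ge> 0" for x unfolding \<psi>_def by simp
    have \<psi>e: "ennreal (\<psi> x) = indicator B x" for x unfolding \<psi>_def by (simp add: indicator_def)
    have \<psi>_L1: "\<psi> \<in> L1"
      unfolding L1_def \<psi>_def using emeasure_bounded_finite[OF bB]
      by (auto intro!: integrable_real_indicator)
    have "C1_Linf_c a b (\<lambda>t. \<psi>) (\<lambda>t x. 0)"
      unfolding \<psi>_def by (rule C1_Linf_c_indicator[OF B bB])
    note id = ident[OF this]
    note pot = green_inverse_eq_potential[OF H G G_H]
    have pot\<psi>: "AE x in lborel. 0 \<le> green_inverse G \<psi> x \<and> ennreal (green_inverse G \<psi> x) = potential (\<lambda>y. ennreal (\<psi> y)) x"
      by (rule pot[OF \<psi>_L1]) (simp add: \<psi>0)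
    define F2 where "F2 = (LBINT z. v (fst z) (snd z) * \<psi> (snd z))"
    define F3 where "F3 = (LBINT z. v (fst z) (snd z) * green_inverse G \<psi> (snd z))"
    define J where "J t = (LBINT x. green_inverse G (u t) x * \<psi> x)" for t
    have i2: "integrable lborel (\<lambda>z. v (fst z) (snd z) * \<psi> (snd z))"
      and i3: "integrable lborel (\<lambda>z. v (fst z) (snd z) * green_inverse G \<psi> (snd z))"
      using id unfolding weak_dual_identity_def set_integrable_def
      by (simp_all add: v_eq[symmetric] case_prod_unfold)
    have ij: "integrable lborel (\<lambda>x. green_inverse G (u a) x * \<psi> x)" "integrable lborel (\<lambda>x. green_inverse G (u b) x * \<psi> x)"
      using id unfolding weak_dual_identity_def by blast+
    have "set_lebesgue_integral lborel ({a..b} \<times> UNIV)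
      (\<lambda>(t, x). green_inverse G (u t) x * 0 - u t x powr m * \<psi> x + u t x powr m * green_inverse G \<psi> x) = J b - J a"
      using id unfolding weak_dual_identity_def J_def by blast
    also have "set_lebesgue_integral lborel ({a..b} \<times> UNIV)
      (\<lambda>(t, x). green_inverse G (u t) x * 0 - u t x powr m * \<psi> x + u t x powr m * green_inverse G \<psi> x)
      = (LBINT z. v (fst z) (snd z) * green_inverse G \<psi> (snd z) - v (fst z) (snd z) * \<psi> (snd z))"
      unfolding set_lebesgue_integral_def v_eq[symmetric]
      by (intro Bochner_Integration.integral_cong) (auto simp: algebra_simps)
    also have "\<dots> = F3 - F2"
      unfolding F2_def F3_def by (rule Bochner_Integration.integral_diff[OF i3 i2])
    finally have bal: "F2 + J b = F3 + J a" by simp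
    have F2: "F2 \<ge> 0" "ennreal F2 = (\<integral>\<^sup>+x\<in>B. w x \<partial>lborel)"
    proof -
      show "F2 \<ge> 0" unfolding F2_def using v0 \<psi>0 by (intro Bochner_Integration.integral_nonneg) simp
      have "ennreal F2 = (\<integral>\<^sup>+z. ennreal (v (fst z) (snd z) * \<psi> (snd z)) \<partial>lborel)"
        unfolding F2_def using v0 \<psi>0 by (intro nn_integral_eq_integral[symmetric] i2) simp
      also have "\<dots> = (\<integral>\<^sup>+z. ennreal (v (fst z) (snd z)) * ennreal (\<psi> (snd z)) \<partial>lborel)"
        using v0 \<psi>0 by (simp add: ennreal_mult)
      also have "\<dots> = (\<integral>\<^sup>+x. w x * ennreal (\<psi> x) \<partial>lborel)"
        by (rule Fubini) measurable
      finally show "ennreal F2 = (\<integral>\<^sup>+x\<in>B. w x \<partial>lborel)" by (simp add: \<psi>e)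
    qed
    have F3: "F3 \<ge> 0" "ennreal F3 = (\<integral>\<^sup>+x\<in>B. potential w x \<partial>lborel)"
    proof -
      have ae: "AE z in (lborel :: (real \<times> 'a) measure). 0 \<le> green_inverse G \<psi> (snd z) \<and>
          ennreal (green_inverse G \<psi> (snd z)) = potential (\<lambda>y. ennreal (\<psi> y)) (snd z)"
        by (rule AE_lborel_snd[OF pot\<psi>])
      have ae0: "AE z in lborel. 0 \<le> v (fst z) (snd z) * green_inverse G \<psi> (snd z)"
        using ae by eventually_elim (simp add: v0)
      show "F3 \<ge> 0" unfolding F3_def by (rule integral_nonneg_AE[OF ae0])
      have "ennreal F3 = (\<integral>\<^sup>+z. ennreal (v (fst z) (snd z) * green_inverse G \<psi> (snd z)) \<partial>lborel)"
        unfolding F3_def by (rule nn_integral_eq_integral[OF i3 ae0, symmetric])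
      also have "\<dots> = (\<integral>\<^sup>+z. ennreal (v (fst z) (snd z)) * potential (\<lambda>y. ennreal (\<psi> y)) (snd z) \<partial>lborel)"
        by (rule nn_integral_cong_AE) (use ae in eventually_elim, auto simp: ennreal_mult v0)
      also have "\<dots> = (\<integral>\<^sup>+x. w x * potential (\<lambda>y. ennreal (\<psi> y)) x \<partial>lborel)"
        by (rule Fubini) measurable
      also have "\<dots> = (\<integral>\<^sup>+x. ennreal (\<psi> x) * potential w x \<partial>lborel)"
        by (rule potential_symmetric) measurable
      finally show "ennreal F3 = (\<integral>\<^sup>+x\<in>B. potential w x \<partial>lborel)" by (simp add: \<psi>e mult.commute)
    qed
    have Jt: "J t \<ge> 0 \<and> ennreal (J t) = (\<integral>\<^sup>+x\<in>B. potential (\<lambda>y. ennreal (u t y)) x \<partial>lborel)"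
      if L: "u t \<in> L1" and nn: "AE x in lborel. 0 \<le> u t x" and i: "integrable lborel (\<lambda>x. green_inverse G (u t) x * \<psi> x)" for t
    proof -
      have ae0: "AE x in lborel. 0 \<le> green_inverse G (u t) x * \<psi> x"
        using pot[OF L nn] by eventually_elim (simp add: \<psi>0)
      have "ennreal (J t) = (\<integral>\<^sup>+x. ennreal (green_inverse G (u t) x * \<psi> x) \<partial>lborel)"
        unfolding J_def by (rule nn_integral_eq_integral[OF i ae0, symmetric])
      also have "\<dots> = (\<integral>\<^sup>+x\<in>B. potential (\<lambda>y. ennreal (u t y)) x \<partial>lborel)"
        by (rule nn_integral_cong_AE) (use pot[OF L nn] in eventually_elim, auto simp: ennreal_mult \<psi>0 \<psi>e)
      finally show ?thesis
        unfolding J_def using integral_nonneg_AE[OF ae0] by simp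
    qed
    note Ja = Jt[OF u_L1(1) u_nonneg(1) ij(1)] and Jb = Jt[OF u_L1(2) u_nonneg(2) ij(2)]
    have Bi [measurable]: "(indicator B :: 'a \<Rightarrow> ennreal) \<in> borel_measurable borel"
      by (rule borel_measurable_indicator[OF B])
    have "(\<integral>\<^sup>+x\<in>B. (w x + potential (\<lambda>y. ennreal (u b y)) x) \<partial>lborel)
      = (\<integral>\<^sup>+x\<in>B. w x \<partial>lborel) + (\<integral>\<^sup>+x\<in>B. potential (\<lambda>y. ennreal (u b y)) x \<partial>lborel)"
      unfolding distrib_right by (rule nn_integral_add) measurable
    also have "\<dots> = ennreal (F2 + J b)"
      using F2 Jb by (simp add: ennreal_plus)
    finally have 1: "(\<integral>\<^sup>+x\<in>B. (w x + potential (\<lambda>y. ennreal (u b y)) x) \<partial>lborel) = ennreal (F2 + J b)" .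
    have "(\<integral>\<^sup>+x\<in>B. potential (\<lambda>y. w y + ennreal (u a y)) x \<partial>lborel)
      = (\<integral>\<^sup>+x. potential w x * indicator B x + potential (\<lambda>y. ennreal (u a y)) x * indicator B x \<partial>lborel)"
      by (intro nn_integral_cong) (subst potential_add, measurable, rule distrib_right)
    also have "\<dots> = (\<integral>\<^sup>+x\<in>B. potential w x \<partial>lborel) + (\<integral>\<^sup>+x\<in>B. potential (\<lambda>y. ennreal (u a y)) x \<partial>lborel)"
      by (rule nn_integral_add) measurable
    also have "\<dots> = ennreal (F3 + J a)"
      using F3 Ja by (simp add: ennreal_plus)
    finally show ?thesis unfolding 1 bal by simp
  qed
  show "AE x in lborel. accumulated_power m a b u x + potential (\<lambda>y. ennreal (u b y)) x
      = potential (\<lambda>y. accumulated_power m a b u y + ennreal (u a y)) x"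
    unfolding w_def[symmetric] by (rule AE_eq_of_nn_integral_bounded_sets[OF _ _ conjunct1[OF key]]; (assumption | measurable))
  show "AE x in lborel. accumulated_power m a b u x + potential (\<lambda>y. ennreal (u b y)) x \<noteq> \<infinity>"
    unfolding w_def[symmetric] by (rule nn_integral_finite_on_balls_AE[OF _ conjunct2[OF key]]; (assumption | measurable))
qed

lemma AE_accumulated_power_bounds:
  fixes u :: "real \<Rightarrow> 'a::euclidean_space \<Rightarrow> real"
  assumes um: "set_borel_measurable lborel ({a..b} \<times> UNIV) (\<lambda>(t, x). u t x)"
    and [measurable]: "u a \<in> borel_measurable borel" "u b \<in> borel_measurable borel"
    and nonneg: "\<And>t. t \<in> {a..b} \<Longrightarrow> AE x in lborel. 0 \<le> u t x"
    and lower: "\<And>t. t \<in> {a..b} \<Longrightarrow> AE x in lborel. u a x \<le> \<kappa> * u t x"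
    and upper: "\<And>t. t \<in> {a..b} \<Longrightarrow> AE x in lborel. u t x \<le> \<kappa> * u b x"
    and ab: "a < b" and \<kappa>: "\<kappa> > 0" and m: "m > 0"
  shows "AE x in lborel. ennreal ((b - a) * (u a x / \<kappa>) powr m) \<le> accumulated_power m a b u x
    \<and> accumulated_power m a b u x \<le> ennreal ((b - a) * (\<kappa> * u b x) powr m)"
proof -
  define v where "v t x = indicat_real ({a..b} \<times> UNIV) (t, x) *\<^sub>R u t x" for t x
  have [measurable]: "case_prod v \<in> borel_measurable (borel \<Otimes>\<^sub>M borel)"
    using pair_measurable_of_set_borel_measurable[OF um] unfolding v_def .
  have v: "v t x = u t x" if "t \<in> {a..b}" for t x
    using that by (simp add: v_def)
  have "AE t in lborel. AE x in lborel. t \<in> {a..b} \<longrightarrow> u a x \<le> \<kappa> * v t x \<and> 0 \<le> v t x \<and> v t x \<le> \<kappa> * u b x"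
  proof (rule AE_I2)
    fix t
    show "AE x in lborel. t \<in> {a..b} \<longrightarrow> u a x \<le> \<kappa> * v t x \<and> 0 \<le> v t x \<and> v t x \<le> \<kappa> * u b x"
    proof (cases "t \<in> {a..b}")
      case True
      show ?thesis
        using nonneg[OF True] lower[OF True] upper[OF True] by eventually_elim (simp add: v True)
    next
      case False
      then show ?thesis by (intro AE_I2) blast
    qed
  qed
  moreover have "{z \<in> space (lborel \<Otimes>\<^sub>M lborel). fst z \<in> {a..b} \<longrightarrow>
      u a (snd z) \<le> \<kappa> * v (fst z) (snd z) \<and> 0 \<le> v (fst z) (snd z) \<and> v (fst z) (snd z) \<le> \<kappa> * u b (snd z)}
      \<in> sets (lborel \<Otimes>\<^sub>M (lborel :: 'a measure))"
    by measurable
  ultimately have "AE x in lborel. AE t in lborel. t \<in> {a..b} \<longrightarrow> u a x \<le> \<kappa> * v t x \<and> 0 \<le> v t x \<and> v t x \<le> \<kappa> * u b x"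
    by (rule iffD1[OF lborel_pair.AE_commute, rotated])
  moreover have "AE x in lborel. 0 \<le> u a x" using nonneg[of a] ab by simp
  ultimately show ?thesis
  proof eventually_elim
    case (elim x)
    have const: "(\<integral>\<^sup>+t\<in>{a..b}. ennreal c \<partial>lborel) = ennreal ((b - a) * c)" if "c \<ge> 0" for c
      using ab that by (simp add: nn_integral_cmult_indicator ennreal_mult mult.commute)
    have "ennreal ((b - a) * (u a x / \<kappa>) powr m) = (\<integral>\<^sup>+t\<in>{a..b}. ennreal ((u a x / \<kappa>) powr m) \<partial>lborel)"
      by (rule const[symmetric]) simp
    also have "\<dots> \<le> accumulated_power m a b u x"
      unfolding accumulated_power_def
    proof (rule nn_integral_mono_AE, use elim(1) in eventually_elim)
      case (elim t)
      show ?case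
      proof (cases "t \<in> {a..b}")
        case True
        then have "u a x / \<kappa> \<le> u t x" using elim \<kappa> v[OF True] by (simp add: field_simps)
        then have "(u a x / \<kappa>) powr m \<le> u t x powr m"
          using m \<kappa> \<open>0 \<le> u a x\<close> by (intro powr_mono2) auto
        then show ?thesis using True by (simp add: ennreal_leI)
      qed simp
    qed
    finally have 1: "ennreal ((b - a) * (u a x / \<kappa>) powr m) \<le> accumulated_power m a b u x" .
    have "accumulated_power m a b u x \<le> (\<integral>\<^sup>+t\<in>{a..b}. ennreal ((\<kappa> * u b x) powr m) \<partial>lborel)"
      unfolding accumulated_power_def
    proof (rule nn_integral_mono_AE, use elim(1) in eventually_elim)
      case (elim t)
      show ?case
      proof (cases "t \<in> {a..b}")
        case True
        then have "u t x powr m \<le> (\<kappa> * u b x) powr m"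
          using m elim v[OF True] by (intro powr_mono2) auto
        then show ?thesis using True by (simp add: ennreal_leI)
      qed simp
    qed
    also have "\<dots> = ennreal ((b - a) * (\<kappa> * u b x) powr m)"
      by (rule const) simp
    finally show ?case using 1 by blast
  qed
qed

section \<open>Boundedness of solutions\<close>

lemma powr_add_le:
  fixes x y q :: real
  assumes "0 \<le> x" "1 \<le> y" "0 < q" "q \<le> 1"
  shows "(x + y) powr q \<le> 2 * (x powr q + y)"
proof -
  have "(x + y) powr q \<le> (2 * max x y) powr q"
    using assms by (intro powr_mono2) auto
  also have "\<dots> = 2 powr q * max x y powr q"
    by (simp add: powr_mult)
  also have "\<dots> \<le> 2 powr 1 * (x powr q + y)"
  proof (intro mult_mono)
    have "y powr q \<le> y powr 1" using assms by (intro powr_mono) auto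
    then show "max x y powr q \<le> x powr q + y"
      using assms by (cases "x \<le> y") (auto simp: max_def intro: order_trans add_increasing)
    show "2 powr q \<le> 2 powr (1 :: real)" using assms by (intro powr_mono) auto
  qed (use assms in auto)
  finally show ?thesis by simp
qed

text \<open>
  The bound for \<open>w\<close>, isolated from the equation: \<open>f\<close> and \<open>g\<close> stand for \<open>u(a)\<close> and \<open>u(b)\<close>, and
  \<open>q\<close> for \<open>1/m\<close>.
\<close>

lemma (in sub_markov_semigroup) bounded_of_potential_identity:
  fixes w :: "'a \<Rightarrow> ennreal" and f g :: "'a \<Rightarrow> real" and C :: "real \<Rightarrow> real" and q r k K :: real
  assumes [measurable]: "w \<in> borel_measurable borel" and f: "f \<in> L1" and g: "g \<in> L1"
    and q: "0 < q" "q < 1" and k: "k \<ge> 0" "K \<ge> 0"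
    and f_nonneg: "AE x in lborel. 0 \<le> f x" and g_nonneg: "AE x in lborel. 0 \<le> g x"
    and f_le: "AE x in lborel. ennreal (f x) \<le> 1 + ennreal k * w x"
    and w_le: "AE x in lborel. enn2real (w x) powr q \<le> K * g x"
    and ident: "AE x in lborel. w x + potential (\<lambda>y. ennreal (g y)) x = potential (\<lambda>y. w y + ennreal (f y)) x"
    and fin: "AE x in lborel. w x + potential (\<lambda>y. ennreal (g y)) x \<noteq> \<infinity>"
    and C: "\<And>t. t > 0 \<Longrightarrow> C t \<ge> 0" "\<And>t. t > 0 \<Longrightarrow> AE x in lborel. h t x \<le> ennreal (C t)"
    and C_int: "set_integrable lborel {0<..} (\<lambda>t. exp (- t) * C t powr r)" and r: "r > 0"
  shows "\<exists>M\<ge>0. AE x in lborel. w x \<le> ennreal M"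
proof -
  note [measurable] = L1_measurable[OF f] L1_measurable[OF g]
  define P where "P = potential (\<lambda>y. ennreal (g y))"
  have [measurable]: "P \<in> borel_measurable borel" unfolding P_def by measurable
  \<comment> \<open>adding \<open>1\<close> makes \<open>V \<ge> 1\<close>, so that powers of \<open>V\<close> increase with the exponent\<close>
  define V where "V x = enn2real (w x + P x) + 1" for x
  have Vm [measurable]: "V \<in> borel_measurable borel" unfolding V_def by measurable
  have V1: "V x \<ge> 1" for x unfolding V_def by simp
  have V_eq: "AE x in lborel. ennreal (V x) = w x + P x + 1"
    using fin unfolding P_def[symmetric]
    by eventually_elim (simp add: V_def ennreal_plus less_top)
  have V_pot: "AE x in lborel. ennreal (V x) = potential (\<lambda>y. w y + ennreal (f y)) x + 1"
    using V_eq ident unfolding P_def by eventually_elim simp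
  have exc: "AE x in lborel. kernel_op (h t) (\<lambda>y. ennreal (V y)) x \<le> ennreal (exp t * V x)" if t: "t > 0" for t
  proof -
    have "AE x in lborel. kernel_op (h t) (potential (\<lambda>y. w y + ennreal (f y))) x
        \<le> ennreal (exp t) * potential (\<lambda>y. w y + ennreal (f y)) x"
      by (rule kernel_op_potential_le[OF _ t]) measurable
    with V_pot show ?thesis
    proof eventually_elim
      case (elim x)
      have "kernel_op (h t) (\<lambda>y. ennreal (V y)) x
        = kernel_op (h t) (\<lambda>y. potential (\<lambda>y. w y + ennreal (f y)) y + 1) x"
        by (rule kernel_op_cong[OF V_pot])
      also have "\<dots> = kernel_op (h t) (potential (\<lambda>y. w y + ennreal (f y))) x + kernel_op (h t) (\<lambda>_. 1) x"
        by (rule kernel_op_add) measurable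
      also have "\<dots> \<le> ennreal (exp t) * potential (\<lambda>y. w y + ennreal (f y)) x + ennreal (exp t) * 1"
      proof (rule add_mono[OF elim(2)])
        have "kernel_op (h t) (\<lambda>_. 1) x \<le> 1" by (rule kernel_op_const_le) (use mass t in auto)
        also have "1 \<le> ennreal (exp t) * 1" using t by simp
        finally show "kernel_op (h t) (\<lambda>_. 1) x \<le> ennreal (exp t) * 1" .
      qed
      also have "\<dots> = ennreal (exp t) * ennreal (V x)"
        unfolding elim(1) by (simp add: distrib_left)
      also have "\<dots> = ennreal (exp t * V x)" using V1[of x] by (simp add: ennreal_mult)
      finally show ?case .
    qed
  qed
  define I where "I = enn2real (\<integral>\<^sup>+x. ennreal (g x) \<partial>lborel)"
  have I: "(\<integral>\<^sup>+x. ennreal (g x) \<partial>lborel) = ennreal I" "I \<ge> 0"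
    using L1_nn_integral_finite[OF g] unfolding I_def by simp_all
  define A where "A = 2 * K * I + 2 * I + 2"
  have A: "A \<ge> 2" unfolding A_def using k I by simp
  have pow: "kernel_op (h t) (\<lambda>y. ennreal (V y powr q)) x \<le> ennreal (A * (C t + 1))" if t: "t > 0" for t x
  proof -
    \<comment> \<open>as \<open>P\<close> is integrable, the crude bound \<open>P + 1\<close> for \<open>(P + 1) powr q\<close> suffices\<close>
    have "AE y in lborel. ennreal (V y powr q) \<le> ennreal (2 * K) * ennreal (g y) + (2 * P y + 2)"
      using fin w_le g_nonneg unfolding P_def[symmetric]
    proof eventually_elim
      case (elim y)
      then have "w y < top" "P y < top" by (auto simp: less_top)
      then have wP: "w y = ennreal (enn2real (w y))" "P y = ennreal (enn2real (P y))" by simp_all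
      have "V y = enn2real (w y) + (enn2real (P y) + 1)"
        unfolding V_def using \<open>w y < top\<close> \<open>P y < top\<close> by (simp add: enn2real_plus)
      then have "V y powr q \<le> 2 * (enn2real (w y) powr q + (enn2real (P y) + 1))"
        using powr_add_le[of "enn2real (w y)" "enn2real (P y) + 1" q] q by simp
      also have "\<dots> \<le> 2 * K * g y + (2 * enn2real (P y) + 2)"
        using elim(2) by simp
      finally have "ennreal (V y powr q) \<le> ennreal (2 * K * g y + (2 * enn2real (P y) + 2))"
        by (rule ennreal_leI)
      also have "\<dots> = ennreal (2 * K) * ennreal (g y) + (2 * ennreal (enn2real (P y)) + 2)"
        using k elim(3) by (simp add: ennreal_plus ennreal_mult)
      finally show ?case unfolding wP(2)[symmetric] .
    qed
    then have "kernel_op (h t) (\<lambda>y. ennreal (V y powr q)) x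
      \<le> kernel_op (h t) (\<lambda>y. ennreal (2 * K) * ennreal (g y) + (2 * P y + 2)) x"
      by (rule kernel_op_mono)
    also have "\<dots> = ennreal (2 * K) * kernel_op (h t) (\<lambda>y. ennreal (g y)) x + (2 * kernel_op (h t) P x + kernel_op (h t) (\<lambda>_. 2) x)"
      by (simp add: kernel_op_add kernel_op_cmult)
    also have "\<dots> \<le> ennreal (2 * K) * ennreal (C t * I) + (2 * ennreal (C t * I) + 2)"
    proof (intro add_mono mult_left_mono)
      show "kernel_op (h t) (\<lambda>y. ennreal (g y)) x \<le> ennreal (C t * I)"
        using kernel_op_le_bound[OF _ C(2)[OF t], of "\<lambda>y. ennreal (g y)" x] C(1)[OF t] I by (simp add: ennreal_mult)
      have "kernel_op (h t) P x \<le> ennreal (C t) * (\<integral>\<^sup>+x. P x \<partial>lborel)"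
        by (rule kernel_op_le_bound[OF _ C(2)[OF t]]) measurable
      also have "\<dots> \<le> ennreal (C t) * ennreal I"
        unfolding P_def I(1)[symmetric] by (intro mult_left_mono nn_integral_potential_le) auto
      finally show "kernel_op (h t) P x \<le> ennreal (C t * I)" using C(1)[OF t] I by (simp add: ennreal_mult)
      show "kernel_op (h t) (\<lambda>_. 2) x \<le> 2" by (rule kernel_op_const_le) (use mass t in auto)
    qed auto
    also have "\<dots> = ennreal (2 * K * (C t * I) + (2 * (C t * I) + 2))"
      using k C(1)[OF t] I by (simp add: ennreal_plus ennreal_mult)
    also have "\<dots> \<le> ennreal (A * (C t + 1))"
    proof (rule ennreal_leI)
      have "0 \<le> 2 * K * I + 2 * I + 2 * C t" using k I C(1)[OF t] by simp
      then show "2 * K * (C t * I) + (2 * (C t * I) + 2) \<le> A * (C t + 1)"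
        unfolding A_def by (simp add: algebra_simps)
    qed
    finally show ?thesis .
  qed
  define \<Lambda> where "\<Lambda> = 1 + k"
  have pot: "AE x in lborel. ennreal (V x) \<le> ennreal \<Lambda> * potential (\<lambda>y. ennreal (V y)) x + ennreal 2"
    using V_pot
  proof eventually_elim
    case (elim x)
    have "AE y in lborel. w y + ennreal (f y) \<le> ennreal \<Lambda> * ennreal (V y) + 1"
      using f_le V_eq
    proof eventually_elim
      case (elim y)
      have "w y + ennreal (f y) \<le> w y + (1 + ennreal k * w y)"
        by (rule add_left_mono[OF elim(1)])
      also have "\<dots> = ennreal \<Lambda> * w y + 1"
        unfolding \<Lambda>_def using k by (simp add: ennreal_plus distrib_left distrib_right ac_simps)
      also have "\<dots> \<le> ennreal \<Lambda> * ennreal (V y) + 1"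
        unfolding elim(2) by (intro add_right_mono mult_left_mono) (simp_all add: add.assoc)
      finally show ?case .
    qed
    then have "potential (\<lambda>y. w y + ennreal (f y)) x \<le> potential (\<lambda>y. ennreal \<Lambda> * ennreal (V y) + 1) x"
      by (rule potential_mono)
    also have "\<dots> = ennreal \<Lambda> * potential (\<lambda>y. ennreal (V y)) x + potential (\<lambda>_. 1) x"
      by (simp add: potential_add potential_cmult)
    also have "\<dots> \<le> ennreal \<Lambda> * potential (\<lambda>y. ennreal (V y)) x + 1"
      by (intro add_left_mono potential_const_le)
    finally have "ennreal (V x) \<le> ennreal \<Lambda> * potential (\<lambda>y. ennreal (V y)) x + 1 + 1"
      unfolding elim by (rule add_right_mono)
    then show ?case by (simp add: add.assoc)
  qed
  define T where "T = 1 / (2 * \<Lambda>)"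
  have T: "T > 0" "\<Lambda> * T \<le> 1 / 2" "\<Lambda> \<ge> 0" unfolding T_def \<Lambda>_def using k by auto
  obtain s E where E: "E \<ge> 1" and s: "\<And>k. s k > 0" "\<And>k. C (s k) \<le> E ^ Suc k" "\<And>k. sum s {..<k} \<le> T"
    using integrable_short_times[OF C_int r T(1) C(1)] by blast
  define D where "D = 2 * A * E"
  have "A * 1 \<le> A * E" using A E by (intro mult_left_mono) auto
  then have D: "D \<ge> 1" unfolding D_def using A by linarith
  have powD: "AE x in lborel. kernel_op (h (s k)) (\<lambda>y. ennreal (V y powr q)) x \<le> ennreal (D ^ Suc k)" for k
  proof (rule AE_I2)
    fix x
    have "1 \<le> E ^ Suc k" using E by (rule one_le_power)
    then have "C (s k) + 1 \<le> 2 * E ^ Suc k" using s(2)[of k] by linarith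
    then have "A * (C (s k) + 1) \<le> A * (2 * E ^ Suc k)" using A by (intro mult_left_mono) auto
    also have "\<dots> = (2 * A) * E ^ Suc k" by simp
    also have "\<dots> \<le> (2 * A) ^ Suc k * E ^ Suc k"
      using A E by (intro mult_right_mono self_le_power) auto
    also have "\<dots> = D ^ Suc k" unfolding D_def by (rule power_mult_distrib[symmetric])
    finally show "kernel_op (h (s k)) (\<lambda>y. ennreal (V y powr q)) x \<le> ennreal (D ^ Suc k)"
      using pow[OF s(1)[of k], of x] by (meson ennreal_leI order_trans)
  qed
  obtain B where B: "B \<ge> 0" "AE x in lborel. kernel_op (h T) (\<lambda>y. ennreal (V y)) x \<le> ennreal B"
    using kernel_op_excessive_bounded[OF Vm V1 q D exc s(1,3) powD] by blast
  have "AE x in lborel. V x \<le> 2 * (\<Lambda> * B + 2)"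
    by (rule excessive_bounded_of_le_potential[OF Vm _ exc T _ B pot]) (use V1 in \<open>auto intro: order_trans[of 0 1]\<close>)
  with V_eq have "AE x in lborel. w x \<le> ennreal (2 * (\<Lambda> * B + 2))"
  proof eventually_elim
    case (elim x)
    have "w x \<le> ennreal (V x)" unfolding elim(1) by (simp add: add.assoc)
    also have "\<dots> \<le> ennreal (2 * (\<Lambda> * B + 2))" by (rule ennreal_leI[OF elim(2)])
    finally show ?case .
  qed
  moreover have "2 * (\<Lambda> * B + 2) \<ge> 0" using T B by simp
  ultimately show ?thesis by blast
qed

lemma bounded_of_bounded_at_AE_times:
  fixes u :: "real \<Rightarrow> 'a::euclidean_space \<Rightarrow> real"
  assumes decay: "Lp_decay G m" and u: "global_weak_dual_solution G m u\<^sub>0 u"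
    and bdd: "AE \<tau> in lborel. 0 < \<tau> \<longrightarrow> (\<exists>M. AE x in lborel. u \<tau> x \<le> M)"
  shows "AE \<tau> in lborel. 0 < \<tau> \<longrightarrow> (\<exists>M. AE (t, x) in lborel. \<tau> \<le> t \<longrightarrow> \<bar>u t x\<bar> \<le> M)"
proof -
  have "AE (\<tau>\<^sub>1, \<tau>\<^sub>2) in lborel. 0 \<le> \<tau>\<^sub>1 \<and> \<tau>\<^sub>1 \<le> \<tau>\<^sub>2 \<longrightarrow> Lr_norm top (u \<tau>\<^sub>2) \<le> Lr_norm top (u \<tau>\<^sub>1)"
    using decay[unfolded Lp_decay_def, rule_format, OF u top_greatest] .
  then have "AE z in lborel \<Otimes>\<^sub>M lborel. case z of (\<tau>\<^sub>1, \<tau>\<^sub>2) \<Rightarrow>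
      0 \<le> \<tau>\<^sub>1 \<and> \<tau>\<^sub>1 \<le> \<tau>\<^sub>2 \<longrightarrow> Lr_norm top (u \<tau>\<^sub>2) \<le> Lr_norm top (u \<tau>\<^sub>1)"
    unfolding lborel_prod .
  from lborel_pair.AE_pair[OF this]
  have "AE \<tau>\<^sub>1 in lborel. AE \<tau>\<^sub>2 in lborel. 0 \<le> \<tau>\<^sub>1 \<and> \<tau>\<^sub>1 \<le> \<tau>\<^sub>2 \<longrightarrow> Lr_norm top (u \<tau>\<^sub>2) \<le> Lr_norm top (u \<tau>\<^sub>1)"
    by simp
  with bdd show ?thesis
  proof eventually_elim
    case (elim \<tau>)
    show ?case
    proof
      assume \<tau>: "0 < \<tau>"
      then obtain M0 where M0: "AE x in lborel. u \<tau> x \<le> M0" using elim(1) by blast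
      define M where "M = max 0 M0"
      have M: "M \<ge> 0" unfolding M_def by simp
      have um: "u t \<in> borel_measurable borel" if "t \<ge> 0" for t
        by (rule L1_measurable[OF weak_dual_solutionD(1)[OF u that]])
      have "AE x in lborel. ennreal \<bar>u \<tau> x\<bar> \<le> ennreal M"
        using M0 weak_dual_solutionD(2)[OF u less_imp_le[OF \<tau>]]
        by eventually_elim (auto simp: M_def intro!: ennreal_leI)
      then have norm: "Lr_norm top (u \<tau>) \<le> ennreal M"
        unfolding Lr_norm_def using um[of \<tau>] \<tau> by (auto intro!: esssup_I)
      have slice: "AE t in lborel. \<tau> \<le> t \<longrightarrow> (AE x in lborel. \<bar>u t x\<bar> \<le> M)"
        using elim(2)
      proof eventually_elim
        case (elim t)
        show ?case
        proof
          assume "\<tau> \<le> t"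
          with elim \<tau> norm have le: "esssup lborel (\<lambda>x. ennreal \<bar>u t x\<bar>) \<le> ennreal M"
            by (auto simp: Lr_norm_def)
          show "AE x in lborel. \<bar>u t x\<bar> \<le> M"
            using esssup_AE[of "\<lambda>x. ennreal \<bar>u t x\<bar>" lborel]
          proof eventually_elim
            case (elim x)
            then have "ennreal \<bar>u t x\<bar> \<le> ennreal M" using le by (rule order_trans)
            then show ?case using M by (simp add: ennreal_le_iff)
          qed
        qed
      qed
      have "AE z in lborel. \<tau> \<le> fst z \<and> fst z \<le> real n \<longrightarrow> \<bar>u (fst z) (snd z)\<bar> \<le> M" for n
      proof (cases "n = 0")
        case True
        then show ?thesis using \<tau> by (intro AE_I2) auto
      next
        case False
        define v where "v t x = indicat_real ({0..real n} \<times> UNIV) (t, x) *\<^sub>R u t x" for t x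
        have [measurable]: "case_prod v \<in> borel_measurable (borel \<Otimes>\<^sub>M borel)"
          using pair_measurable_of_set_borel_measurable[OF weak_dual_solutionD(4)[OF u]] False
          unfolding v_def by simp
        have "AE t in lborel. AE x in lborel. \<tau> \<le> t \<longrightarrow> \<bar>v t x\<bar> \<le> M"
          using slice
        proof eventually_elim
          case (elim t)
          show ?case
          proof (cases "\<tau> \<le> t")
            case True
            with elim have "AE x in lborel. \<bar>u t x\<bar> \<le> M" by blast
            then show ?thesis by eventually_elim (use M in \<open>simp add: v_def indicator_def\<close>)
          next
            case False
            then show ?thesis by (intro AE_I2) blast
          qed
        qed
        moreover have "{z \<in> space (lborel \<Otimes>\<^sub>M lborel). \<tau> \<le> fst z \<longrightarrow> \<bar>v (fst z) (snd z)\<bar> \<le> M}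
            \<in> sets (lborel \<Otimes>\<^sub>M (lborel :: 'a measure))"
          by measurable
        ultimately have "AE z in lborel \<Otimes>\<^sub>M (lborel :: 'a measure). \<tau> \<le> fst z \<longrightarrow> \<bar>v (fst z) (snd z)\<bar> \<le> M"
          by (intro lborel_pair.AE_pair_measure) auto
        then show ?thesis
          unfolding lborel_prod by eventually_elim (use \<tau> in \<open>auto simp: v_def indicator_def mem_Times_iff\<close>)
      qed
      then have "AE z in lborel. \<forall>n::nat. \<tau> \<le> fst z \<and> fst z \<le> real n \<longrightarrow> \<bar>u (fst z) (snd z)\<bar> \<le> M"
        unfolding AE_all_countable by blast
      then have "AE (t, x) in lborel. \<tau> \<le> t \<longrightarrow> \<bar>u t x\<bar> \<le> M"
      proof eventually_elim
        case (elim z)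
        obtain n :: nat where "fst z \<le> real n" using real_arch_simple by blast
        then show ?case using elim[rule_format, of n] by (simp add: case_prod_unfold)
      qed
      then show "\<exists>M. AE (t, x) in lborel. \<tau> \<le> t \<longrightarrow> \<bar>u t x\<bar> \<le> M" by blast
    qed
  qed
qed

lemma heat_kernel_convolution_le:
  assumes H: "heat_kernel D A H" and t: "t > 0"
    and C: "AE x in lborel. 0 \<le> H t 0 x \<and> H t 0 x \<le> C"
    and f: "f \<in> L1" "AE x in lborel. 0 \<le> f x"
  shows "(LBINT y. H t y x * f y) \<le> C * (LBINT y. f y)"
proof -
  have ae: "AE y in lborel. 0 \<le> H t y x * f y \<and> H t y x * f y \<le> C * f y"
    using AE_lborel_reflect[OF C, of x] f(2)
  proof eventually_elim
    case (elim y)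
    then show ?case
      unfolding heat_kernelD(2)[OF H t, of y x] by (auto intro: mult_right_mono)
  qed
  have "(LBINT y. H t y x * f y) \<le> (LBINT y. C * f y)"
  proof (rule integral_mono_AE')
    show "integrable lborel (\<lambda>y. C * f y)" using f(1) by (simp add: L1_def)
    show "AE y in lborel. H t y x * f y \<le> C * f y" using ae by eventually_elim simp
    show "AE y in lborel. 0 \<le> C * f y" using ae by eventually_elim linarith
  qed
  then show ?thesis by simp
qed

text \<open>
  The last hypothesis is available for almost every pair \<open>(a, b)\<close> with \<open>0 < a < b\<close>.
\<close>

lemma bounded_at_time:
  fixes u :: "real \<Rightarrow> 'a::euclidean_space \<Rightarrow> real"
  assumes H: "heat_kernel D A H"
    and G: "green_function D' A' G"
    and G_H: "\<And>x\<^sub>0. AE x in lborel. G x\<^sub>0 x = (LBINT t:{0<..}. exp (- t) * H t x\<^sub>0 x)"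
    and comparison: "comparison_principle G m" and m: "m > 1"
    and u: "global_weak_dual_solution G m u\<^sub>0 u"
    and H_bound: "\<And>t. t > 0 \<Longrightarrow> AE x in lborel. 0 \<le> H t 0 x \<and> H t 0 x \<le> C t"
    and C_int: "set_integrable lborel {0<..} (\<lambda>t. exp (- t) * C t powr r)" and r: "r > 0"
    and ab: "0 < a" "a < b"
    and ident: "\<And>\<psi> \<psi>'. C1_Linf_c a b \<psi> \<psi>' \<Longrightarrow> weak_dual_identity G m u a b \<psi> \<psi>'"
  shows "\<exists>M. AE x in lborel. u a x \<le> M"
proof -
  interpret sub_markov_semigroup "nn_heat H" by (rule sub_markov_semigroup_nn_heat[OF H])
  define \<kappa> where "\<kappa> = (b / a) powr (1 / (m - 1))"
  have \<kappa>: "\<kappa> > 0" unfolding \<kappa>_def using ab by simp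
  have um: "set_borel_measurable lborel ({a..b} \<times> UNIV) (\<lambda>(t, x). u t x)"
  proof (rule set_borel_measurable_subset)
    show "set_borel_measurable lborel ({0..b} \<times> UNIV) (\<lambda>(t, x). u t x)"
      by (rule weak_dual_solutionD(4)[OF u]) (use ab in simp)
  qed (use ab in \<open>auto simp: borel_prod[symmetric] intro!: pair_measureI\<close>)
  have L1: "u a \<in> L1" "u b \<in> L1"
    using weak_dual_solutionD(1)[OF u] ab by auto
  have nonneg: "AE x in lborel. 0 \<le> u t x" if "t \<in> {a..b}" for t
    using weak_dual_solutionD(2)[OF u, of t] that ab by auto
  have lower: "AE x in lborel. u a x \<le> \<kappa> * u t x" if t: "t \<in> {a..b}" for t
  proof -
    have le: "(t / a) powr (1 / (m - 1)) \<le> \<kappa>"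
      unfolding \<kappa>_def using ab t m by (intro powr_mono2 divide_right_mono) auto
    have "AE x in lborel. u a x \<le> (t / a) powr (1 / (m - 1)) * u t x"
      by (rule time_monotonicity[OF comparison m u]) (use ab t in auto)
    with nonneg[OF t] show ?thesis
    proof eventually_elim
      case (elim x)
      then show ?case using mult_right_mono[OF le elim(1)] by linarith
    qed
  qed
  have upper: "AE x in lborel. u t x \<le> \<kappa> * u b x" if t: "t \<in> {a..b}" for t
  proof -
    have le: "(b / t) powr (1 / (m - 1)) \<le> \<kappa>"
      unfolding \<kappa>_def using ab t m by (intro powr_mono2 divide_left_mono) auto
    have "AE x in lborel. u t x \<le> (b / t) powr (1 / (m - 1)) * u b x"
      by (rule time_monotonicity[OF comparison m u]) (use ab t in auto)
    moreover have "AE x in lborel. 0 \<le> u b x" using nonneg[of b] ab by simp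
    ultimately show ?thesis
    proof eventually_elim
      case (elim x)
      then show ?case using mult_right_mono[OF le elim(2)] by linarith
    qed
  qed
  define w where "w = accumulated_power m a b u"
  have bounds: "AE x in lborel. ennreal ((b - a) * (u a x / \<kappa>) powr m) \<le> w x \<and> w x \<le> ennreal ((b - a) * (\<kappa> * u b x) powr m)"
    unfolding w_def
    by (rule AE_accumulated_power_bounds[OF um L1_measurable[OF L1(1)] L1_measurable[OF L1(2)] nonneg lower upper ab(2) \<kappa>])
       (use m in auto)
  define k where "k = \<kappa> powr m / (b - a)"
  have k: "k \<ge> 0" unfolding k_def using ab by simp
  have f_le: "AE x in lborel. ennreal (u a x) \<le> 1 + ennreal k * w x"
    using bounds nonneg[of a, simplified, OF less_imp_le[OF ab(2)]]
  proof eventually_elim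
    case (elim x)
    have "u a x \<le> 1 + u a x powr m"
    proof (cases "u a x \<le> 1")
      case False
      then have "u a x powr 1 \<le> u a x powr m" using m by (intro powr_mono) auto
      then show ?thesis using False by simp
    qed (simp add: add_increasing2)
    also have "u a x powr m = k * ((b - a) * (u a x / \<kappa>) powr m)"
      unfolding k_def using ab \<kappa> elim(2) by (simp add: powr_divide)
    finally have "ennreal (u a x) \<le> ennreal (1 + k * ((b - a) * (u a x / \<kappa>) powr m))"
      by (rule ennreal_leI)
    also have "\<dots> = 1 + ennreal k * ennreal ((b - a) * (u a x / \<kappa>) powr m)"
      using k ab by (simp add: ennreal_plus ennreal_mult)
    also have "\<dots> \<le> 1 + ennreal k * w x"
      using elim(1) by (intro add_left_mono mult_left_mono) auto
    finally show ?case .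
  qed
  define K where "K = (b - a) powr (1 / m) * \<kappa>"
  have K: "K \<ge> 0" unfolding K_def using \<kappa> by simp
  have w_le: "AE x in lborel. enn2real (w x) powr (1 / m) \<le> K * u b x"
    using bounds nonneg[of b, simplified, OF less_imp_le[OF ab(2)]]
  proof eventually_elim
    case (elim x)
    have "enn2real (w x) \<le> (b - a) * (\<kappa> * u b x) powr m"
      using elim(1) ab by (intro enn2real_leI) auto
    then have "enn2real (w x) powr (1 / m) \<le> ((b - a) * (\<kappa> * u b x) powr m) powr (1 / m)"
      using m by (intro powr_mono2) auto
    also have "\<dots> = K * u b x"
      unfolding K_def using m \<kappa> elim(2) ab by (simp add: powr_mult powr_powr)
    finally show ?case .
  qed
  have C0: "C t \<ge> 0" if "t > 0" for t
    using AE_lborel_happens[OF H_bound[OF that]] by auto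
  have hC: "AE x in lborel. nn_heat H t x \<le> ennreal (C t)" if "t > 0" for t
    using H_bound[OF that] by eventually_elim (simp add: nn_heat_eq[OF that] ennreal_leI)
  note id = accumulated_power_identity[OF H G G_H um L1 nonneg nonneg ident, folded w_def]
  have "\<exists>M\<ge>0. AE x in lborel. w x \<le> ennreal M"
  proof (rule bounded_of_potential_identity[OF _ L1 _ _ k K nonneg nonneg f_le w_le _ _ C0 hC C_int r])
    show "w \<in> borel_measurable borel"
      unfolding w_def by (rule accumulated_power_measurable[OF um])
    show "AE x in lborel. w x + potential (\<lambda>y. ennreal (u b y)) x = potential (\<lambda>y. w y + ennreal (u a y)) x"
      by (rule id) (use ab in auto)
    show "AE x in lborel. w x + potential (\<lambda>y. ennreal (u b y)) x \<noteq> \<infinity>"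
      by (rule id) (use ab in auto)
  qed (use m ab in auto)
  then obtain M where M: "M \<ge> 0" "AE x in lborel. w x \<le> ennreal M" by blast
  have "AE x in lborel. u a x \<le> 1 + k * M"
    using f_le M(2)
  proof eventually_elim
    case (elim x)
    have "ennreal (u a x) \<le> 1 + ennreal k * ennreal M"
      using elim by (meson add_left_mono mult_left_mono order_trans zero_le)
    also have "\<dots> = ennreal (1 + k * M)"
      using k M(1) by (simp add: ennreal_plus ennreal_mult)
    finally show ?case using k M(1) by (subst (asm) ennreal_le_iff) auto
  qed
  then show ?thesis by blast
qed

theorem theorem3p9:
  fixes D :: "((real ^ 'n) \<Rightarrow> real) set"
    and A :: "((real ^ 'n) \<Rightarrow> real) \<Rightarrow> (real ^ 'n) \<Rightarrow> real"
    and H :: "real \<Rightarrow> (real ^ 'n) \<Rightarrow> (real ^ 'n) \<Rightarrow> real"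
    and G :: "(real ^ 'n) \<Rightarrow> (real ^ 'n) \<Rightarrow> real"
    and u\<^sub>0 :: "(real ^ 'n) \<Rightarrow> real"
    and u :: "real \<Rightarrow> (real ^ 'n) \<Rightarrow> real"
    and C :: "real \<Rightarrow> real"
    and p m :: real
  assumes N: "CARD('n) \<ge> 3"
    and p: "1 < p"
    and m: "1 \<le> m"
    and u0: "u\<^sub>0 \<in> L1" "AE x in lborel. 0 \<le> u\<^sub>0 x"
    and A: "admissible_operator D A"
    and H: "heat_kernel D A H"
    and G: "green_function D (\<lambda>f x. f x + A f x) G"
    and G_H: "\<And>x\<^sub>0. AE x in lborel. G x\<^sub>0 x = (LBINT t:{0<..}. exp (- t) * H t x\<^sub>0 x)"
    and comparison: "comparison_principle G m"
    and decay: "Lp_decay G m"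
    and u: "global_weak_dual_solution G m u\<^sub>0 u"
    and u_linear: "m = 1 \<Longrightarrow> (\<And>t. t > 0 \<Longrightarrow> AE x in lborel. u t x = (LBINT y. H t y x * u\<^sub>0 y))"
    and H_bound: "\<And>t x\<^sub>0. t > 0 \<Longrightarrow> AE x in lborel. 0 \<le> H t x\<^sub>0 x \<and> H t x\<^sub>0 x \<le> C t"
    and C_int: "set_integrable lborel {0<..} (\<lambda>t. exp (- t) * C t powr ((p - 1) / p))"
  shows "AE \<tau> in lborel. 0 < \<tau> \<longrightarrow>
    (\<exists>M. AE (t, x) in lborel. \<tau> \<le> t \<longrightarrow> \<bar>u t x\<bar> \<le> M)"
proof (rule bounded_of_bounded_at_AE_times[OF decay u])
  show "AE \<tau> in lborel. 0 < \<tau> \<longrightarrow> (\<exists>M. AE x in lborel. u \<tau> x \<le> M)"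
  proof (cases "m = 1")
    case True
    show ?thesis
    proof (intro AE_I2 impI)
      fix \<tau> :: real assume \<tau>: "0 < \<tau>"
      have "AE x in lborel. u \<tau> x \<le> C \<tau> * (LBINT y. u\<^sub>0 y)"
        using u_linear[OF True \<tau>]
        by eventually_elim (simp add: heat_kernel_convolution_le[OF H \<tau> H_bound[OF \<tau>] u0])
      then show "\<exists>M. AE x in lborel. u \<tau> x \<le> M" by blast
    qed
  next
    case False
    with m have m1: "m > 1" by simp
    have "AE (\<tau>\<^sub>1, \<tau>\<^sub>2) in lborel. 0 < \<tau>\<^sub>1 \<and> \<tau>\<^sub>1 \<le> \<tau>\<^sub>2 \<and> \<tau>\<^sub>2 \<le> real (Suc n) \<longrightarrow>
       (\<forall>\<psi> \<psi>'. C1_Linf_c \<tau>\<^sub>1 \<tau>\<^sub>2 \<psi> \<psi>' \<longrightarrow> weak_dual_identity G m u \<tau>\<^sub>1 \<tau>\<^sub>2 \<psi> \<psi>')" for n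
    proof -
      have "weak_dual_solution G m (real (Suc n)) u\<^sub>0 u"
        using u unfolding global_weak_dual_solution_def by simp
      then show ?thesis unfolding weak_dual_solution_def by blast
    qed
    then have "AE z in lborel. \<forall>n. case z of (\<tau>\<^sub>1, \<tau>\<^sub>2) \<Rightarrow> 0 < \<tau>\<^sub>1 \<and> \<tau>\<^sub>1 \<le> \<tau>\<^sub>2 \<and> \<tau>\<^sub>2 \<le> real (Suc n) \<longrightarrow>
       (\<forall>\<psi> \<psi>'. C1_Linf_c \<tau>\<^sub>1 \<tau>\<^sub>2 \<psi> \<psi>' \<longrightarrow> weak_dual_identity G m u \<tau>\<^sub>1 \<tau>\<^sub>2 \<psi> \<psi>')"
      unfolding AE_all_countable by blast
    then have "AE z in lborel \<Otimes>\<^sub>M lborel. \<forall>n. case z of (\<tau>\<^sub>1, \<tau>\<^sub>2) \<Rightarrow> 0 < \<tau>\<^sub>1 \<and> \<tau>\<^sub>1 \<le> \<tau>\<^sub>2 \<and> \<tau>\<^sub>2 \<le> real (Suc n) \<longrightarrow>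
       (\<forall>\<psi> \<psi>'. C1_Linf_c \<tau>\<^sub>1 \<tau>\<^sub>2 \<psi> \<psi>' \<longrightarrow> weak_dual_identity G m u \<tau>\<^sub>1 \<tau>\<^sub>2 \<psi> \<psi>')"
      unfolding lborel_prod .
    from lborel_pair.AE_pair[OF this] show ?thesis
    proof eventually_elim
      case (elim a)
      show ?case
      proof
        assume a: "0 < a"
        \<comment> \<open>almost every \<open>b\<close> is admissible for the given \<open>a\<close>, so there is one in \<open>(a, a + 1)\<close>\<close>
        obtain b where b: "a < b" "\<forall>n. case (a, b) of (\<tau>\<^sub>1, \<tau>\<^sub>2) \<Rightarrow> 0 < \<tau>\<^sub>1 \<and> \<tau>\<^sub>1 \<le> \<tau>\<^sub>2 \<and> \<tau>\<^sub>2 \<le> real (Suc n) \<longrightarrow>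
            (\<forall>\<psi> \<psi>'. C1_Linf_c \<tau>\<^sub>1 \<tau>\<^sub>2 \<psi> \<psi>' \<longrightarrow> weak_dual_identity G m u \<tau>\<^sub>1 \<tau>\<^sub>2 \<psi> \<psi>')"
          using AE_lborel_happens_between[OF elim, of a "a + 1"] by auto
        obtain n :: nat where n: "b \<le> real n" using real_arch_simple by blast
        then have "b \<le> real (Suc n)" by simp
        with a b have ident: "weak_dual_identity G m u a b \<psi> \<psi>'" if "C1_Linf_c a b \<psi> \<psi>'" for \<psi> \<psi>'
          using that less_imp_le[OF b(1)] unfolding case_prod_conv by blast
        show "\<exists>M. AE x in lborel. u a x \<le> M"
          by (rule bounded_at_time[OF H G G_H comparison m1 u H_bound C_int _ a b(1) ident]) (use p in auto)
      qed
    qed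
  qed
qed

end
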